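(* Let $\mathbf{k}$ be a field, $A$ a (not necessarily commutative) noetherian domain which is a $\mathbf{k}$-algebra, $\mathcal{G}$ a Lie algebra over $\mathbf{k}$, and $B=A\star U\mathcal{G}$ a crossed product (all rings being assumed to have the IBN property). Let $g\in\mathcal{G}$ be a nonzero element, let $\mathcal{G}_1=\mathbf{k}g$ be the one-dimensional Lie subalgebra it generates, and let $A_1=A\star U\mathcal{G}_1=A[g,\delta]$ be the subalgebra of $B$ generated by $A$ and $\bar g$, where $\delta=\delta_g$. Let $K$ be a right ideal of $A_1$ which is stably free but not free as a right $A_1$-module. Then the induced right ideal $K\otimes_{A_1}B$ of $B$ (identified with $KB\subseteq B$) is stably free but not free as a right $B$-module.
   Context: All rings are unital, all modules are unital, and all rings are assumed to have the invariant basis number (IBN) property. Crossed product: let $A$ be a $\mathbf{k}$-algebra and $\mathcal{G}$ a Lie algebra over $\mathbf{k}$ with a (totally ordered) basis $\{g_i\mid i\in I\}$. A $\mathbf{k}$-algebra $B$ containing $A$ is called a crossed product, denoted $A\star U\mathcal{G}$, if there is an embedding of linear spaces $\mathcal{G}\hookrightarrow B$, $g\mapsto\bar g$, such that: (1) $\bar g r-r\bar g\in A$ for all $g\in\mathcal{G}$, $r\in A$, and $\delta_g(r):=\bar g r-r\bar g$ is a derivation of $A$; (2) $\bar g\bar h-\bar h\bar g\equiv\overline{[g,h]}$ modulo $A$ for all $g,h\in\mathcal{G}$; (3) $B$ is a free (right) $A$-module with the commutative (i.e. ordered) monomials $\bar g_1^{j_1}\cdots\bar g_m^{j_m}$ in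 the $g_i$, $i\in I$, as a basis. For a nonzero $g\in\mathcal{G}$ with $\mathcal{G}_1=\mathbf{k}g$, the subalgebra $A\star U\mathcal{G}_1$ of $B$ consists of the sums $\sum_i a_i\bar g^i$ with $a_i\in A$; it is isomorphic to the differential Ore extension $A[g,\delta_g]$. A finitely generated module $M$ over a ring $R$ is stably free if $M\oplus R^n\cong R^m$ for some nonnegative integers $n,m$. *)

theory Defs
  imports Complex_Main "HOL-Library.Poly_Mapping" "HOL-Library.Function_Algebras" "HOL-Library.Product_Plus"
    HOL.Hull
begin

text \<open>Rings are subrings of an ambient unital ring, given by their carrier sets; the type class
  \<open>ring_1\<close> includes \<open>0 \<noteq> 1\<close>. A right module over a ring with carrier \<open>R\<close> is given by its
  carrier \<open>M\<close> and its right action \<open>act x r\<close>.\<close>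

subsection \<open>Ideals, noetherian rings, domains\<close>

definition right_ideal :: "'r::ring_1 set \<Rightarrow> 'r set \<Rightarrow> bool" where
  "right_ideal R K \<longleftrightarrow> K \<subseteq> R \<and> 0 \<in> K \<and> (\<forall>x\<in>K. \<forall>y\<in>K. x - y \<in> K) \<and> (\<forall>x\<in>K. \<forall>r\<in>R. x * r \<in> K)"

definition left_ideal :: "'r::ring_1 set \<Rightarrow> 'r set \<Rightarrow> bool" where
  "left_ideal R K \<longleftrightarrow> K \<subseteq> R \<and> 0 \<in> K \<and> (\<forall>x\<in>K. \<forall>y\<in>K. x - y \<in> K) \<and> (\<forall>x\<in>K. \<forall>r\<in>R. r * x \<in> K)"

definition noetherian :: "'r::ring_1 set \<Rightarrow> bool" where
  "noetherian R \<longleftrightarrow>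
     (\<forall>J::nat \<Rightarrow> 'r set. (\<forall>n. right_ideal R (J n)) \<and> mono J \<longrightarrow> (\<exists>N. \<forall>n\<ge>N. J n = J N)) \<and>
     (\<forall>J::nat \<Rightarrow> 'r set. (\<forall>n. left_ideal R (J n)) \<and> mono J \<longrightarrow> (\<exists>N. \<forall>n\<ge>N. J n = J N))"

definition nc_domain :: "'r::ring_1 set \<Rightarrow> bool" where
  "nc_domain R \<longleftrightarrow> (\<forall>x\<in>R. \<forall>y\<in>R. x * y = 0 \<longrightarrow> x = 0 \<or> y = 0)"

subsection \<open>Free and stably free right modules\<close>

text \<open>The family \<open>f j\<close>, \<open>j \<in> J\<close>, is a basis of the right \<open>R\<close>-module \<open>M\<close>: every element
  is a unique finite right linear combination.\<close>

definition is_right_basis ::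
  "'r::ring_1 set \<Rightarrow> ('m::ab_group_add \<Rightarrow> 'r \<Rightarrow> 'm) \<Rightarrow> 'm set \<Rightarrow> 'j set \<Rightarrow> ('j \<Rightarrow> 'm) \<Rightarrow> bool" where
  "is_right_basis R act M J f \<longleftrightarrow> f ` J \<subseteq> M \<and>
     (\<forall>x\<in>M. \<exists>!c. (\<forall>j. c j \<in> R) \<and> finite {j. c j \<noteq> 0} \<and> {j. c j \<noteq> 0} \<subseteq> J \<and>
        x = (\<Sum>j | c j \<noteq> 0. act (f j) (c j)))"

definition free_module ::
  "'r::ring_1 set \<Rightarrow> ('m::ab_group_add \<Rightarrow> 'r \<Rightarrow> 'm) \<Rightarrow> 'm set \<Rightarrow> bool" where
  "free_module R act M \<longleftrightarrow> (\<exists>X. is_right_basis R act M X (\<lambda>x. x))"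

definition fg_module ::
  "'r::ring_1 set \<Rightarrow> ('m::ab_group_add \<Rightarrow> 'r \<Rightarrow> 'm) \<Rightarrow> 'm set \<Rightarrow> bool" where
  "fg_module R act M \<longleftrightarrow> (\<exists>X\<subseteq>M. finite X \<and>
     (\<forall>x\<in>M. \<exists>c. (\<forall>y\<in>X. c y \<in> R) \<and> x = (\<Sum>y\<in>X. act y (c y))))"

definition module_isomorphic ::
  "'r::ring_1 set \<Rightarrow> ('m::ab_group_add \<Rightarrow> 'r \<Rightarrow> 'm) \<Rightarrow> 'm set \<Rightarrow>
   ('n::ab_group_add \<Rightarrow> 'r \<Rightarrow> 'n) \<Rightarrow> 'n set \<Rightarrow> bool" where
  "module_isomorphic R actM M actN N \<longleftrightarrow> (\<exists>f. bij_betw f M N \<and>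
     (\<forall>x\<in>M. \<forall>y\<in>M. f (x + y) = f x + f y) \<and> (\<forall>x\<in>M. \<forall>r\<in>R. f (actM x r) = actN (f x) r))"

text \<open>The right module \<open>R\<^sup>n\<close>, as sequences vanishing from index \<open>n\<close> on.\<close>

definition power_module :: "'r::ring_1 set \<Rightarrow> nat \<Rightarrow> (nat \<Rightarrow> 'r) set" where
  "power_module R n = {v. (\<forall>i<n. v i \<in> R) \<and> (\<forall>i\<ge>n. v i = 0)}"

definition power_act :: "(nat \<Rightarrow> 'r::ring_1) \<Rightarrow> 'r \<Rightarrow> nat \<Rightarrow> 'r" where
  "power_act v r = (\<lambda>i. v i * r)"

definition sum_act ::
  "('m \<Rightarrow> 'r \<Rightarrow> 'm) \<Rightarrow> ('n \<Rightarrow> 'r \<Rightarrow> 'n) \<Rightarrow> 'm \<times> 'n \<Rightarrow> 'r \<Rightarrow> 'm \<times> 'n" where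
  "sum_act actM actN p r = (actM (fst p) r, actN (snd p) r)"

definition stably_free ::
  "'r::ring_1 set \<Rightarrow> ('m::ab_group_add \<Rightarrow> 'r \<Rightarrow> 'm) \<Rightarrow> 'm set \<Rightarrow> bool" where
  "stably_free R act M \<longleftrightarrow> fg_module R act M \<and>
     (\<exists>n m. module_isomorphic R (sum_act act power_act) (M \<times> power_module R n)
                                power_act (power_module R m))"

definition IBN :: "'r::ring_1 set \<Rightarrow> bool" where
  "IBN R \<longleftrightarrow> (\<forall>n m. module_isomorphic R power_act (power_module R n) power_act (power_module R m)
                     \<longrightarrow> n = m)"

subsection \<open>Tensor products\<close>

text \<open>The free abelian group on \<open>M \<times> N\<close> consists of the integer-valued finitely supported functions
  whose keys lie in \<open>M \<times> N\<close>; the following is its subgroup generated by the relations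
  defining \<open>M \<otimes>\<^sub>R N\<close>, for a right module \<open>M\<close> (action \<open>x r\<close> written \<open>actr x r\<close>)
  and a left module \<open>N\<close> (action \<open>r y\<close> written \<open>actl r y\<close>).\<close>

inductive_set tensor_relations ::
  "'r set \<Rightarrow> ('m::ab_group_add \<Rightarrow> 'r \<Rightarrow> 'm) \<Rightarrow> 'm set \<Rightarrow> ('r \<Rightarrow> 'n::ab_group_add \<Rightarrow> 'n) \<Rightarrow> 'n set
   \<Rightarrow> ('m \<times> 'n \<Rightarrow>\<^sub>0 int) set"
  for R actr M actl N where
  zero: "0 \<in> tensor_relations R actr M actl N"
| diff: "\<lbrakk>u \<in> tensor_relations R actr M actl N; v \<in> tensor_relations R actr M actl N\<rbrakk>
         \<Longrightarrow> u - v \<in> tensor_relations R actr M actl N"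
| add_left: "\<lbrakk>x \<in> M; x' \<in> M; y \<in> N\<rbrakk> \<Longrightarrow>
    frag_of (x + x', y) - frag_of (x, y) - frag_of (x', y) \<in> tensor_relations R actr M actl N"
| add_right: "\<lbrakk>x \<in> M; y \<in> N; y' \<in> N\<rbrakk> \<Longrightarrow>
    frag_of (x, y + y') - frag_of (x, y) - frag_of (x, y') \<in> tensor_relations R actr M actl N"
| balanced: "\<lbrakk>x \<in> M; r \<in> R; y \<in> N\<rbrakk> \<Longrightarrow>
    frag_of (actr x r, y) - frag_of (x, actl r y) \<in> tensor_relations R actr M actl N"

text \<open>The group \<open>T\<close> together with \<open>\<tau> : M \<times> N \<rightarrow> T\<close> is the tensor product: the additive
  extension of \<open>\<tau>\<close> to the free abelian group on \<open>M \<times> N\<close> maps onto \<open>T\<close>, with kernel the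
  tensor relations, so that \<open>x \<otimes> y \<mapsto> \<tau> x y\<close> is an isomorphism \<open>M \<otimes>\<^sub>R N \<cong> T\<close>.\<close>

definition is_tensor_product ::
  "'r set \<Rightarrow> ('m::ab_group_add \<Rightarrow> 'r \<Rightarrow> 'm) \<Rightarrow> 'm set \<Rightarrow> ('r \<Rightarrow> 'n::ab_group_add \<Rightarrow> 'n) \<Rightarrow> 'n set
   \<Rightarrow> 't::ab_group_add set \<Rightarrow> ('m \<Rightarrow> 'n \<Rightarrow> 't) \<Rightarrow> bool" where
  "is_tensor_product R actr M actl N T \<tau> \<longleftrightarrow>
     (\<exists>\<phi>. Modules.additive \<phi> \<and> (\<forall>x\<in>M. \<forall>y\<in>N. \<phi> (frag_of (x, y)) = \<tau> x y) \<and>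
          \<phi> ` {c. Poly_Mapping.keys c \<subseteq> M \<times> N} = T \<and>
          {c. Poly_Mapping.keys c \<subseteq> M \<times> N \<and> \<phi> c = 0} = tensor_relations R actr M actl N)"

text \<open>For a right ideal \<open>K\<close> and a ring \<open>B\<close>, the right ideal \<open>KB\<close> of finite sums of products.\<close>

definition extend_ideal :: "'b::ring_1 set \<Rightarrow> 'b set \<Rightarrow> 'b set" where
  "extend_ideal K B = {\<Sum>i<n. x i * y i | (n::nat) x y. (\<forall>i<n. x i \<in> K \<and> y i \<in> B)}"

subsection \<open>Algebras, Lie algebras and crossed products\<close>

locale nc_algebra = vector_space scale
  for scale :: "'k::field \<Rightarrow> 'b::ring_1 \<Rightarrow> 'b" +
  assumes scale_mult_left: "scale c x * y = scale c (x * y)"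
    and scale_mult_right: "x * scale c y = scale c (x * y)"

definition subalgebra :: "('k \<Rightarrow> 'b::ring_1 \<Rightarrow> 'b) \<Rightarrow> 'b set \<Rightarrow> bool" where
  "subalgebra scale S \<longleftrightarrow> 1 \<in> S \<and> (\<forall>x\<in>S. \<forall>y\<in>S. x - y \<in> S) \<and> (\<forall>x\<in>S. \<forall>y\<in>S. x * y \<in> S) \<and>
     (\<forall>c. \<forall>x\<in>S. scale c x \<in> S)"

definition derivation :: "('k \<Rightarrow> 'b::ring_1 \<Rightarrow> 'b) \<Rightarrow> 'b set \<Rightarrow> ('b \<Rightarrow> 'b) \<Rightarrow> bool" where
  "derivation scale A d \<longleftrightarrow> (\<forall>x\<in>A. d x \<in> A) \<and> (\<forall>x\<in>A. \<forall>y\<in>A. d (x + y) = d x + d y) \<and>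
     (\<forall>c. \<forall>x\<in>A. d (scale c x) = scale c (d x)) \<and>
     (\<forall>x\<in>A. \<forall>y\<in>A. d (x * y) = d x * y + x * d y)"

locale lie_algebra = vector_space scale
  for scale :: "'k::field \<Rightarrow> 'g::ab_group_add \<Rightarrow> 'g" +
  fixes bracket :: "'g \<Rightarrow> 'g \<Rightarrow> 'g"
  assumes bracket_add_left: "bracket (x + y) z = bracket x z + bracket y z"
    and bracket_add_right: "bracket x (y + z) = bracket x y + bracket x z"
    and bracket_scale_left: "bracket (scale c x) y = scale c (bracket x y)"
    and bracket_scale_right: "bracket x (scale c y) = scale c (bracket x y)"
    and bracket_self: "bracket x x = 0"
    and jacobi: "bracket x (bracket y z) + bracket y (bracket z x) + bracket z (bracket x y) = 0"

text \<open>The ordered monomial with exponents \<open>p\<close>, the indices increasing from left to right.\<close>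

definition ordered_monomial :: "('i::linorder \<Rightarrow> 'b::ring_1) \<Rightarrow> ('i \<Rightarrow>\<^sub>0 nat) \<Rightarrow> 'b" where
  "ordered_monomial u p =
     prod_list (map (\<lambda>i. u i ^ Poly_Mapping.lookup p i) (sorted_list_of_set (Poly_Mapping.keys p)))"

text \<open>The type \<open>'b\<close> is the crossed product \<open>A \<star> U\<G>\<close>, where \<open>\<G>\<close> is the type \<open>'g\<close>, with basis
  \<open>e i\<close>, \<open>i \<in> I\<close>, and \<open>bar\<close> is the embedding \<open>g \<mapsto> \<bar>g\<close>.\<close>

locale crossed_product =
  B: nc_algebra scaleB + G: lie_algebra scaleG bracket
  for scaleB :: "'k::field \<Rightarrow> 'b::ring_1 \<Rightarrow> 'b"
    and scaleG :: "'k \<Rightarrow> 'g::ab_group_add \<Rightarrow> 'g"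
    and bracket :: "'g \<Rightarrow> 'g \<Rightarrow> 'g" +
  fixes A :: "'b set" and I :: "'i::linorder set" and e :: "'i \<Rightarrow> 'g" and bar :: "'g \<Rightarrow> 'b"
  assumes subalgebra_A: "subalgebra scaleB A"
    and basis_inj: "inj_on e I"
    and basis_independent: "G.independent (e ` I)"
    and basis_span: "G.span (e ` I) = UNIV"
    and bar_linear: "Vector_Spaces.linear scaleG scaleB bar"
    and bar_inj: "inj bar"
    and commutator_derivation: "derivation scaleB A (\<lambda>r. bar x * r - r * bar x)"
    and commutator_bracket: "(bar x * bar y - bar y * bar x) - bar (bracket x y) \<in> A"
    and monomial_basis:
      "is_right_basis A (*) UNIV {p. Poly_Mapping.keys p \<subseteq> I} (ordered_monomial (\<lambda>i. bar (e i)))"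

end

theory Submission
  imports Defs
begin

text \<open>
  Write \<open>A\<^sub>1 = A[g; \<delta>]\<close>. Two properties of the inclusion \<open>A\<^sub>1 \<subseteq> B\<close> carry the theorem.

  First, \<open>B\<close> is free as a left \<open>A\<^sub>1\<close>-module on a basis that contains \<open>1\<close>. Hence an element of \<open>B\<close> lies
  in \<open>KB\<close> if and only if all its left coordinates lie in \<open>K\<close>. Statements about \<open>KB\<close> can then be
  checked coordinate by coordinate: \<open>K \<otimes> B \<rightarrow> KB\<close> is bijective, an isomorphism
  \<open>K \<oplus> A\<^sub>1\<^sup>n \<cong> A\<^sub>1\<^sup>l\<close>, which is given by a matrix, stays an isomorphism over \<open>B\<close> with the same matrix,
  and \<open>KB \<inter> A\<^sub>1 = K\<close>.

  Second, \<open>A\<^sub>1\<close> is factor closed: a nonzero product of two elements of \<open>B\<close> lies in \<open>A\<^sub>1\<close> only if both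
  factors do. Suppose now that \<open>KB\<close> is free. The noetherian domain \<open>A\<close> is right Ore, and so is \<open>A\<^sub>1\<close>
  by a count of coefficients. The right ideal \<open>K\<close> of \<open>A\<^sub>1\<close> is nonzero, since \<open>0\<close> is free, so it has
  rank one, that is \<open>l = n + 1\<close>. By IBN for \<open>B\<close>, the basis of \<open>KB\<close> has one element, so \<open>KB = bB\<close>. A nonzero
  \<open>a \<in> K\<close> is a product \<open>bc\<close> that lies in \<open>A\<^sub>1\<close>, so \<open>b \<in> A\<^sub>1 \<inter> KB = K\<close>. Likewise every nonzero element of \<open>K\<close>
  is \<open>bc\<close> with \<open>c \<in> A\<^sub>1\<close>, so \<open>K = bA\<^sub>1\<close> is free, against the hypothesis. This part is
  \<open>free_extend_imp_free\<close> and holds for any right Ore domain in place of \<open>A\<^sub>1\<close> whose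
  inclusion into \<open>B\<close> has the two properties.

  Both properties come from filtrations of \<open>B\<close>. Give the basis vectors of \<open>\<G>\<close> positive
  weights such that no weight reaches the sum of the weights of two distinct basis vectors. Then the
  commutators of the variables with each other and with \<open>A\<close> are of lower weight than the products,
  and the leading part of a product in \<open>B\<close> is computed as in a
  polynomial ring over \<open>A\<close> with central variables (\<open>term_mult_lead\<close>). Three choices of the weights are
  used. With weight 3 for one basis vector that occurs in \<open>g\<close> and 2 for all others, \<open>bar g\<close> has the
  leading part of that basis vector up to a scalar, so that \<open>g\<close> can be exchanged into the basis.
  With all weights 1, the products \<open>g\<^sup>n a h\<close>, where \<open>h\<close> is an ordered monomial without \<open>g\<close>, are
  triangular with respect to the ordered monomials times \<open>a\<close>; this gives the left basis. With weight 1
  for \<open>g\<close> and a large weight for all others, a leading monomial which is a power of \<open>g\<close> forces all the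
  monomials of the element to be powers of \<open>g\<close>; this gives factor closedness.
\<close>

section \<open>Subrings, combinations and bases\<close>

definition unital_subring :: "'r::ring_1 set \<Rightarrow> bool" where
  "unital_subring R \<longleftrightarrow> 1 \<in> R \<and> (\<forall>x\<in>R. \<forall>y\<in>R. x - y \<in> R) \<and> (\<forall>x\<in>R. \<forall>y\<in>R. x * y \<in> R)"

lemma unital_subringD:
  assumes "unital_subring R"
  shows "1 \<in> R" "0 \<in> R" "x \<in> R \<Longrightarrow> y \<in> R \<Longrightarrow> x - y \<in> R" "x \<in> R \<Longrightarrow> y \<in> R \<Longrightarrow> x + y \<in> R"
    "x \<in> R \<Longrightarrow> y \<in> R \<Longrightarrow> x * y \<in> R" "x \<in> R \<Longrightarrow> - x \<in> R"
proof -
  show 1: "1 \<in> R" and d: "\<And>x y. x \<in> R \<Longrightarrow> y \<in> R \<Longrightarrow> x - y \<in> R"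
    and "x \<in> R \<Longrightarrow> y \<in> R \<Longrightarrow> x * y \<in> R"
    using assms by (auto simp: unital_subring_def)
  show z: "0 \<in> R" using d[OF 1 1] by simp
  show m: "\<And>x. x \<in> R \<Longrightarrow> - x \<in> R" using d[OF z] by simp
  show "x \<in> R \<Longrightarrow> y \<in> R \<Longrightarrow> x + y \<in> R" using d[of x "- y"] m by simp
qed

lemma unital_subring_sum:
  assumes "unital_subring R" and "\<And>i. i \<in> F \<Longrightarrow> f i \<in> R"
  shows "sum f F \<in> R"
  using assms(2) by (induction F rule: infinite_finite_induct) (auto simp: unital_subringD[OF assms(1)])

text \<open>The function \<open>f j\<close> is left or right multiplication by a basis element, so that spans on
  both sides are covered.\<close>

definition combinations :: "('j \<Rightarrow> 'b \<Rightarrow> 'b) \<Rightarrow> 'j set \<Rightarrow> 'b set \<Rightarrow> 'b::ring_1 set" where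
  "combinations f J R = {x. \<exists>F c. finite F \<and> F \<subseteq> J \<and> (\<forall>j\<in>F. c j \<in> R) \<and> x = (\<Sum>j\<in>F. f j (c j))}"

lemma combinations_0: "0 \<in> combinations f J R"
  unfolding combinations_def mem_Collect_eq by (rule exI[of _ "{}"], rule exI[of _ "\<lambda>_. 0"]) simp

lemma combinations_single:
  assumes "j \<in> J" "a \<in> R" shows "f j a \<in> combinations f J R"
  unfolding combinations_def mem_Collect_eq
  by (rule exI[of _ "{j}"], rule exI[of _ "\<lambda>_. a"]) (simp add: assms)

lemma combinations_add:
  assumes R: "unital_subring R" and f: "\<And>j a b. f j (a + b) = f j a + f j b"
    and x: "x \<in> combinations f J R" and y: "y \<in> combinations f J R"
  shows "x + y \<in> combinations f J R"
proof -
  have f0: "f j 0 = 0" for j using f[of j 0 0] by simp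
  obtain F c where F: "finite F" "F \<subseteq> J" "\<forall>j\<in>F. c j \<in> R" and x': "x = (\<Sum>j\<in>F. f j (c j))"
    using x unfolding combinations_def mem_Collect_eq by (elim exE conjE)
  obtain G d where G: "finite G" "G \<subseteq> J" "\<forall>j\<in>G. d j \<in> R" and y': "y = (\<Sum>j\<in>G. f j (d j))"
    using y unfolding combinations_def mem_Collect_eq by (elim exE conjE)
  let ?c = "\<lambda>j. if j \<in> F then c j else 0" and ?d = "\<lambda>j. if j \<in> G then d j else 0"
  have "x = (\<Sum>j\<in>F \<union> G. f j (?c j))"
    unfolding x' using F(1) G(1) by (intro sum.mono_neutral_cong_left) (auto simp: f0)
  moreover have "y = (\<Sum>j\<in>F \<union> G. f j (?d j))"
    unfolding y' using F(1) G(1) by (intro sum.mono_neutral_cong_left) (auto simp: f0)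
  ultimately have xy: "x + y = (\<Sum>j\<in>F \<union> G. f j (?c j + ?d j))"
    by (simp only: f sum.distrib)
  have mem: "\<forall>j\<in>F \<union> G. ?c j + ?d j \<in> R"
    using F(3) G(3) unital_subringD(2,4)[OF R] by simp
  show ?thesis
    unfolding combinations_def mem_Collect_eq
    by (rule exI[of _ "F \<union> G"], rule exI[of _ "\<lambda>j. ?c j + ?d j"], intro conjI xy mem)
      (use F(1,2) G(1,2) in simp_all)
qed

lemma is_right_basisI:
  fixes f :: "'j \<Rightarrow> 'r::ring_1"
  assumes R: "unital_subring R" and f: "f ` J \<subseteq> M"
    and span: "M \<subseteq> combinations (\<lambda>j a. f j * a) J R"
    and indep: "\<And>F c j. \<lbrakk>finite F; F \<subseteq> J; \<And>j. j \<in> F \<Longrightarrow> c j \<in> R; (\<Sum>j\<in>F. f j * c j) = 0; j \<in> F\<rbrakk> \<Longrightarrow> c j = 0"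
  shows "is_right_basis R (*) M J f"
  unfolding is_right_basis_def
proof (intro conjI ballI f ex_ex1I)
  fix x assume "x \<in> M"
  then obtain F c where F: "finite F" "F \<subseteq> J" "\<forall>j\<in>F. c j \<in> R" and x: "x = (\<Sum>j\<in>F. f j * c j)"
    using span unfolding combinations_def by blast
  let ?c = "\<lambda>j. if j \<in> F then c j else 0"
  have s: "{j. ?c j \<noteq> 0} \<subseteq> F" by auto
  have "(\<Sum>j | ?c j \<noteq> 0. f j * ?c j) = (\<Sum>j\<in>F. f j * c j)"
    using F(1) s by (intro sum.mono_neutral_cong_left) auto
  then have "x = (\<Sum>j | ?c j \<noteq> 0. f j * ?c j)" by (simp only: x)
  moreover have "\<forall>j. ?c j \<in> R" using F(3) unital_subringD(2)[OF R] by simp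
  moreover have "finite {j. ?c j \<noteq> 0}" using s F(1) by (rule finite_subset)
  moreover have "{j. ?c j \<noteq> 0} \<subseteq> J" using s F(2) by (rule order_trans)
  ultimately show "\<exists>c. (\<forall>j. c j \<in> R) \<and> finite {j. c j \<noteq> 0} \<and> {j. c j \<noteq> 0} \<subseteq> J \<and>
      x = (\<Sum>j | c j \<noteq> 0. f j * c j)"
    by (intro exI[of _ ?c] conjI)
next
  fix x a b
  assume "(\<forall>j. a j \<in> R) \<and> finite {j. a j \<noteq> 0} \<and> {j. a j \<noteq> 0} \<subseteq> J \<and> x = (\<Sum>j | a j \<noteq> 0. f j * a j)"
    and "(\<forall>j. b j \<in> R) \<and> finite {j. b j \<noteq> 0} \<and> {j. b j \<noteq> 0} \<subseteq> J \<and> x = (\<Sum>j | b j \<noteq> 0. f j * b j)"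
  then have a: "\<And>j. a j \<in> R" "finite {j. a j \<noteq> 0}" "{j. a j \<noteq> 0} \<subseteq> J" "x = (\<Sum>j | a j \<noteq> 0. f j * a j)"
    and b: "\<And>j. b j \<in> R" "finite {j. b j \<noteq> 0}" "{j. b j \<noteq> 0} \<subseteq> J" "x = (\<Sum>j | b j \<noteq> 0. f j * b j)"
    by (elim conjE; assumption | blast)+
  let ?F = "{j. a j \<noteq> 0} \<union> {j. b j \<noteq> 0}"
  have "x = (\<Sum>j\<in>?F. f j * a j)"
    by (rule trans[OF a(4)], rule sum.mono_neutral_left) (use a(2) b(2) in auto)
  moreover have "x = (\<Sum>j\<in>?F. f j * b j)"
    by (rule trans[OF b(4)], rule sum.mono_neutral_left) (use a(2) b(2) in auto)
  ultimately have "(\<Sum>j\<in>?F. f j * (a j - b j)) = x - x"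
    by (simp only: right_diff_distrib sum_subtractf)
  then have 0: "(\<Sum>j\<in>?F. f j * (a j - b j)) = 0" by simp
  have "a j - b j = 0" if "j \<in> ?F" for j
    by (rule indep[OF _ _ _ 0 that]) (use a(1-3) b(1-3) unital_subringD(3)[OF R] in auto)
  then show "a = b" by (intro ext) force
qed

section \<open>Right Ore domains\<close>

definition right_ore :: "'r::ring_1 set \<Rightarrow> bool" where
  "right_ore R \<longleftrightarrow> (\<forall>a\<in>R. \<forall>b\<in>R. a \<noteq> 0 \<longrightarrow> b \<noteq> 0 \<longrightarrow> (\<exists>s\<in>R. \<exists>t\<in>R. a * s = b * t \<and> a * s \<noteq> 0))"

lemma right_oreD:
  assumes "right_ore R" "a \<in> R" "b \<in> R" "a \<noteq> 0" "b \<noteq> 0"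
  obtains s t where "s \<in> R" "t \<in> R" "a * s = b * t" "a * s \<noteq> 0"
  using assms unfolding right_ore_def by blast

lemma nc_domainD: "nc_domain R \<Longrightarrow> x \<in> R \<Longrightarrow> y \<in> R \<Longrightarrow> x * y = 0 \<Longrightarrow> x = 0 \<or> y = 0"
  unfolding nc_domain_def by blast

text \<open>If \<open>aR \<inter> bR = 0\<close> with \<open>a, b \<noteq> 0\<close>, then \<open>b, ab, a\<^sup>2b, \<dots>\<close> are right linearly independent, because a
  relation between them can be divided by \<open>a\<close> on the left after its first term is split off.
  The right ideals that they generate then form a strictly ascending chain.\<close>

lemma noetherian_domain_right_ore:
  assumes R: "unital_subring R" and dom: "nc_domain R" and noeth: "noetherian R"
  shows "right_ore R"
proof (rule ccontr)
  note closed = unital_subringD[OF R]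
  assume "\<not> right_ore R"
  then obtain a b where a: "a \<in> R" "a \<noteq> 0" and b: "b \<in> R" "b \<noteq> 0"
    and disjoint: "\<And>s t. s \<in> R \<Longrightarrow> t \<in> R \<Longrightarrow> a * s = b * t \<Longrightarrow> a * s = 0"
    unfolding right_ore_def by blast
  have pow: "a ^ i * b * c \<in> R" if "c \<in> R" for i c
    using a b that by (induction i) (auto simp: mult.assoc closed(5))
  have indep: "c i = 0" if "\<And>i. c i \<in> R" "(\<Sum>i<n. a ^ i * b * c i) = 0" "i < n" for n i c
    using that
  proof (induction n arbitrary: c i)
    case (Suc n)
    let ?s = "\<Sum>i<n. a ^ i * b * c (Suc i)"
    have s: "?s \<in> R" using Suc.prems(1) pow by (intro unital_subring_sum[OF R]) auto
    have "(\<Sum>i<Suc n. a ^ i * b * c i) = b * c 0 + a * ?s"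
      by (simp only: sum.lessThan_Suc_shift) (simp add: sum_distrib_left mult.assoc)
    then have eq: "b * c 0 + a * ?s = 0" using Suc.prems(2) by simp
    then have "a * ?s = b * (- c 0)" by (metis add.commute minus_unique minus_mult_right)
    then have as: "a * ?s = 0" by (rule disjoint[OF s closed(6)[OF Suc.prems(1)]])
    then have s0: "?s = 0" using nc_domainD[OF dom a(1) s] a(2) by blast
    have "b * c 0 = 0" using eq as by (simp only: add_0_right)
    then have "c 0 = 0" using nc_domainD[OF dom b(1) Suc.prems(1)] b(2) by blast
    then show ?case using Suc.IH[OF Suc.prems(1) s0] Suc.prems(3) by (cases i) simp_all
  qed simp
  \<comment> \<open>The right ideal generated by the first \<open>n\<close> of the elements \<open>b, ab, a\<^sup>2b, \<dots>\<close>\<close>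
  define J where "J n = {\<Sum>i<n. a ^ i * b * c i | c. \<forall>i. c i \<in> R}" for n
  have "right_ideal R (J n)" for n
    unfolding right_ideal_def
  proof (intro conjI ballI subsetI)
    show "x \<in> R" if "x \<in> J n" for x
      using that pow unfolding J_def by (auto intro!: unital_subring_sum[OF R])
    show "0 \<in> J n"
      unfolding J_def by (rule CollectI, rule exI[of _ "\<lambda>_. 0"]) (simp add: closed)
    show "x - y \<in> J n" if x: "x \<in> J n" and y: "y \<in> J n" for x y
    proof -
      obtain c where "x = (\<Sum>i<n. a ^ i * b * c i)" "\<forall>i. c i \<in> R"
        using x unfolding J_def mem_Collect_eq by (elim exE conjE)
      moreover obtain d where "y = (\<Sum>i<n. a ^ i * b * d i)" "\<forall>i. d i \<in> R"
        using y unfolding J_def mem_Collect_eq by (elim exE conjE)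
      ultimately show ?thesis unfolding J_def
        by (intro CollectI exI[of _ "\<lambda>i. c i - d i"]) (simp add: closed right_diff_distrib sum_subtractf)
    qed
    show "x * r \<in> J n" if x: "x \<in> J n" and r: "r \<in> R" for x r
    proof -
      obtain c where "x = (\<Sum>i<n. a ^ i * b * c i)" "\<forall>i. c i \<in> R"
        using x unfolding J_def mem_Collect_eq by (elim exE conjE)
      then show ?thesis unfolding J_def using r
        by (intro CollectI exI[of _ "\<lambda>i. c i * r"]) (simp add: closed sum_distrib_right mult.assoc)
    qed
  qed
  moreover have "mono J"
  proof (rule monoI)
    fix k n :: nat assume le: "k \<le> n"
    show "J k \<subseteq> J n"
    proof
      fix x assume "x \<in> J k"
      then obtain c where x: "x = (\<Sum>i<k. a ^ i * b * c i)" and c: "\<forall>i. c i \<in> R"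
        unfolding J_def mem_Collect_eq by (elim exE conjE)
      let ?c = "\<lambda>i. if i < k then c i else 0"
      have "(\<Sum>i<k. a ^ i * b * c i) = (\<Sum>i<n. a ^ i * b * ?c i)"
        using le by (intro sum.mono_neutral_cong_left) auto
      then show "x \<in> J n" unfolding J_def x using c
        by (intro CollectI exI[of _ ?c]) (simp add: closed)
    qed
  qed
  ultimately obtain N where N: "\<forall>n\<ge>N. J n = J N" using noeth unfolding noetherian_def by blast
  let ?c = "\<lambda>i. if i = N then 1 else 0"
  have "a ^ N * b \<in> J (Suc N)" unfolding J_def
    by (intro CollectI exI[of _ ?c]) (simp add: closed)
  then have "a ^ N * b \<in> J N" using N by (metis le_SucI order_refl)
  then obtain c where c: "a ^ N * b = (\<Sum>i<N. a ^ i * b * c i)" "\<forall>i. c i \<in> R"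
    unfolding J_def mem_Collect_eq by (elim exE conjE)
  let ?d = "\<lambda>i. if i = N then - 1 else c i"
  have "(\<Sum>i<Suc N. a ^ i * b * ?d i) = 0" using c(1) by simp
  moreover have "?d i \<in> R" for i using c(2) closed by simp
  ultimately have "?d N = 0" using indep[of ?d "Suc N" N] by blast
  then show False by simp
qed

text \<open>Gaussian elimination on the columns \<open>v j\<close>. The Ore condition supplies common right multiples of a pivot
  and the other entries in its row; they clear the row at the price of multiplying
  column \<open>j\<close> by a nonzero \<open>s j\<close>, which preserves nontriviality of a relation in a domain.\<close>

lemma right_ore_dependent:
  assumes R: "unital_subring R" and dom: "nc_domain R" and ore: "right_ore R"
    and "finite I" "finite J" "card I < card J" "\<And>j i. j \<in> J \<Longrightarrow> i \<in> I \<Longrightarrow> v j i \<in> R"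
  shows "\<exists>c. (\<forall>j. c j \<in> R) \<and> (\<exists>j\<in>J. c j \<noteq> 0) \<and> (\<forall>i\<in>I. (\<Sum>j\<in>J. v j i * c j) = 0)"
  using assms(4-)
proof (induction I arbitrary: J v rule: finite_induct)
  case empty
  then have "J \<noteq> {}" by auto
  then show ?case using unital_subringD(1)[OF R] by (intro exI[of _ "\<lambda>_. 1"]) auto
next
  case (insert x I)
  note closed = unital_subringD[OF R]
  show ?case
  proof (cases "\<forall>j\<in>J. v j x = 0")
    case True
    have "\<exists>c. (\<forall>j. c j \<in> R) \<and> (\<exists>j\<in>J. c j \<noteq> 0) \<and> (\<forall>i\<in>I. (\<Sum>j\<in>J. v j i * c j) = 0)"
      using insert.prems insert.hyps by (intro insert.IH) auto
    then obtain c where c: "\<forall>j. c j \<in> R" "\<exists>j\<in>J. c j \<noteq> 0" "\<forall>i\<in>I. (\<Sum>j\<in>J. v j i * c j) = 0" by blast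
    have "(\<Sum>j\<in>J. v j x * c j) = 0" using True by simp
    then show ?thesis using c by (intro exI[of _ c]) simp
  next
    case False
    then obtain k where k: "k \<in> J" "v k x \<noteq> 0" by blast
    have vR: "v j i \<in> R" if "j \<in> J" "i \<in> insert x I" for i j using insert.prems(3) that by blast
    have "\<exists>s t. s \<in> R \<and> t \<in> R \<and> s \<noteq> 0 \<and> v j x * s = v k x * t" if j: "j \<in> J" for j
    proof (cases "v j x = 0")
      case True
      then show ?thesis using closed(1,2) by (intro exI[of _ 1] exI[of _ 0]) simp
    next
      case False
      then obtain s t where st: "s \<in> R" "t \<in> R" "v j x * s = v k x * t" "v j x * s \<noteq> 0"
        using right_oreD[OF ore vR[OF j insertI1] vR[OF k(1) insertI1] _ k(2)] by blast
      then show ?thesis by (intro exI[of _ s] exI[of _ t]) auto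
    qed
    then obtain s t where st: "\<And>j. j \<in> J \<Longrightarrow> s j \<in> R" "\<And>j. j \<in> J \<Longrightarrow> t j \<in> R"
        "\<And>j. j \<in> J \<Longrightarrow> s j \<noteq> 0" "\<And>j. j \<in> J \<Longrightarrow> v j x * s j = v k x * t j"
      by metis
    let ?J = "J - {k}"
    \<comment> \<open>Column \<open>j\<close> after the entry in row \<open>x\<close> has been cleared with the pivot column \<open>k\<close>.\<close>
    define v' where "v' j i = v j i * s j - v k i * t j" for j i
    have "\<exists>c. (\<forall>j. c j \<in> R) \<and> (\<exists>j\<in>?J. c j \<noteq> 0) \<and> (\<forall>i\<in>I. (\<Sum>j\<in>?J. v' j i * c j) = 0)"
    proof (rule insert.IH)
      show "finite ?J" using insert.prems by simp
      show "card I < card ?J" using insert.prems insert.hyps k by simp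
      show "v' j i \<in> R" if "j \<in> ?J" "i \<in> I" for j i
        unfolding v'_def using that k by (intro closed(3) closed(5) st vR) auto
    qed
    then obtain c j0 where c: "\<forall>j. c j \<in> R" and j0: "j0 \<in> ?J" "c j0 \<noteq> 0"
      and rel: "\<forall>i\<in>I. (\<Sum>j\<in>?J. v' j i * c j) = 0" by blast
    define C where "C j = (if j = k then - (\<Sum>j\<in>?J. t j * c j) else if j \<in> J then s j * c j else 0)" for j
    have sum: "(\<Sum>j\<in>J. v j i * C j) = (\<Sum>j\<in>?J. v' j i * c j)" for i
    proof -
      have "(\<Sum>j\<in>J. v j i * C j) = v k i * C k + (\<Sum>j\<in>?J. v j i * C j)"
        using insert.prems k by (intro sum.remove) auto
      also have "(\<Sum>j\<in>?J. v j i * C j) = (\<Sum>j\<in>?J. v j i * s j * c j)"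
        by (intro sum.cong) (auto simp: C_def mult.assoc)
      also have "v k i * C k = - (\<Sum>j\<in>?J. v k i * t j * c j)"
        by (simp add: C_def sum_distrib_left mult.assoc)
      finally show ?thesis by (simp add: v'_def left_diff_distrib sum_subtractf)
    qed
    have "C j \<in> R" for j
      unfolding C_def using c st by (auto intro!: closed(2,5,6) unital_subring_sum[OF R])
    moreover have "C j0 \<noteq> 0"
      using j0 nc_domainD[OF dom st(1) , of j0 "c j0"] st(3)[of j0] c by (auto simp: C_def)
    moreover have "(\<Sum>j\<in>J. v j i * C j) = 0" if "i \<in> insert x I" for i
    proof (cases "i = x")
      case True
      have "(\<Sum>j\<in>?J. v' j x * c j) = 0" by (intro sum.neutral) (simp add: v'_def st(4))
      then show ?thesis using sum True by simp
    next
      case False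
      then show ?thesis using sum rel that by simp
    qed
    ultimately show ?thesis using j0 by (intro exI[of _ C]) blast
  qed
qed

section \<open>Stably free right ideals in matrix form\<close>

lemma right_idealD:
  assumes "right_ideal R K"
  shows "K \<subseteq> R" "0 \<in> K" "x \<in> K \<Longrightarrow> y \<in> K \<Longrightarrow> x - y \<in> K" "x \<in> K \<Longrightarrow> y \<in> K \<Longrightarrow> x + y \<in> K"
    "x \<in> K \<Longrightarrow> r \<in> R \<Longrightarrow> x * r \<in> K"
proof -
  show "K \<subseteq> R" and z: "0 \<in> K" and d: "\<And>x y. x \<in> K \<Longrightarrow> y \<in> K \<Longrightarrow> x - y \<in> K"
    and "x \<in> K \<Longrightarrow> r \<in> R \<Longrightarrow> x * r \<in> K"
    using assms by (auto simp: right_ideal_def)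
  show "x \<in> K \<Longrightarrow> y \<in> K \<Longrightarrow> x + y \<in> K" using d[of x "0 - y"] d[OF z, of y] by simp
qed

lemma right_ideal_sum:
  assumes "right_ideal R K" and "\<And>i. i \<in> F \<Longrightarrow> f i \<in> K"
  shows "sum f F \<in> K"
  using assms(2) by (induction F rule: infinite_finite_induct) (auto simp: right_idealD[OF assms(1)])

lemma module_isomorphic_sym:
  assumes "module_isomorphic R actM M actN N"
    and add: "\<And>x y. x \<in> M \<Longrightarrow> y \<in> M \<Longrightarrow> x + y \<in> M" and act: "\<And>x r. x \<in> M \<Longrightarrow> r \<in> R \<Longrightarrow> actM x r \<in> M"
  shows "module_isomorphic R actN N actM M"
proof -
  obtain f where f: "bij_betw f M N" "\<And>x y. x \<in> M \<Longrightarrow> y \<in> M \<Longrightarrow> f (x + y) = f x + f y"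
      "\<And>x r. x \<in> M \<Longrightarrow> r \<in> R \<Longrightarrow> f (actM x r) = actN (f x) r"
    using assms(1) unfolding module_isomorphic_def by blast
  let ?g = "the_inv_into M f"
  have inj: "inj_on f M" using f(1) by (rule bij_betw_imp_inj_on)
  have g: "?g x \<in> M" "f (?g x) = x" if "x \<in> N" for x
    using that f(1) by (auto simp: bij_betw_def the_inv_into_into f_the_inv_into_f)
  have "?g (x + y) = ?g x + ?g y" if "x \<in> N" "y \<in> N" for x y
    using the_inv_into_f_f[OF inj add[OF g(1)[OF that(1)] g(1)[OF that(2)]]] that f(2) g by simp
  moreover have "?g (actN x r) = actM (?g x) r" if "x \<in> N" "r \<in> R" for x r
    using the_inv_into_f_f[OF inj act[OF g(1)[OF that(1)] that(2)]] that f(3) g by simp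
  ultimately show ?thesis
    unfolding module_isomorphic_def using bij_betw_the_inv_into[OF f(1)] by blast
qed

lemma module_isomorphic_trans:
  assumes "module_isomorphic R actL L actM M" "module_isomorphic R actM M actN N"
  shows "module_isomorphic R actL L actN N"
proof -
  obtain f g where f: "bij_betw f L M" "\<forall>x\<in>L. \<forall>y\<in>L. f (x + y) = f x + f y"
      "\<forall>x\<in>L. \<forall>r\<in>R. f (actL x r) = actM (f x) r"
    and g: "bij_betw g M N" "\<forall>x\<in>M. \<forall>y\<in>M. g (x + y) = g x + g y"
      "\<forall>x\<in>M. \<forall>r\<in>R. g (actM x r) = actN (g x) r"
    using assms unfolding module_isomorphic_def by blast
  have "f x \<in> M" if "x \<in> L" for x using f(1) that by (auto simp: bij_betw_def)
  then show ?thesis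
    unfolding module_isomorphic_def
    using bij_betw_trans[OF f(1) g(1)] f(2,3) g(2,3) by (intro exI[of _ "g \<circ> f"]) simp
qed

text \<open>An isomorphism \<open>R\<^sup>m \<cong> K \<oplus> R\<^sup>n\<close>, written as the \<open>(1 + n) \<times> m\<close> matrix with columns \<open>(k i, w i)\<close>, the images
  of the standard basis vectors. In this form it makes sense over every ring that contains \<open>R\<close>.\<close>

definition stable_matrix ::
  "'r::ring_1 set \<Rightarrow> 'r set \<Rightarrow> nat \<Rightarrow> nat \<Rightarrow> (nat \<Rightarrow> 'r) \<Rightarrow> (nat \<Rightarrow> nat \<Rightarrow> 'r) \<Rightarrow> bool" where
  "stable_matrix R K n m k w \<longleftrightarrow> (\<forall>i<m. k i \<in> K) \<and> (\<forall>i<m. \<forall>j<n. w i j \<in> R) \<and>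
     (\<forall>v. (\<forall>i<m. v i \<in> R) \<and> (\<Sum>i<m. k i * v i) = 0 \<and> (\<forall>j<n. (\<Sum>i<m. w i j * v i) = 0) \<longrightarrow> (\<forall>i<m. v i = 0)) \<and>
     (\<forall>x\<in>K. \<forall>y. (\<forall>j<n. y j \<in> R) \<longrightarrow>
       (\<exists>v. (\<forall>i<m. v i \<in> R) \<and> x = (\<Sum>i<m. k i * v i) \<and> (\<forall>j<n. y j = (\<Sum>i<m. w i j * v i))))"

lemma stable_matrixD:
  assumes "stable_matrix R K n m k w"
  shows "i < m \<Longrightarrow> k i \<in> K" "i < m \<Longrightarrow> j < n \<Longrightarrow> w i j \<in> R"
    "\<lbrakk>\<And>i. i < m \<Longrightarrow> v i \<in> R; (\<Sum>i<m. k i * v i) = 0; \<And>j. j < n \<Longrightarrow> (\<Sum>i<m. w i j * v i) = 0; i < m\<rbrakk> \<Longrightarrow> v i = 0"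
  using assms unfolding stable_matrix_def by blast+

lemma stable_matrix_surj:
  assumes "stable_matrix R K n m k w" "x \<in> K" "\<forall>j<n. y j \<in> R"
  shows "\<exists>v. (\<forall>i<m. v i \<in> R) \<and> x = (\<Sum>i<m. k i * v i) \<and> (\<forall>j<n. y j = (\<Sum>i<m. w i j * v i))"
  using assms unfolding stable_matrix_def by simp

lemma stable_matrix_exists:
  assumes R: "unital_subring R" and K: "right_ideal R K"
    and iso: "module_isomorphic R (sum_act (*) power_act) (K \<times> power_module R n) power_act (power_module R m)"
  shows "\<exists>k w. stable_matrix R K n m k w"
proof -
  note closed = unital_subringD[OF R] and Kclosed = right_idealD[OF K]
  let ?M = "K \<times> power_module R n" and ?act = "sum_act (*) power_act"
  obtain f where f: "bij_betw f ?M (power_module R m)"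
      and f_add: "\<And>x y. x \<in> ?M \<Longrightarrow> y \<in> ?M \<Longrightarrow> f (x + y) = f x + f y"
      and f_act: "\<And>x r. x \<in> ?M \<Longrightarrow> r \<in> R \<Longrightarrow> f (?act x r) = power_act (f x) r"
    using iso unfolding module_isomorphic_def by blast
  have M0: "0 \<in> ?M" using Kclosed(2) closed(2) by (simp add: power_module_def zero_prod_def)
  have M_add: "x + y \<in> ?M" if "x \<in> ?M" "y \<in> ?M" for x y
    using that by (simp add: mem_Times_iff power_module_def Kclosed(4) closed(4))
  have M_act: "?act x r \<in> ?M" if "x \<in> ?M" "r \<in> R" for x r
    using that by (simp add: mem_Times_iff power_module_def sum_act_def power_act_def Kclosed(5) closed(5))
  have M_sum: "sum h F \<in> ?M" if "\<And>i. i \<in> F \<Longrightarrow> h i \<in> ?M" for h and F :: "nat set"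
    using that
  proof (induction F rule: infinite_finite_induct)
    case (insert x F)
    have "h x + sum h F \<in> ?M"
      by (rule M_add[OF insert.prems[OF insertI1] insert.IH[OF insert.prems[OF insertI2]]])
    then show ?case by (simp only: sum.insert[OF insert.hyps])
  qed (simp_all add: M0 del: mem_Sigma_iff)
  have f0: "f 0 = 0" using f_add[OF M0 M0] by simp
  have f_sum: "f (sum h F) = (\<Sum>i\<in>F. f (h i))" if "\<And>i. i \<in> F \<Longrightarrow> h i \<in> ?M" for h and F :: "nat set"
    using that
  proof (induction F rule: infinite_finite_induct)
    case (insert x F)
    have "f (h x + sum h F) = f (h x) + f (sum h F)"
      by (rule f_add[OF insert.prems[OF insertI1] M_sum[OF insert.prems[OF insertI2]]])
    then show ?case using insert by simp
  qed (simp_all add: f0)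
  define e where "e i = (\<lambda>j. if j = i then 1 else (0::'a))" for i :: nat
  have e: "e i \<in> power_module R m" if "i < m" for i
    using that closed(1,2) by (auto simp: power_module_def e_def)
  define z where "z i = the_inv_into ?M f (e i)" for i
  have inj: "inj_on f ?M" using f by (rule bij_betw_imp_inj_on)
  have z: "z i \<in> ?M" "f (z i) = e i" if "i < m" for i
    unfolding z_def using e[OF that] f
    by (auto simp: bij_betw_def simp del: mem_Sigma_iff intro: the_inv_into_into f_the_inv_into_f)
  let ?k = "\<lambda>i. fst (z i)" and ?w = "\<lambda>i. snd (z i)"
  have k: "?k i \<in> K" and w: "?w i \<in> power_module R n" if "i < m" for i
    using z(1)[OF that] by (auto simp: mem_Times_iff)
  define Z where "Z v = (\<Sum>i<m. ?act (z i) (v i))" for v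
  have Z_fst: "fst (Z v) = (\<Sum>i<m. ?k i * v i)" and Z_snd: "snd (Z v) j = (\<Sum>i<m. ?w i j * v i)" for v j
  proof -
    have "fst (Z v) = (\<Sum>i<m. fst (?act (z i) (v i)))" unfolding Z_def
      by (induction m) (simp_all add: zero_prod_def)
    then show "fst (Z v) = (\<Sum>i<m. ?k i * v i)" by (simp add: sum_act_def)
    have "snd (Z v) j = (\<Sum>i<m. snd (?act (z i) (v i)) j)" unfolding Z_def
      by (induction m) (simp_all add: zero_prod_def)
    then show "snd (Z v) j = (\<Sum>i<m. ?w i j * v i)" by (simp add: sum_act_def power_act_def)
  qed
  have Z: "Z v \<in> ?M" "f (Z v) = (\<lambda>i. if i < m then v i else 0)" if v: "\<forall>i<m. v i \<in> R" for v
  proof -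
    have t: "?act (z i) (v i) \<in> ?M" if "i < m" for i by (rule M_act[OF z(1)[OF that] v[rule_format, OF that]])
    show "Z v \<in> ?M" unfolding Z_def using t by (intro M_sum) simp
    have "f (Z v) = (\<Sum>i<m. f (?act (z i) (v i)))" unfolding Z_def using t by (intro f_sum) simp
    also have "\<dots> = (\<Sum>i<m. power_act (e i) (v i))"
      using f_act z v by (intro sum.cong) auto
    finally have "f (Z v) = (\<Sum>i<m. power_act (e i) (v i))" .
    moreover have "(\<Sum>i<m. power_act (e i) (v i)) j = (\<Sum>i<m. if j = i then v i else 0)" for j
    proof -
      have "(\<Sum>i<m. power_act (e i) (v i)) j = (\<Sum>i<m. power_act (e i) (v i) j)"
        by (induction m) auto
      then show ?thesis by (simp add: power_act_def e_def if_distrib[of "\<lambda>x. x * _"] cong: if_cong)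
    qed
    ultimately show "f (Z v) = (\<lambda>i. if i < m then v i else 0)" by (auto simp: fun_eq_iff)
  qed
  have "stable_matrix R K n m ?k ?w"
    unfolding stable_matrix_def
  proof (intro conjI allI impI ballI)
    show "?k i \<in> K" if "i < m" for i by (rule k[OF that])
    show "?w i j \<in> R" if "i < m" "j < n" for i j using w[OF that(1)] that(2) by (simp add: power_module_def)
  next
    fix v i
    assume v: "(\<forall>i<m. v i \<in> R) \<and> (\<Sum>i<m. ?k i * v i) = 0 \<and> (\<forall>j<n. (\<Sum>i<m. ?w i j * v i) = 0)" and i: "i < m"
    have v': "\<forall>i<m. v i \<in> R" using v by blast
    have "snd (Z v) j = 0" for j
    proof (cases "j < n")
      case True
      then show ?thesis using v by (simp add: Z_snd)
    next
      case False
      then show ?thesis using Z(1)[OF v'] by (auto simp: power_module_def mem_Times_iff)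
    qed
    then have "snd (Z v) = 0" by (simp add: fun_eq_iff)
    moreover have "fst (Z v) = 0" using v by (simp add: Z_fst)
    ultimately have "Z v = 0" by (simp add: prod_eq_iff)
    then have "(\<lambda>i. if i < m then v i else 0) = 0" using Z(2)[OF v'] f0 by simp
    then show "v i = 0" using i by (simp add: fun_eq_iff split: if_splits)
  next
    fix x y assume x: "x \<in> K" and y: "\<forall>j<n. y j \<in> R"
    let ?y = "\<lambda>j. if j < n then y j else 0"
    have xy: "(x, ?y) \<in> ?M" using x y by (simp add: power_module_def)
    define v where "v = f (x, ?y)"
    have "v \<in> power_module R m" using bij_betwE[OF f] xy unfolding v_def by blast
    then have v: "\<forall>i<m. v i \<in> R" "(\<lambda>i. if i < m then v i else 0) = v"
      by (auto simp: power_module_def fun_eq_iff)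
    have "Z v = (x, ?y)"
      using inj_onD[OF inj _ Z(1)[OF v(1)] xy] Z(2)[OF v(1)] v(2) unfolding v_def by simp
    then have "fst (Z v) = x" "\<And>j. snd (Z v) j = ?y j" by simp_all
    then show "\<exists>v. (\<forall>i<m. v i \<in> R) \<and> x = (\<Sum>i<m. ?k i * v i) \<and> (\<forall>j<n. y j = (\<Sum>i<m. ?w i j * v i))"
      using v(1) unfolding Z_fst Z_snd by (intro exI[of _ v]) (auto split: if_splits)
  qed
  then show ?thesis by (intro exI)
qed

lemma stable_matrix_isomorphic:
  assumes R: "unital_subring R" and K: "right_ideal R K" and M: "stable_matrix R K n m k w"
  shows "module_isomorphic R (sum_act (*) power_act) (K \<times> power_module R n) power_act (power_module R m)"
proof (rule module_isomorphic_sym)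
  note closed = unital_subringD[OF R] and Kclosed = right_idealD[OF K]
  define g where "g v = (\<Sum>i<m. k i * v i, \<lambda>j. if j < n then \<Sum>i<m. w i j * v i else 0)" for v
  have g_add: "g (x + y) = g x + g y" for x y
    by (auto simp: g_def distrib_left sum.distrib fun_eq_iff)
  have g_act: "g (power_act x r) = sum_act (*) power_act (g x) r" for x r
    by (auto simp: g_def power_act_def sum_act_def sum_distrib_right mult.assoc fun_eq_iff)
  have g_in: "g v \<in> K \<times> power_module R n" if "v \<in> power_module R m" for v
    using that stable_matrixD(1,2)[OF M]
    by (auto simp: g_def power_module_def intro!: right_ideal_sum[OF K] unital_subring_sum[OF R] Kclosed closed(5))
  have g_inj: "x = y" if "x \<in> power_module R m" "y \<in> power_module R m" "g x = g y" for x y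
  proof
    fix i
    have xy: "(x - y) i \<in> R" if "i < m" for i
      using that \<open>x \<in> _\<close> \<open>y \<in> _\<close> by (simp add: power_module_def closed(3))
    have "g (x - y) + g y = g x" using g_add[of "x - y" y] by simp
    then have "g (x - y) = 0" using \<open>g x = g y\<close> by simp
    then have z: "(\<Sum>i<m. k i * (x - y) i) = 0"
      "\<And>j. (if j < n then \<Sum>i<m. w i j * (x - y) i else 0) = 0"
      unfolding g_def zero_prod_def prod.inject fun_eq_iff by simp_all
    show "x i = y i"
    proof (cases "i < m")
      case True
      have "(x - y) i = 0"
      proof (rule stable_matrixD(3)[OF M xy z(1) _ True])
        show "(\<Sum>i<m. w i j * (x - y) i) = 0" if "j < n" for j using z(2)[of j] that by simp
      qed
      then show ?thesis by simp
    next
      case False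
      then show ?thesis using \<open>x \<in> _\<close> \<open>y \<in> _\<close> by (simp add: power_module_def)
    qed
  qed
  have g_surj: "z \<in> g ` power_module R m" if z: "z \<in> K \<times> power_module R n" for z
  proof -
    obtain x y where xy: "z = (x, y)" "x \<in> K" "y \<in> power_module R n" using z by blast
    have y: "\<forall>j<n. y j \<in> R" using xy(3) by (simp add: power_module_def)
    obtain v where v: "\<forall>i<m. v i \<in> R" "x = (\<Sum>i<m. k i * v i)" "\<forall>j<n. y j = (\<Sum>i<m. w i j * v i)"
      using stable_matrix_surj[OF M xy(2) y] by (elim exE conjE)
    let ?v = "\<lambda>i. if i < m then v i else 0"
    have "g ?v = z" unfolding g_def xy(1) v(2)
      using xy(3) by (auto simp: fun_eq_iff v(3) power_module_def intro!: sum.cong)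
    moreover have "?v \<in> power_module R m" using v(1) by (simp add: power_module_def)
    ultimately show ?thesis by blast
  qed
  have "bij_betw g (power_module R m) (K \<times> power_module R n)"
    using g_inj g_in g_surj by (intro bij_betw_imageI inj_onI) blast+
  then show "module_isomorphic R power_act (power_module R m) (sum_act (*) power_act) (K \<times> power_module R n)"
    unfolding module_isomorphic_def using g_add g_act by blast
  show "x + y \<in> power_module R m" if "x \<in> power_module R m" "y \<in> power_module R m" for x y
    using that by (simp add: power_module_def closed(4))
  show "power_act x r \<in> power_module R m" if "x \<in> power_module R m" "r \<in> R" for x r
    using that by (simp add: power_module_def power_act_def closed(5))
qed

text \<open>A nonzero right ideal \<open>K\<close> embeds in \<open>R\<close> and contains a copy of \<open>R\<close>. So \<open>R\<^sup>m\<close> embeds in \<open>R\<^sup>1\<^sup>+\<^sup>n\<close> and \<open>R\<^sup>1\<^sup>+\<^sup>n\<close>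
  embeds in \<open>R\<^sup>m\<close>; over a right Ore domain either embedding bounds the ranks.\<close>

lemma stable_matrix_rank:
  assumes R: "unital_subring R" and dom: "nc_domain R" and ore: "right_ore R"
    and K: "right_ideal R K" "K \<noteq> {0}" and M: "stable_matrix R K n m k w"
  shows "m = Suc n"
proof (rule antisym)
  note closed = unital_subringD[OF R] and Kclosed = right_idealD[OF K(1)]
  show "m \<le> Suc n"
  proof (rule ccontr)
    assume "\<not> m \<le> Suc n"
    \<comment> \<open>Row \<open>0\<close> is the component in \<open>K \<subseteq> R\<close>, row \<open>Suc j\<close> the component \<open>j\<close> in \<open>R\<^sup>n\<close>.\<close>
    define V where "V i l = (case l of 0 \<Rightarrow> k i | Suc j \<Rightarrow> w i j)" for i l
    have "\<exists>c. (\<forall>i. c i \<in> R) \<and> (\<exists>i\<in>{..<m}. c i \<noteq> 0) \<and> (\<forall>l\<in>{..n}. (\<Sum>i<m. V i l * c i) = 0)"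
    proof (rule right_ore_dependent[OF R dom ore])
      show "card {..n} < card {..<m}" using \<open>\<not> m \<le> Suc n\<close> by simp
      show "V i l \<in> R" if "i \<in> {..<m}" "l \<in> {..n}" for i l
        using that stable_matrixD(1,2)[OF M] Kclosed(1) by (auto simp: V_def split: nat.split)
    qed auto
    then obtain c i where c: "\<And>i. c i \<in> R" "i < m" "c i \<noteq> 0" "\<And>l. l \<le> n \<Longrightarrow> (\<Sum>i<m. V i l * c i) = 0"
      by blast
    have "c i = 0"
    proof (rule stable_matrixD(3)[OF M c(1) _ _ c(2)])
      show "(\<Sum>i<m. k i * c i) = 0" using c(4)[of 0] by (simp add: V_def)
      show "(\<Sum>i<m. w i j * c i) = 0" if "j < n" for j using c(4)[of "Suc j"] that by (simp add: V_def)
    qed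
    then show False using c(3) by simp
  qed
  show "Suc n \<le> m"
  proof (rule ccontr)
    assume "\<not> Suc n \<le> m"
    obtain x where x: "x \<in> K" "x \<noteq> 0" using K Kclosed(2) by blast
    \<comment> \<open>Preimages of \<open>(x, 0)\<close> and of the standard basis vectors of \<open>R\<^sup>n\<close>: \<open>1 + n\<close> independent vectors in \<open>R\<^sup>m\<close>.\<close>
    have "\<forall>l. \<exists>v. (\<forall>i<m. v i \<in> R) \<and> (if l = 0 then x else 0) = (\<Sum>i<m. k i * v i) \<and>
        (\<forall>j<n. (if l = Suc j then 1 else 0) = (\<Sum>i<m. w i j * v i))"
      by (intro allI stable_matrix_surj[OF M]) (use x Kclosed(2) closed(1,2) in auto)
    from choice[OF this] obtain V where
        "\<forall>l. (\<forall>i<m. V l i \<in> R) \<and> (if l = 0 then x else 0) = (\<Sum>i<m. k i * V l i) \<and>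
        (\<forall>j<n. (if l = Suc j then 1 else 0) = (\<Sum>i<m. w i j * V l i))"
      by (elim exE)
    then have V: "\<And>l i. i < m \<Longrightarrow> V l i \<in> R"
      and Vk: "\<And>l. (if l = 0 then x else 0) = (\<Sum>i<m. k i * V l i)"
      and Vw: "\<And>l j. j < n \<Longrightarrow> (if l = Suc j then 1 else 0) = (\<Sum>i<m. w i j * V l i)"
      by (simp_all only: simp_thms)
    have "\<exists>c. (\<forall>l. c l \<in> R) \<and> (\<exists>l\<in>{..n}. c l \<noteq> 0) \<and> (\<forall>i\<in>{..<m}. (\<Sum>l\<le>n. V l i * c l) = 0)"
      using \<open>\<not> Suc n \<le> m\<close> V by (intro right_ore_dependent[OF R dom ore]) auto
    then obtain c l where c: "\<And>l. c l \<in> R" and l: "l \<le> n" "c l \<noteq> 0"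
      and rel: "\<And>i. i < m \<Longrightarrow> (\<Sum>l\<le>n. V l i * c l) = 0" by blast
    have swap: "(\<Sum>l\<le>n. (\<Sum>i<m. h i * V l i) * c l) = 0" for h
    proof -
      have "(\<Sum>l\<le>n. (\<Sum>i<m. h i * V l i) * c l) = (\<Sum>l\<le>n. \<Sum>i<m. h i * (V l i * c l))"
        by (simp add: sum_distrib_right mult.assoc)
      also have "\<dots> = (\<Sum>i<m. \<Sum>l\<le>n. h i * (V l i * c l))" by (rule sum.swap)
      also have "\<dots> = (\<Sum>i<m. h i * (\<Sum>l\<le>n. V l i * c l))" by (simp add: sum_distrib_left)
      also have "\<dots> = 0" using rel by simp
      finally show ?thesis .
    qed
    have if_mult: "(if P then a else 0) * b = (if P then a * b else 0)" for P and a b :: 'a by simp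
    have "x * c 0 = 0" using swap[of k] by (simp add: Vk[symmetric] if_mult)
    then have c0: "c 0 = 0" using nc_domainD[OF dom _ c, of x 0] x Kclosed(1) by blast
    have cS: "c (Suc j) = 0" if "j < n" for j
      using swap[of "\<lambda>i. w i j"] that by (simp add: Vw[symmetric] if_mult)
    show False using c0 cS l by (cases l) auto
  qed
qed

section \<open>Extending right ideals along a left free ring extension\<close>

lemma unital_subring_UNIV: "unital_subring UNIV"
  by (simp add: unital_subring_def)

lemma is_right_basis_independent:
  fixes f :: "'j \<Rightarrow> 'r::ring_1"
  assumes B: "is_right_basis R (*) M J f" and R: "unital_subring R" and M: "0 \<in> M"
    and F: "finite F" "F \<subseteq> J" "\<forall>j\<in>F. c j \<in> R" "(\<Sum>j\<in>F. f j * c j) = 0" and j: "j \<in> F"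
  shows "c j = 0"
proof -
  define P where "P c \<longleftrightarrow> (\<forall>j. c j \<in> R) \<and> finite {j. c j \<noteq> 0} \<and> {j. c j \<noteq> 0} \<subseteq> J \<and>
      0 = (\<Sum>j | c j \<noteq> 0. f j * c j)" for c
  let ?c = "\<lambda>j. if j \<in> F then c j else 0"
  have s: "{j. ?c j \<noteq> 0} \<subseteq> F" by auto
  have "(\<Sum>j | ?c j \<noteq> 0. f j * ?c j) = (\<Sum>j\<in>F. f j * c j)"
    using F(1) s by (intro sum.mono_neutral_cong_left) auto
  then have "0 = (\<Sum>j | ?c j \<noteq> 0. f j * ?c j)" by (simp only: F(4))
  moreover have "\<forall>j. ?c j \<in> R" using F(3) unital_subringD(2)[OF R] by simp
  moreover have "finite {j. ?c j \<noteq> 0}" using s F(1) by (rule finite_subset)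
  moreover have "{j. ?c j \<noteq> 0} \<subseteq> J" using s F(2) by (rule order_trans)
  ultimately have "P ?c" unfolding P_def by (intro conjI)
  moreover have "P (\<lambda>_. 0)" unfolding P_def using unital_subringD(2)[OF R] by simp
  moreover have "\<exists>!c. P c" unfolding P_def using B M unfolding is_right_basis_def by (elim conjE bspec)
  ultimately have "?c = (\<lambda>_. 0)" by blast
  from fun_cong[OF this, of j] show ?thesis using j by simp
qed

lemma is_right_basis_span:
  fixes f :: "'j \<Rightarrow> 'r::ring_1"
  assumes B: "is_right_basis R (*) M J f" and x: "x \<in> M"
  shows "\<exists>F c. finite F \<and> F \<subseteq> J \<and> (\<forall>j. c j \<in> R) \<and> (\<forall>j. j \<notin> F \<longrightarrow> c j = 0) \<and> x = (\<Sum>j\<in>F. f j * c j)"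
proof -
  have "\<exists>!c. (\<forall>j. c j \<in> R) \<and> finite {j. c j \<noteq> 0} \<and> {j. c j \<noteq> 0} \<subseteq> J \<and> x = (\<Sum>j | c j \<noteq> 0. f j * c j)"
    using B x unfolding is_right_basis_def by (elim conjE bspec)
  then obtain c where "(\<forall>j. c j \<in> R) \<and> finite {j. c j \<noteq> 0} \<and> {j. c j \<noteq> 0} \<subseteq> J \<and> x = (\<Sum>j | c j \<noteq> 0. f j * c j)"
    by (elim ex1E)
  then show ?thesis by (intro exI[of _ "{j. c j \<noteq> 0}"] exI[of _ c]) simp
qed

text \<open>Each of finitely many generators involves finitely many basis elements. A basis element outside this
  finite set would be a combination of its members.\<close>

lemma is_right_basis_finite:
  fixes f :: "'r::ring_1 \<Rightarrow> 'r"
  assumes B: "is_right_basis R (*) M X (\<lambda>x. x)" and R: "unital_subring R" and M: "0 \<in> M"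
    and fg: "fg_module R (*) M"
  shows "finite X"
proof -
  note closed = unital_subringD[OF R]
  obtain Z where Z: "Z \<subseteq> M" "finite Z" "\<forall>x\<in>M. \<exists>c. (\<forall>y\<in>Z. c y \<in> R) \<and> x = (\<Sum>y\<in>Z. y * c y)"
    using fg unfolding fg_module_def by (elim exE conjE)
  have "\<forall>z\<in>Z. \<exists>F c. finite F \<and> F \<subseteq> X \<and> (\<forall>j. c j \<in> R) \<and> (\<forall>j. j \<notin> F \<longrightarrow> c j = 0) \<and> z = (\<Sum>j\<in>F. j * c j)"
    using is_right_basis_span[OF B] Z(1) by blast
  from bchoice[OF this] obtain F where
    "\<forall>z\<in>Z. \<exists>c. finite (F z) \<and> F z \<subseteq> X \<and> (\<forall>j. c j \<in> R) \<and> (\<forall>j. j \<notin> F z \<longrightarrow> c j = 0) \<and> z = (\<Sum>j\<in>F z. j * c j)"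
    by (elim exE)
  from bchoice[OF this] obtain c where
    Fc: "\<forall>z\<in>Z. finite (F z) \<and> F z \<subseteq> X \<and> (\<forall>j. c z j \<in> R) \<and> (\<forall>j. j \<notin> F z \<longrightarrow> c z j = 0) \<and> z = (\<Sum>j\<in>F z. j * c z j)"
    by (elim exE)
  define X0 where "X0 = (\<Union>z\<in>Z. F z)"
  have X0: "finite X0" "X0 \<subseteq> X" using Fc Z(2) unfolding X0_def by blast+
  have "X \<subseteq> X0"
  proof (rule ccontr)
    assume "\<not> X \<subseteq> X0"
    then obtain x where x: "x \<in> X" "x \<notin> X0" by blast
    have cR: "c z j \<in> R" if "z \<in> Z" for z j using Fc that by blast
    have "x \<in> M" using B x(1) unfolding is_right_basis_def by auto
    then obtain d where d: "\<forall>y\<in>Z. d y \<in> R" "x = (\<Sum>y\<in>Z. y * d y)" using Z(3) by blast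
    have "x = (\<Sum>z\<in>Z. \<Sum>j\<in>X0. j * (c z j * d z))"
    proof -
      have "(\<Sum>z\<in>Z. z * d z) = (\<Sum>z\<in>Z. \<Sum>j\<in>X0. j * (c z j * d z))"
      proof (rule sum.cong[OF refl])
        fix z assume z: "z \<in> Z"
        have "(\<Sum>j\<in>F z. j * c z j) = (\<Sum>j\<in>X0. j * c z j)"
          using z Fc X0(1) by (intro sum.mono_neutral_left) (auto simp: X0_def)
        then have "z = (\<Sum>j\<in>X0. j * c z j)" using Fc z by (metis (no_types, lifting))
        then have "z * d z = (\<Sum>j\<in>X0. j * c z j) * d z" by (rule arg_cong)
        then show "z * d z = (\<Sum>j\<in>X0. j * (c z j * d z))" by (simp only: sum_distrib_right mult.assoc)
      qed
      then show ?thesis by (rule trans[OF d(2)])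
    qed
    also have "\<dots> = (\<Sum>j\<in>X0. \<Sum>z\<in>Z. j * (c z j * d z))" by (rule sum.swap)
    also have "\<dots> = (\<Sum>j\<in>X0. j * (\<Sum>z\<in>Z. c z j * d z))" by (simp only: sum_distrib_left)
    finally have xe: "x = (\<Sum>j\<in>X0. j * (\<Sum>z\<in>Z. c z j * d z))" .
    define a where "a j = (if j = x then - 1 else \<Sum>z\<in>Z. c z j * d z)" for j
    have "(\<Sum>j\<in>X0. j * a j) = (\<Sum>j\<in>X0. j * (\<Sum>z\<in>Z. c z j * d z))"
      using x(2) by (intro sum.cong) (auto simp: a_def)
    then have "(\<Sum>j\<in>insert x X0. j * a j) = 0"
      using X0(1) x(2) xe[symmetric] by (simp add: a_def)
    moreover have "\<forall>j\<in>insert x X0. a j \<in> R"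
      unfolding a_def using cR d(1) closed(1,6) by (auto intro!: unital_subring_sum[OF R] closed(5))
    ultimately have "a x = 0"
      using X0 x(1) by (intro is_right_basis_independent[OF B R M, of "insert x X0" a x]) auto
    then show False by (simp add: a_def)
  qed
  then show ?thesis using X0(1) by (rule finite_subset)
qed

text \<open>A ring extension \<open>R \<subseteq> B\<close>, with \<open>B\<close> the whole type, for which \<open>B\<close> is a free left \<open>R\<close>-module with basis
  \<open>m p\<close>, \<open>p \<in> Q\<close>. That \<open>1\<close> is the basis element at \<open>q0\<close> makes \<open>R\<close> a direct summand of \<open>B\<close>.\<close>

locale left_free_extension =
  fixes R :: "'b::ring_1 set" and Q :: "'p set" and m :: "'p \<Rightarrow> 'b" and q0 :: 'p
  assumes subring_R: "unital_subring R"
    and left_independent: "\<lbrakk>finite F; F \<subseteq> Q; \<forall>p\<in>F. r p \<in> R; (\<Sum>p\<in>F. r p * m p) = 0\<rbrakk> \<Longrightarrow> \<forall>p\<in>F. r p = 0"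
    and left_span: "x \<in> combinations (\<lambda>p r. r * m p) Q R"
    and q0_in: "q0 \<in> Q" and m_q0: "m q0 = 1"
begin

lemmas R_closed = unital_subringD[OF subring_R]

definition coord :: "'b \<Rightarrow> 'p \<Rightarrow> 'b" where
  "coord x = (SOME r. (\<forall>p. r p \<in> R) \<and> finite {p. r p \<noteq> 0} \<and> {p. r p \<noteq> 0} \<subseteq> Q \<and>
     x = (\<Sum>p | r p \<noteq> 0. r p * m p))"

lemma coord_props:
  "(\<forall>p. coord x p \<in> R) \<and> finite {p. coord x p \<noteq> 0} \<and> {p. coord x p \<noteq> 0} \<subseteq> Q \<and>
     x = (\<Sum>p | coord x p \<noteq> 0. coord x p * m p)"
proof -
  obtain F r where F: "finite F" "F \<subseteq> Q" "\<forall>p\<in>F. r p \<in> R" and x: "x = (\<Sum>p\<in>F. r p * m p)"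
    using left_span[of x] unfolding combinations_def mem_Collect_eq by (elim exE conjE)
  let ?r = "\<lambda>p. if p \<in> F then r p else 0"
  have s: "{p. ?r p \<noteq> 0} \<subseteq> F" by auto
  have "(\<Sum>p | ?r p \<noteq> 0. ?r p * m p) = (\<Sum>p\<in>F. r p * m p)"
    using F(1) s by (intro sum.mono_neutral_cong_left) auto
  then have "x = (\<Sum>p | ?r p \<noteq> 0. ?r p * m p)" by (simp only: x)
  moreover have "\<forall>p. ?r p \<in> R" using F(3) R_closed(2) by simp
  moreover have "finite {p. ?r p \<noteq> 0}" using s F(1) by (rule finite_subset)
  moreover have "{p. ?r p \<noteq> 0} \<subseteq> Q" using s F(2) by (rule order_trans)
  ultimately have "\<exists>r. (\<forall>p. r p \<in> R) \<and> finite {p. r p \<noteq> 0} \<and> {p. r p \<noteq> 0} \<subseteq> Q \<and>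
     x = (\<Sum>p | r p \<noteq> 0. r p * m p)" by (intro exI[of _ ?r] conjI)
  from someI_ex[OF this, folded coord_def] show ?thesis .
qed

lemma coord_in_R: "coord x p \<in> R"
  and coord_finite: "finite {p. coord x p \<noteq> 0}"
  and coord_Q: "{p. coord x p \<noteq> 0} \<subseteq> Q"
  by (rule spec[OF conjunct1[OF coord_props]], rule conjunct1[OF conjunct2[OF coord_props]],
      rule conjunct1[OF conjunct2[OF conjunct2[OF coord_props]]])

lemma coord_expansion:
  assumes "finite F" "{p. coord x p \<noteq> 0} \<subseteq> F"
  shows "x = (\<Sum>p\<in>F. coord x p * m p)"
proof -
  have "(\<Sum>p | coord x p \<noteq> 0. coord x p * m p) = (\<Sum>p\<in>F. coord x p * m p)"
    using assms by (intro sum.mono_neutral_left) auto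
  with conjunct2[OF conjunct2[OF conjunct2[OF coord_props]]] show ?thesis by (rule trans)
qed

lemma coord_eqI:
  assumes F: "finite F" "F \<subseteq> Q" and r: "\<forall>p. r p \<in> R" "\<forall>p. p \<notin> F \<longrightarrow> r p = 0"
    and x: "x = (\<Sum>p\<in>F. r p * m p)"
  shows "coord x = r"
proof
  fix p
  let ?F = "F \<union> {p. coord x p \<noteq> 0}"
  have fin: "finite ?F" using F(1) coord_finite by simp
  have "(\<Sum>p\<in>F. r p * m p) = (\<Sum>p\<in>?F. r p * m p)"
    using fin r(2) by (intro sum.mono_neutral_left) auto
  then have "x = (\<Sum>p\<in>?F. r p * m p)" by (rule trans[OF x])
  moreover have "x = (\<Sum>p\<in>?F. coord x p * m p)" by (rule coord_expansion[OF fin]) blast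
  ultimately have "(\<Sum>p\<in>?F. (coord x p - r p) * m p) = x - x"
    by (simp only: left_diff_distrib sum_subtractf)
  then have "(\<Sum>p\<in>?F. (coord x p - r p) * m p) = 0" by simp
  moreover have "\<forall>p\<in>?F. coord x p - r p \<in> R" using r(1) coord_in_R R_closed(3) by simp
  moreover have "?F \<subseteq> Q" using F(2) coord_Q by (rule Un_least)
  ultimately have zero: "\<forall>p\<in>?F. coord x p - r p = 0"
    using left_independent[OF fin, where r = "\<lambda>p. coord x p - r p"] by blast
  show "coord x p = r p"
  proof (cases "p \<in> ?F")
    case True
    with zero have "coord x p - r p = 0" by (rule bspec)
    then show ?thesis by simp
  next
    case False
    then have "coord x p = 0" "r p = 0" using r(2) by blast+
    then show ?thesis by simp
  qed
qed

lemma coord_add: "coord (x + y) p = coord x p + coord y p"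
proof -
  let ?F = "{p. coord x p \<noteq> 0} \<union> {p. coord y p \<noteq> 0}"
  have fin: "finite ?F" using coord_finite by simp
  have "x + y = (\<Sum>p\<in>?F. coord x p * m p) + (\<Sum>p\<in>?F. coord y p * m p)"
    by (rule arg_cong2[of _ _ _ _ "(+)", OF coord_expansion[OF fin] coord_expansion[OF fin]]) blast+
  then have "x + y = (\<Sum>p\<in>?F. (coord x p + coord y p) * m p)"
    by (simp only: distrib_right sum.distrib)
  then have "coord (x + y) = (\<lambda>p. coord x p + coord y p)"
    using Un_least[OF coord_Q coord_Q] R_closed(4)[OF coord_in_R coord_in_R]
    by (intro coord_eqI[OF fin]) simp_all
  then show ?thesis by simp
qed

lemma coord_0 [simp]: "coord 0 p = 0"
  using coord_add[of 0 0 p] by (simp only: add_0_right add_cancel_right_right)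

lemma coord_diff: "coord (x - y) p = coord x p - coord y p"
  using coord_add[of "x - y" y p] by (simp add: eq_diff_eq)

lemma coord_sum: "coord (sum f F) p = (\<Sum>i\<in>F. coord (f i) p)"
  by (induction F rule: infinite_finite_induct) (auto simp: coord_add)

lemma coord_mult_left:
  assumes "r \<in> R" shows "coord (r * x) p = r * coord x p"
proof -
  have "r * x = r * (\<Sum>p | coord x p \<noteq> 0. coord x p * m p)"
    by (rule arg_cong[OF coord_expansion[OF coord_finite order_refl]])
  then have "r * x = (\<Sum>p | coord x p \<noteq> 0. (r * coord x p) * m p)"
    by (simp only: sum_distrib_left mult.assoc)
  then have "coord (r * x) = (\<lambda>p. r * coord x p)"
    using R_closed(5)[OF assms coord_in_R] by (intro coord_eqI[OF coord_finite coord_Q]) simp_all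
  then show ?thesis by simp
qed

lemma coord_of_R:
  assumes "r \<in> R" shows "coord r p = (if p = q0 then r else 0)"
proof -
  have "coord r = (\<lambda>p. if p = q0 then r else 0)"
    using assms R_closed(2) q0_in m_q0 by (intro coord_eqI[of "{q0}"]) auto
  then show ?thesis by simp
qed

context
  fixes K :: "'b set"
  assumes K: "right_ideal R K"
begin

lemmas K_closed = right_idealD[OF K]

text \<open>Left coordinates are left \<open>R\<close>-linear, hence those of \<open>ky\<close> with \<open>k \<in> K\<close> are \<open>k\<close> times those of \<open>y\<close>.\<close>

lemma extend_ideal_iff: "x \<in> extend_ideal K UNIV \<longleftrightarrow> (\<forall>p. coord x p \<in> K)"
proof
  assume "x \<in> extend_ideal K UNIV"
  then obtain n :: nat and k y where x: "x = (\<Sum>i<n. k i * y i)" and k: "\<forall>i<n. k i \<in> K \<and> y i \<in> UNIV"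
    unfolding extend_ideal_def mem_Collect_eq by (elim exE conjE)
  have "coord x p = (\<Sum>i<n. k i * coord (y i) p)" for p
    unfolding x coord_sum using k K_closed(1) by (intro sum.cong refl coord_mult_left) auto
  then show "\<forall>p. coord x p \<in> K"
    using k coord_in_R by (auto intro!: right_ideal_sum[OF K] K_closed(5))
next
  assume x: "\<forall>p. coord x p \<in> K"
  let ?F = "{p. coord x p \<noteq> 0}"
  obtain h where h: "bij_betw h {0..<card ?F} ?F" using ex_bij_betw_nat_finite[OF coord_finite] by blast
  have "x = (\<Sum>p\<in>?F. coord x p * m p)" by (rule coord_expansion[OF coord_finite order_refl])
  also have "\<dots> = (\<Sum>i<card ?F. coord x (h i) * m (h i))"
    using sum.reindex_bij_betw[OF h, of "\<lambda>p. coord x p * m p"] by (simp add: atLeast0LessThan)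
  finally have "x = (\<Sum>i<card ?F. coord x (h i) * m (h i))" .
  then show "x \<in> extend_ideal K UNIV"
    unfolding extend_ideal_def mem_Collect_eq using x
    by (intro exI[of _ "card ?F"] exI[of _ "\<lambda>i. coord x (h i)"] exI[of _ "\<lambda>i. m (h i)"] conjI) simp_all
qed

lemma right_ideal_extend: "right_ideal UNIV (extend_ideal K UNIV)"
  unfolding right_ideal_def
proof (intro conjI ballI subset_UNIV)
  show "0 \<in> extend_ideal K UNIV" using K_closed(2) by (simp add: extend_ideal_iff)
  show "x - y \<in> extend_ideal K UNIV" if "x \<in> extend_ideal K UNIV" "y \<in> extend_ideal K UNIV" for x y
    using that K_closed(3) by (simp add: extend_ideal_iff coord_diff)
  show "x * b \<in> extend_ideal K UNIV" if x: "x \<in> extend_ideal K UNIV" for x b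
  proof -
    obtain n :: nat and k y where "x = (\<Sum>i<n. k i * y i)" "\<forall>i<n. k i \<in> K \<and> y i \<in> UNIV"
      using x unfolding extend_ideal_def mem_Collect_eq by (elim exE conjE)
    then show ?thesis unfolding extend_ideal_def mem_Collect_eq
      by (intro exI[of _ n] exI[of _ k] exI[of _ "\<lambda>i. y i * b"]) (simp add: sum_distrib_right mult.assoc)
  qed
qed

lemmas KB_closed = right_idealD[OF right_ideal_extend]

lemma K_subset_extend:
  assumes "x \<in> K" shows "x \<in> extend_ideal K UNIV"
proof -
  have "x \<in> R" using assms K_closed(1) by blast
  then show ?thesis using assms K_closed(2) by (simp add: extend_ideal_iff coord_of_R)
qed

lemma extend_ideal_Int:
  assumes "x \<in> R" "x \<in> extend_ideal K UNIV" shows "x \<in> K"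
proof -
  have "coord x q0 \<in> K" using assms(2) by (simp only: extend_ideal_iff)
  then show ?thesis by (simp add: coord_of_R[OF assms(1)])
qed

text \<open>Freeness of \<open>B\<close> gives the kernel: modulo the tensor relations, an element of the free abelian group
  equals \<open>\<Sum>\<^sub>p k\<^sub>p \<otimes> m p\<close>, where the \<open>k\<^sub>p \<in> K\<close> are the coordinates of its image in \<open>B\<close>. If the image vanishes, so
  does this normal form.\<close>

lemma tensor_product_extend: "is_tensor_product R (*) K (*) UNIV (extend_ideal K UNIV) (*)"
proof -
  define \<phi> :: "('b \<times> 'b \<Rightarrow>\<^sub>0 int) \<Rightarrow> 'b" where
    "\<phi> c = (\<Sum>z\<in>Poly_Mapping.keys c. of_int (Poly_Mapping.lookup c z) * (fst z * snd z))" for c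
  define T where "T = tensor_relations R (*) K (*) (UNIV :: 'b set)"
  have \<phi>_superset: "\<phi> c = (\<Sum>z\<in>F. of_int (Poly_Mapping.lookup c z) * (fst z * snd z))"
    if "finite F" "Poly_Mapping.keys c \<subseteq> F" for c F
    unfolding \<phi>_def using that by (intro sum.mono_neutral_left) (auto simp: in_keys_iff)
  have \<phi>_add: "\<phi> (c + d) = \<phi> c + \<phi> d" for c d
  proof -
    let ?F = "Poly_Mapping.keys c \<union> Poly_Mapping.keys d"
    have "Poly_Mapping.keys (c + d) \<subseteq> ?F" by (rule keys_add)
    then show ?thesis
      by (simp add: \<phi>_superset[of ?F] lookup_add distrib_right sum.distrib)
  qed
  have \<phi>_0: "\<phi> 0 = 0" by (simp add: \<phi>_def)
  have \<phi>_diff: "\<phi> (c - d) = \<phi> c - \<phi> d" for c d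
    using \<phi>_add[of "c - d" d] by simp
  have \<phi>_of: "\<phi> (frag_of (x, y)) = x * y" for x y
    by (simp add: \<phi>_def keys_frag_of)
  have \<phi>_KB: "\<phi> c \<in> extend_ideal K UNIV" if "Poly_Mapping.keys c \<subseteq> K \<times> UNIV" for c
    unfolding \<phi>_def
  proof (rule right_ideal_sum[OF right_ideal_extend])
    fix z assume "z \<in> Poly_Mapping.keys c"
    then have "fst z \<in> K" using that by auto
    then have "fst z * (of_int (Poly_Mapping.lookup c z) * snd z) \<in> extend_ideal K UNIV"
      by (intro KB_closed(5) K_subset_extend) simp_all
    then show "of_int (Poly_Mapping.lookup c z) * (fst z * snd z) \<in> extend_ideal K UNIV"
      by (metis mult.assoc mult_of_int_commute)
  qed
  have image: "\<phi> ` {c. Poly_Mapping.keys c \<subseteq> K \<times> UNIV} = extend_ideal K UNIV"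
  proof (intro equalityI subsetI)
    fix x assume "x \<in> \<phi> ` {c. Poly_Mapping.keys c \<subseteq> K \<times> UNIV}"
    then show "x \<in> extend_ideal K UNIV" using \<phi>_KB by blast
  next
    fix x assume "x \<in> extend_ideal K UNIV"
    then obtain n :: nat and k y where x: "x = (\<Sum>i<n. k i * y i)" and k: "\<forall>i<n. k i \<in> K \<and> y i \<in> UNIV"
      unfolding extend_ideal_def mem_Collect_eq by (elim exE conjE)
    have "\<phi> (\<Sum>i<l. frag_of (k i, y i)) = (\<Sum>i<l. k i * y i)" for l
      by (induction l) (simp_all add: \<phi>_0 \<phi>_add \<phi>_of)
    moreover have "Poly_Mapping.keys (\<Sum>i<n. frag_of (k i, y i)) \<subseteq> K \<times> UNIV"
      using keys_sum[of "\<lambda>i. frag_of (k i, y i)" "{..<n}"] k by (auto simp: keys_frag_of)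
    ultimately show "x \<in> \<phi> ` {c. Poly_Mapping.keys c \<subseteq> K \<times> UNIV}"
      by (intro image_eqI[where x = "\<Sum>i<n. frag_of (k i, y i)"]) (simp_all add: x)
  qed
  have T_sub: "Poly_Mapping.keys c \<subseteq> K \<times> UNIV \<and> \<phi> c = 0" if "c \<in> T" for c
    using that unfolding T_def
  proof (induction rule: tensor_relations.induct)
    case zero
    then show ?case by (simp add: \<phi>_0)
  next
    case (diff u v)
    then show ?case using keys_diff[of u v] by (auto simp: \<phi>_diff)
  next
    case (add_left x x' y)
    have "Poly_Mapping.keys (frag_of (x + x', y) - frag_of (x, y) - frag_of (x', y)) \<subseteq>
        {(x + x', y), (x, y), (x', y)}"
      by (rule order_trans[OF keys_diff Un_least[OF order_trans[OF keys_diff Un_least]]])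
        (simp_all add: keys_frag_of)
    then show ?case using add_left K_closed(4)[of x x'] by (auto simp: \<phi>_diff \<phi>_add \<phi>_of algebra_simps)
  next
    case (add_right x y y')
    have "Poly_Mapping.keys (frag_of (x, y + y') - frag_of (x, y) - frag_of (x, y')) \<subseteq>
        {(x, y + y'), (x, y), (x, y')}"
      by (rule order_trans[OF keys_diff Un_least[OF order_trans[OF keys_diff Un_least]]])
        (simp_all add: keys_frag_of)
    then show ?case using add_right by (auto simp: \<phi>_diff \<phi>_add \<phi>_of algebra_simps)
  next
    case (balanced x r y)
    have "Poly_Mapping.keys (frag_of (x * r, y) - frag_of (x, r * y)) \<subseteq> {(x * r, y), (x, r * y)}"
      by (rule order_trans[OF keys_diff]) (simp add: keys_frag_of)
    then show ?case using balanced K_closed(5)[of x r] by (auto simp: \<phi>_diff \<phi>_of mult.assoc)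
  qed
  have T0: "0 \<in> T" and T_diff: "\<And>a b. a \<in> T \<Longrightarrow> b \<in> T \<Longrightarrow> a - b \<in> T"
    unfolding T_def by (auto intro: tensor_relations.intros)
  have T_minus: "- a \<in> T" if "a \<in> T" for a using T_diff[OF T0 that] by simp
  have T_add: "a + b \<in> T" if "a \<in> T" "b \<in> T" for a b using T_diff[OF that(1) T_minus[OF that(2)]] by simp
  have T_sum: "sum h F \<in> T" if "\<And>i. i \<in> F \<Longrightarrow> h i \<in> T" for h and F :: "'p set"
    using that by (induction F rule: infinite_finite_induct) (auto simp: T0 intro: T_add)
  have T_addl: "frag_of (x + x', y) - frag_of (x, y) - frag_of (x', y) \<in> T" if "x \<in> K" "x' \<in> K" for x x' y
    unfolding T_def using that by (intro tensor_relations.add_left) auto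
  have T_addr: "frag_of (x, y + y') - frag_of (x, y) - frag_of (x, y') \<in> T" if "x \<in> K" for x y y'
    unfolding T_def using that by (intro tensor_relations.add_right) auto
  have T_bal: "frag_of (x * r, y) - frag_of (x, r * y) \<in> T" if "x \<in> K" "r \<in> R" for x r y
    unfolding T_def using that by (intro tensor_relations.balanced) auto
  have T_0l: "frag_of (0, y) \<in> T" for y
    using T_minus[OF T_addl[OF K_closed(2) K_closed(2), of y]] by simp
  have T_0r: "frag_of (x, 0) \<in> T" if "x \<in> K" for x
    using T_minus[OF T_addr[OF that, of 0 0]] by simp
  have T_sumr: "frag_of (x, sum h F) - (\<Sum>p\<in>F. frag_of (x, h p)) \<in> T"
    if "x \<in> K" "finite F" for x h and F :: "'p set"
    using that(2)
  proof (induction F rule: finite_induct)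
    case empty
    then show ?case using T_0r[OF that(1)] by simp
  next
    case (insert p F)
    have "(frag_of (x, h p + sum h F) - frag_of (x, h p) - frag_of (x, sum h F))
        + (frag_of (x, sum h F) - (\<Sum>p\<in>F. frag_of (x, h p))) \<in> T"
      by (intro T_add T_addr that(1) insert.IH)
    then show ?case using insert.hyps by (simp add: algebra_simps)
  qed
  define N where "N F c = (\<Sum>p\<in>F. frag_of (coord (\<phi> c) p, m p))" for F c
  \<comment> \<open>The normal form may be taken over any sufficiently large finite index set \<open>F\<close>. This freedom
    is needed for differences, whose two parts have different supports.\<close>
  have normal: "\<exists>F0. finite F0 \<and> (\<forall>F. finite F \<and> F0 \<subseteq> F \<longrightarrow> c - N F c \<in> T)"
    if "Poly_Mapping.keys c \<subseteq> K \<times> UNIV" for c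
  proof -
    have "Poly_Mapping.keys c \<subseteq> K \<times> UNIV \<and>
        (\<exists>F0. finite F0 \<and> (\<forall>F. finite F \<and> F0 \<subseteq> F \<longrightarrow> c - N F c \<in> T))"
      using that
    proof (induction c rule: frag_induction)
      case zero
      have "0 - N F 0 \<in> T" for F
        unfolding N_def by (intro T_diff T0 T_sum) (simp add: \<phi>_0 T_0l)
      then show ?case by (intro conjI exI[of _ "{}"]) auto
    next
      case (one z)
      obtain x y where z: "z = (x, y)" and x: "x \<in> K" using one by auto
      have xR: "x \<in> R" using x K_closed(1) by blast
      have "frag_of (x, y) - N F (frag_of (x, y)) \<in> T" if F: "finite F" "{p. coord y p \<noteq> 0} \<subseteq> F" for F
      proof -
        have y: "y = (\<Sum>p\<in>F. coord y p * m p)" by (rule coord_expansion[OF F])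
        have "frag_of (x, \<Sum>p\<in>F. coord y p * m p) - (\<Sum>p\<in>F. frag_of (x, coord y p * m p)) \<in> T"
          by (rule T_sumr[OF x F(1)])
        then have 1: "frag_of (x, y) - (\<Sum>p\<in>F. frag_of (x, coord y p * m p)) \<in> T"
          by (simp only: y[symmetric])
        have "(\<Sum>p\<in>F. frag_of (x * coord y p, m p) - frag_of (x, coord y p * m p)) \<in> T"
          by (intro T_sum T_bal x coord_in_R)
        from T_diff[OF 1 this] show ?thesis
          by (simp add: N_def \<phi>_of coord_mult_left[OF xR] sum_subtractf)
      qed
      then show ?case unfolding z using x coord_finite[of y]
        by (intro conjI exI[of _ "{p. coord y p \<noteq> 0}"]) (auto simp: keys_frag_of)
    next
      case (diff a b)
      obtain Fa where a: "finite Fa" "\<forall>F. finite F \<and> Fa \<subseteq> F \<longrightarrow> a - N F a \<in> T"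
        and ka: "Poly_Mapping.keys a \<subseteq> K \<times> UNIV" using diff(1) by (elim conjE exE)
      obtain Fb where b: "finite Fb" "\<forall>F. finite F \<and> Fb \<subseteq> F \<longrightarrow> b - N F b \<in> T"
        and kb: "Poly_Mapping.keys b \<subseteq> K \<times> UNIV" using diff(2) by (elim conjE exE)
      have keys: "Poly_Mapping.keys (a - b) \<subseteq> K \<times> UNIV"
        by (rule order_trans[OF keys_diff Un_least[OF ka kb]])
      have Ka: "coord (\<phi> a) p \<in> K" and Kb: "coord (\<phi> b) p \<in> K" for p
        using \<phi>_KB[OF ka] \<phi>_KB[OF kb] by (simp_all add: extend_ideal_iff)
      have "(a - b) - N F (a - b) \<in> T" if F: "finite F" "Fa \<union> Fb \<subseteq> F" for F
      proof -
        have "(\<Sum>p\<in>F. frag_of (coord (\<phi> a) p, m p) - frag_of (coord (\<phi> a) p - coord (\<phi> b) p, m p)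
            - frag_of (coord (\<phi> b) p, m p)) \<in> T"
        proof (rule T_sum)
          fix p
          show "frag_of (coord (\<phi> a) p, m p) - frag_of (coord (\<phi> a) p - coord (\<phi> b) p, m p)
              - frag_of (coord (\<phi> b) p, m p) \<in> T"
            using T_addl[OF K_closed(3)[OF Ka[of p] Kb[of p]] Kb[of p], of "m p"] by simp
        qed
        then have n: "N F a - N F (a - b) - N F b \<in> T"
          by (simp add: N_def \<phi>_diff coord_diff sum_subtractf)
        have "a - N F a \<in> T" "b - N F b \<in> T" using a(2) b(2) F by simp_all
        from T_add[OF T_diff[OF this] n] show ?thesis by (simp add: algebra_simps)
      qed
      then show ?case using keys a(1) b(1) by (intro conjI exI[of _ "Fa \<union> Fb"]) auto
    qed
    then show ?thesis by blast
  qed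
  have kernel: "{c. Poly_Mapping.keys c \<subseteq> K \<times> UNIV \<and> \<phi> c = 0} = T"
  proof (intro equalityI subsetI)
    fix c assume "c \<in> {c. Poly_Mapping.keys c \<subseteq> K \<times> UNIV \<and> \<phi> c = 0}"
    then have c: "Poly_Mapping.keys c \<subseteq> K \<times> UNIV" "\<phi> c = 0" by auto
    obtain F where "finite F" "c - N F c \<in> T" using normal[OF c(1)] by blast
    moreover have "N F c \<in> T" unfolding N_def c(2) by (intro T_sum) (simp add: T_0l)
    ultimately have "c - N F c + N F c \<in> T" by (intro T_add)
    then show "c \<in> T" by simp
  next
    fix c assume "c \<in> T"
    then show "c \<in> {c. Poly_Mapping.keys c \<subseteq> K \<times> UNIV \<and> \<phi> c = 0}" using T_sub by blast
  qed
  show ?thesis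
    unfolding is_tensor_product_def
  proof (intro exI[of _ \<phi>] conjI ballI)
    show "Modules.additive \<phi>" by (rule Modules.additive.intro) (rule \<phi>_add)
    show "\<phi> (frag_of (x, y)) = x * y" for x y by (rule \<phi>_of)
    show "\<phi> ` {c. Poly_Mapping.keys c \<subseteq> K \<times> UNIV} = extend_ideal K UNIV" by (rule image)
    show "{c. Poly_Mapping.keys c \<subseteq> K \<times> UNIV \<and> \<phi> c = 0} = tensor_relations R (*) K (*) UNIV"
      using kernel unfolding T_def .
  qed
qed

text \<open>A system of linear equations with coefficients in \<open>R\<close> on the left splits into one system over \<open>R\<close>
  for each left coordinate.\<close>

lemma stable_matrix_extend:
  assumes M: "stable_matrix R K n l k w"
  shows "stable_matrix UNIV (extend_ideal K UNIV) n l k w"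
  unfolding stable_matrix_def
proof (intro conjI allI impI ballI UNIV_I)
  show "k i \<in> extend_ideal K UNIV" if "i < l" for i
    by (rule K_subset_extend[OF stable_matrixD(1)[OF M that]])
next
  fix v i
  assume v: "(\<forall>i<l. v i \<in> UNIV) \<and> (\<Sum>i<l. k i * v i) = 0 \<and> (\<forall>j<n. (\<Sum>i<l. w i j * v i) = 0)" and i: "i < l"
  have coord_comb: "coord (\<Sum>i<l. a i * v i) p = (\<Sum>i<l. a i * coord (v i) p)" if a: "\<And>i. i < l \<Longrightarrow> a i \<in> R" for a p
    unfolding coord_sum using a by (intro sum.cong refl coord_mult_left) auto
  have kR: "k i \<in> R" if "i < l" for i using stable_matrixD(1)[OF M that] K_closed(1) by blast
  have "coord (v i) p = 0" for p
  proof (rule stable_matrixD(3)[OF M coord_in_R _ _ i])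
    show "(\<Sum>i<l. k i * coord (v i) p) = 0" using coord_comb[of k p] kR v by simp
    show "(\<Sum>i<l. w i j * coord (v i) p) = 0" if "j < n" for j
      using coord_comb[of "\<lambda>i. w i j" p] stable_matrixD(2)[OF M _ that] v that by simp
  qed
  then show "v i = 0" using coord_expansion[of "{}" "v i"] by simp
next
  fix x and y :: "nat \<Rightarrow> 'b"
  assume x: "x \<in> extend_ideal K UNIV" and "\<forall>j<n. y j \<in> UNIV"
  have "\<forall>p. \<exists>v. (\<forall>i<l. v i \<in> R) \<and> coord x p = (\<Sum>i<l. k i * v i) \<and>
      (\<forall>j<n. coord (y j) p = (\<Sum>i<l. w i j * v i))"
    using x by (intro allI stable_matrix_surj[OF M]) (simp_all add: extend_ideal_iff coord_in_R)
  from choice[OF this] obtain V where V: "\<forall>p. (\<forall>i<l. V p i \<in> R) \<and> coord x p = (\<Sum>i<l. k i * V p i) \<and>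
      (\<forall>j<n. coord (y j) p = (\<Sum>i<l. w i j * V p i))"
    by (elim exE)
  let ?F = "{p. coord x p \<noteq> 0} \<union> (\<Union>j<n. {p. coord (y j) p \<noteq> 0})"
  have fin: "finite ?F" using coord_finite by simp
  define v where "v i = (\<Sum>p\<in>?F. V p i * m p)" for i
  have comb: "(\<Sum>i<l. a i * v i) = (\<Sum>p\<in>?F. (\<Sum>i<l. a i * V p i) * m p)" for a
  proof -
    have "(\<Sum>i<l. a i * v i) = (\<Sum>i<l. \<Sum>p\<in>?F. a i * V p i * m p)"
      unfolding v_def by (simp only: sum_distrib_left mult.assoc)
    also have "\<dots> = (\<Sum>p\<in>?F. \<Sum>i<l. a i * V p i * m p)" by (rule sum.swap)
    finally show ?thesis by (simp only: sum_distrib_right)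
  qed
  have "x = (\<Sum>i<l. k i * v i)"
  proof -
    have "x = (\<Sum>p\<in>?F. coord x p * m p)" by (rule coord_expansion[OF fin]) blast
    also have "\<dots> = (\<Sum>p\<in>?F. (\<Sum>i<l. k i * V p i) * m p)"
      by (rule sum.cong[OF refl]) (simp only: V[rule_format])
    finally show ?thesis by (simp only: comb)
  qed
  moreover have "y j = (\<Sum>i<l. w i j * v i)" if j: "j < n" for j
  proof -
    have "y j = (\<Sum>p\<in>?F. coord (y j) p * m p)" using j by (intro coord_expansion[OF fin]) blast
    also have "\<dots> = (\<Sum>p\<in>?F. (\<Sum>i<l. w i j * V p i) * m p)"
      using V j by (intro sum.cong[OF refl]) (metis (no_types, lifting))
    finally show ?thesis by (simp only: comb)
  qed
  ultimately show "\<exists>v. (\<forall>i<l. v i \<in> UNIV) \<and> x = (\<Sum>i<l. k i * v i) \<and> (\<forall>j<n. y j = (\<Sum>i<l. w i j * v i))"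
    by (intro exI[of _ v]) blast
qed

lemma fg_module_extend:
  assumes "fg_module R (*) K"
  shows "fg_module UNIV (*) (extend_ideal K UNIV)"
proof -
  obtain X where X: "X \<subseteq> K" "finite X" "\<forall>x\<in>K. \<exists>c. (\<forall>y\<in>X. c y \<in> R) \<and> x = (\<Sum>y\<in>X. y * c y)"
    using assms unfolding fg_module_def by (elim exE conjE)
  have "\<exists>c. x = (\<Sum>y\<in>X. y * c y)" if "x \<in> extend_ideal K UNIV" for x
  proof -
    let ?F = "{p. coord x p \<noteq> 0}"
    have "\<forall>p. \<exists>c. coord x p = (\<Sum>y\<in>X. y * c y)" using X(3) that extend_ideal_iff by meson
    from choice[OF this] obtain c where c: "\<forall>p. coord x p = (\<Sum>y\<in>X. y * c p y)" by (elim exE)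
    have "x = (\<Sum>p\<in>?F. coord x p * m p)" by (rule coord_expansion[OF coord_finite order_refl])
    also have "\<dots> = (\<Sum>p\<in>?F. \<Sum>y\<in>X. y * (c p y * m p))"
    proof (rule sum.cong[OF refl])
      fix p
      have "coord x p * m p = (\<Sum>y\<in>X. y * c p y) * m p" by (rule arg_cong[OF c[rule_format]])
      then show "coord x p * m p = (\<Sum>y\<in>X. y * (c p y * m p))" by (simp only: sum_distrib_right mult.assoc)
    qed
    also have "\<dots> = (\<Sum>y\<in>X. \<Sum>p\<in>?F. y * (c p y * m p))" by (rule sum.swap)
    also have "\<dots> = (\<Sum>y\<in>X. y * (\<Sum>p\<in>?F. c p y * m p))" by (simp only: sum_distrib_left)
    finally show ?thesis by (rule exI[of _ "\<lambda>y. \<Sum>p\<in>?F. c p y * m p"])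
  qed
  then show ?thesis
    unfolding fg_module_def using X(1,2) K_subset_extend by (intro exI[of _ X]) auto
qed

lemma stably_free_extend:
  assumes "stably_free R (*) K"
  shows "stably_free UNIV (*) (extend_ideal K UNIV)"
proof -
  obtain n l where "module_isomorphic R (sum_act (*) power_act) (K \<times> power_module R n) power_act (power_module R l)"
    using assms unfolding stably_free_def by blast
  then obtain k w where "stable_matrix R K n l k w" using stable_matrix_exists[OF subring_R K] by blast
  from stable_matrix_isomorphic[OF unital_subring_UNIV right_ideal_extend stable_matrix_extend[OF this]]
  show ?thesis using assms fg_module_extend unfolding stably_free_def by blast
qed

end

end

text \<open>The setting in which freeness of \<open>KB\<close> descends to \<open>K\<close>. The Ore domain \<open>R\<close> has a notion of rank, and the factors
  of a nonzero element of \<open>R\<close> cannot leave \<open>R\<close>.\<close>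

locale factor_closed_extension = left_free_extension R Q m q0
  for R :: "'b::ring_1 set" and Q :: "'p set" and m :: "'p \<Rightarrow> 'b" and q0 :: 'p +
  assumes domain_R: "nc_domain R" and ore_R: "right_ore R"
    and factor_closed: "x * y \<in> R \<Longrightarrow> x * y \<noteq> 0 \<Longrightarrow> x \<in> R \<and> y \<in> R"
begin

text \<open>The rank forces \<open>KB = bB\<close> to be generated by one element. Since \<open>K\<close> has a nonzero element, which \<open>b\<close>
  divides, factor closedness puts \<open>b\<close> into \<open>R\<close>, and then \<open>K = bR\<close>.\<close>

lemma free_extend_imp_free:
  assumes K: "right_ideal R K" and sf: "stably_free R (*) K" and IBN: "IBN (UNIV :: 'b set)"
    and free: "free_module UNIV (*) (extend_ideal K UNIV)"
  shows "free_module R (*) K"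
proof (cases "K = {0}")
  case True
  have "is_right_basis R (*) K {} (\<lambda>x. x)"
    by (rule is_right_basisI[OF subring_R]) (auto simp: True combinations_0)
  then show ?thesis unfolding free_module_def by (rule exI)
next
  case False
  let ?KB = "extend_ideal K UNIV"
  note KB = right_ideal_extend[OF K] and K_closed = right_idealD[OF K]
  obtain n l where fg: "fg_module R (*) K"
    and iso: "module_isomorphic R (sum_act (*) power_act) (K \<times> power_module R n) power_act (power_module R l)"
    using sf unfolding stably_free_def by blast
  obtain k w where M: "stable_matrix R K n l k w" using stable_matrix_exists[OF subring_R K iso] by blast
  have l: "l = Suc n" by (rule stable_matrix_rank[OF subring_R domain_R ore_R K False M])
  obtain X where X: "is_right_basis UNIV (*) ?KB X (\<lambda>x. x)" using free unfolding free_module_def by blast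
  have X_KB: "X \<subseteq> ?KB" using X unfolding is_right_basis_def by simp
  have finX: "finite X"
    by (rule is_right_basis_finite[OF X unital_subring_UNIV right_idealD(2)[OF KB] fg_module_extend[OF K fg]])
  obtain h where h: "bij_betw h {0..<card X} X" using ex_bij_betw_nat_finite[OF finX] by blast
  let ?r = "card X"
  have reindex: "(\<Sum>i<?r. h i * v i) = (\<Sum>x\<in>X. x * v (the_inv_into {0..<?r} h x))" for v
  proof -
    have "(\<Sum>i\<in>{0..<?r}. h i * v (the_inv_into {0..<?r} h (h i))) = (\<Sum>x\<in>X. x * v (the_inv_into {0..<?r} h x))"
      by (rule sum.reindex_bij_betw[OF h])
    moreover have "(\<Sum>i\<in>{0..<?r}. h i * v (the_inv_into {0..<?r} h (h i))) = (\<Sum>i<?r. h i * v i)"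
    proof (rule sum.cong)
      fix i assume "i \<in> {..<?r}"
      then have "the_inv_into {0..<?r} h (h i) = i"
        using h by (intro the_inv_into_f_f) (auto simp: bij_betw_def)
      then show "h i * v (the_inv_into {0..<?r} h (h i)) = h i * v i" by simp
    qed (simp add: atLeast0LessThan)
    ultimately show ?thesis by simp
  qed
  \<comment> \<open>An isomorphism \<open>B\<^sup>r\<^sup>+\<^sup>n \<cong> KB \<oplus> B\<^sup>n\<close> built from the basis \<open>X\<close> of \<open>KB\<close>, with \<open>r = card X\<close>.\<close>
  define g where "g v = (\<Sum>i<?r. h i * v i, \<lambda>j. if j < n then v (?r + j) else 0)" for v :: "nat \<Rightarrow> 'b"
  have g_add: "g (x + y) = g x + g y" for x y
    by (auto simp: g_def distrib_left sum.distrib fun_eq_iff)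
  have g_act: "g (power_act x b) = sum_act (*) power_act (g x) b" for x b
    by (auto simp: g_def power_act_def sum_act_def sum_distrib_right mult.assoc fun_eq_iff)
  have hX: "h i \<in> X" if "i < ?r" for i using h that by (auto simp: bij_betw_def)
  have g_in: "g v \<in> ?KB \<times> power_module UNIV n" for v
    using hX X_KB by (auto simp: g_def power_module_def intro!: right_ideal_sum[OF KB] right_idealD(5)[OF KB])
  have g_0: "v i = 0" if v: "v \<in> power_module UNIV (?r + n)" and gv: "g v = 0" for v i
  proof -
    have s: "(\<Sum>x\<in>X. x * v (the_inv_into {0..<?r} h x)) = 0" and t: "\<And>j. (if j < n then v (?r + j) else 0) = 0"
      using gv unfolding g_def zero_prod_def prod.inject fun_eq_iff reindex by simp_all
    have "v i = 0" if i: "i < ?r" for i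
    proof -
      have "v (the_inv_into {0..<?r} h (h i)) = 0"
        by (rule is_right_basis_independent[OF X unital_subring_UNIV right_idealD(2)[OF KB] finX order_refl,
              where c = "\<lambda>x. v (the_inv_into {0..<?r} h x)", OF _ s hX[OF i]]) simp
      moreover have "the_inv_into {0..<?r} h (h i) = i"
        using h i by (intro the_inv_into_f_f) (auto simp: bij_betw_def)
      ultimately show ?thesis by simp
    qed
    moreover have "v i = 0" if "?r \<le> i" "i < ?r + n" for i using t[of "i - ?r"] that by (simp split: if_splits)
    moreover have "v i = 0" if "?r + n \<le> i" for i using v that by (simp add: power_module_def)
    ultimately show ?thesis by (meson not_le)
  qed
  have g_inj: "x = y" if "x \<in> power_module UNIV (?r + n)" "y \<in> power_module UNIV (?r + n)" "g x = g y" for x y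
  proof
    fix i
    have "g (x - y) + g y = g x" using g_add[of "x - y" y] by simp
    then have "g (x - y) = 0" using that(3) by simp
    moreover have "x - y \<in> power_module UNIV (?r + n)" using that(1,2) by (simp add: power_module_def)
    ultimately have "(x - y) i = 0" by (rule g_0[rotated])
    then show "x i = y i" by simp
  qed
  have g_surj: "z \<in> g ` power_module UNIV (?r + n)" if z: "z \<in> ?KB \<times> power_module UNIV n" for z
  proof -
    obtain x y where xy: "z = (x, y)" "x \<in> ?KB" "y \<in> power_module UNIV n" using z by blast
    obtain F c where F: "finite F" "F \<subseteq> X" "\<forall>j. j \<notin> F \<longrightarrow> c j = 0" and x: "x = (\<Sum>j\<in>F. j * c j)"
      using is_right_basis_span[OF X xy(2)] by (elim exE conjE)
    have "(\<Sum>j\<in>F. j * c j) = (\<Sum>j\<in>X. j * c j)"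
      using F finX by (intro sum.mono_neutral_left) auto
    also have "\<dots> = (\<Sum>i<?r. h i * c (h i))"
      using sum.reindex_bij_betw[OF h, of "\<lambda>j. j * c j"] by (simp add: atLeast0LessThan)
    finally have x': "x = (\<Sum>i<?r. h i * c (h i))" by (rule trans[OF x])
    let ?v = "\<lambda>i. if i < ?r then c (h i) else if i < ?r + n then y (i - ?r) else 0"
    have "g ?v = z" unfolding g_def xy(1) x'
      using xy(3) by (auto simp: fun_eq_iff power_module_def)
    moreover have "?v \<in> power_module UNIV (?r + n)" by (simp add: power_module_def)
    ultimately show ?thesis by blast
  qed
  have "bij_betw g (power_module UNIV (?r + n)) (?KB \<times> power_module UNIV n)"
    using g_inj g_in g_surj by (intro bij_betw_imageI inj_onI) blast+
  then have "module_isomorphic UNIV power_act (power_module UNIV (?r + n))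
      (sum_act (*) power_act) (?KB \<times> power_module UNIV n)"
    unfolding module_isomorphic_def using g_add g_act by blast
  from module_isomorphic_trans[OF this
      stable_matrix_isomorphic[OF unital_subring_UNIV KB stable_matrix_extend[OF K M]]]
  have "?r + n = l" using IBN unfolding IBN_def by blast
  then have "card X = 1" using l by simp
  then obtain b where Xb: "X = {b}" by (auto simp: card_1_singleton_iff)
  have gen: "\<exists>c. x = b * c" if x: "x \<in> ?KB" for x
  proof -
    obtain F c where F: "F \<subseteq> X" and x': "x = (\<Sum>j\<in>F. j * c j)"
      using is_right_basis_span[OF X x] by (elim exE conjE)
    consider "F = {}" | "F = {b}" using F Xb by blast
    then show ?thesis
    proof cases
      case 1
      then show ?thesis unfolding x' by (intro exI[of _ 0]) simp
    next
      case 2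
      then show ?thesis unfolding x' by (intro exI[of _ "c b"]) simp
    qed
  qed
  obtain a where a: "a \<in> K" "a \<noteq> 0" using False K_closed(2) by blast
  obtain c where c: "a = b * c" using gen K_subset_extend[OF K a(1)] by blast
  have bR: "b \<in> R" using factor_closed[of b c] a c K_closed(1) by blast
  have b0: "b \<noteq> 0" using a c by auto
  have bK: "b \<in> K" using extend_ideal_Int[OF K bR] X_KB Xb by blast
  have "is_right_basis R (*) K {b} (\<lambda>x. x)"
  proof (rule is_right_basisI[OF subring_R])
    show "(\<lambda>x. x) ` {b} \<subseteq> K" using bK by simp
  next
    show "K \<subseteq> combinations (\<lambda>x r. x * r) {b} R"
    proof
      fix x assume x: "x \<in> K"
      obtain d where d: "x = b * d" using gen K_subset_extend[OF K x] by blast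
      show "x \<in> combinations (\<lambda>x r. x * r) {b} R"
      proof (cases "x = 0")
        case True
        then show ?thesis by (simp add: combinations_0)
      next
        case False
        then have "d \<in> R" using factor_closed[of b d] x d K_closed(1) by blast
        then show ?thesis unfolding d by (intro combinations_single) simp_all
      qed
    qed
  next
    fix F and c :: "'b \<Rightarrow> 'b" and j
    assume F: "F \<subseteq> {b}" "\<And>j. j \<in> F \<Longrightarrow> c j \<in> R" "(\<Sum>j\<in>F. j * c j) = 0" "j \<in> F"
    then have Fb: "F = {b}" and j: "j = b" by blast+
    have "c b \<in> R" "b * c b = 0" using F(2)[OF F(4)] F(3) unfolding Fb j by simp_all
    then have "b = 0 \<or> c b = 0" by (rule nc_domainD[OF domain_R bR])
    then show "c j = 0" using b0 j by simp
  qed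
  then show ?thesis unfolding free_module_def by (rule exI)
qed

end

section \<open>Weights and ordered monomials\<close>

text \<open>The weighted degree of a monomial.\<close>

definition wt :: "('i \<Rightarrow> nat) \<Rightarrow> ('i \<Rightarrow>\<^sub>0 nat) \<Rightarrow> nat" where
  "wt w p = (\<Sum>i\<in>Poly_Mapping.keys p. w i * Poly_Mapping.lookup p i)"

abbreviation deg :: "('i \<Rightarrow>\<^sub>0 nat) \<Rightarrow> nat" where "deg \<equiv> wt (\<lambda>_. Suc 0)"
abbreviation unit_exp :: "'i \<Rightarrow> 'i \<Rightarrow>\<^sub>0 nat" where "unit_exp i \<equiv> Poly_Mapping.single i (Suc 0)"

lemma wt_superset:
  assumes "finite F" "Poly_Mapping.keys p \<subseteq> F"
  shows "wt w p = (\<Sum>i\<in>F. w i * Poly_Mapping.lookup p i)"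
  unfolding wt_def using assms
  by (intro sum.mono_neutral_left) (auto simp: in_keys_iff)

lemma wt_zero [simp]: "wt w 0 = 0"
  by (simp add: wt_def)

lemma wt_single [simp]: "wt w (Poly_Mapping.single i n) = w i * n"
  by (simp add: wt_def)

lemma wt_add: "wt w (p + q) = wt w p + wt w q"
proof -
  let ?F = "Poly_Mapping.keys p \<union> Poly_Mapping.keys q"
  have "Poly_Mapping.keys (p + q) \<subseteq> ?F" by (rule keys_add)
  then show ?thesis
    by (simp add: wt_superset[of ?F] lookup_add distrib_left sum.distrib)
qed

lemma keys_single_add:
  fixes p :: "'i \<Rightarrow>\<^sub>0 nat"
  shows "Poly_Mapping.keys (unit_exp j + p) = insert j (Poly_Mapping.keys p)"
  by (auto simp: in_keys_iff lookup_add lookup_single when_def split: if_splits)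

lemma ordered_monomial_zero [simp]: "ordered_monomial u 0 = 1"
  by (simp add: ordered_monomial_def)

lemma ordered_monomial_split_least:
  assumes "\<And>k. k \<in> Poly_Mapping.keys p \<Longrightarrow> j \<le> k"
  shows "ordered_monomial u p = u j ^ Poly_Mapping.lookup p j *
    prod_list (map (\<lambda>i. u i ^ Poly_Mapping.lookup p i) (sorted_list_of_set (Poly_Mapping.keys p - {j})))"
proof (cases "j \<in> Poly_Mapping.keys p")
  case True
  then have "Min (Poly_Mapping.keys p) = j"
    using assms by (intro Min_eqI) auto
  then have "sorted_list_of_set (Poly_Mapping.keys p) = j # sorted_list_of_set (Poly_Mapping.keys p - {j})"
    using True sorted_list_of_set_nonempty[of "Poly_Mapping.keys p"] by (metis finite_keys empty_iff)
  then show ?thesis by (simp add: ordered_monomial_def)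
next
  case False
  then show ?thesis by (simp add: ordered_monomial_def in_keys_iff)
qed

lemma ordered_monomial_Cons:
  assumes "\<And>k. k \<in> Poly_Mapping.keys p \<Longrightarrow> j \<le> k"
  shows "ordered_monomial u (unit_exp j + p) = u j * ordered_monomial u p"
proof -
  let ?q = "unit_exp j + p"
  have k: "Poly_Mapping.keys ?q - {j} = Poly_Mapping.keys p - {j}"
    unfolding keys_single_add by blast
  have m: "map (\<lambda>i. u i ^ Poly_Mapping.lookup ?q i) (sorted_list_of_set (Poly_Mapping.keys p - {j})) =
      map (\<lambda>i. u i ^ Poly_Mapping.lookup p i) (sorted_list_of_set (Poly_Mapping.keys p - {j}))"
    by (rule map_cong) (auto simp: lookup_add lookup_single when_def)
  have "ordered_monomial u ?q = u j ^ Poly_Mapping.lookup ?q j *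
      prod_list (map (\<lambda>i. u i ^ Poly_Mapping.lookup ?q i) (sorted_list_of_set (Poly_Mapping.keys ?q - {j})))"
    using assms by (intro ordered_monomial_split_least) (auto simp: keys_single_add)
  also have "\<dots> = u j * ordered_monomial u p"
    unfolding k m ordered_monomial_split_least[OF assms, of p u, simplified]
    by (simp add: lookup_add mult.assoc)
  finally show ?thesis .
qed

lemma ordered_monomial_single: "ordered_monomial u (Poly_Mapping.single j n) = u j ^ n"
proof (induction n)
  case (Suc n)
  have "Poly_Mapping.single j (Suc n) = unit_exp j + Poly_Mapping.single j n"
    by (simp flip: single_add)
  moreover have "ordered_monomial u (unit_exp j + Poly_Mapping.single j n) = u j * u j ^ n"
    by (subst ordered_monomial_Cons) (auto simp: Suc split: if_splits)
  ultimately show ?case by simp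
qed simp

lemma exponent_peel:
  fixes p :: "'i::linorder \<Rightarrow>\<^sub>0 nat"
  assumes "p \<noteq> 0"
  obtains j q where "p = unit_exp j + q" "\<And>k. k \<in> Poly_Mapping.keys p \<Longrightarrow> j \<le> k"
proof -
  let ?j = "Min (Poly_Mapping.keys p)"
  have ne: "Poly_Mapping.keys p \<noteq> {}" using assms by simp
  then have j: "?j \<in> Poly_Mapping.keys p" by simp
  let ?q = "p - unit_exp ?j"
  have "p = unit_exp ?j + ?q"
    using j by (intro poly_mapping_eqI) (auto simp: lookup_add lookup_minus lookup_single when_def in_keys_iff)
  moreover have "\<And>k. k \<in> Poly_Mapping.keys p \<Longrightarrow> ?j \<le> k" by simp
  ultimately show ?thesis using that by blast
qed

section \<open>Rings with ordered monomials as a right basis\<close>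

text \<open>What the Poincare-Birkhoff-Witt arguments use of a crossed product. The set \<open>U\<close> stands for the image of the Lie
  algebra, and the \<open>u i\<close> for the images of its basis vectors. Keeping \<open>U\<close> apart from \<open>u\<close> allows the variables to be
  exchanged while the commutator conditions stay the same. Elements of \<open>A\<close> take
  the place of scalars in the combinations of variables.\<close>

locale pbw_ring =
  fixes A :: "'b::ring_1 set" and I :: "'i::linorder set" and u :: "'i \<Rightarrow> 'b" and U :: "'b set"
  assumes subring_A: "unital_subring A"
    and u_in_U: "i \<in> I \<Longrightarrow> u i \<in> U"
    and commutator_coefficient: "x \<in> U \<Longrightarrow> a \<in> A \<Longrightarrow> x * a - a * x \<in> A"
    and commutator_U: "x \<in> U \<Longrightarrow> y \<in> U \<Longrightarrow> \<exists>z\<in>U. x * y - y * x - z \<in> A"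
    and U_combination: "x \<in> U \<Longrightarrow> \<exists>T c. finite T \<and> T \<subseteq> I \<and> (\<forall>k\<in>T. c k \<in> A) \<and> x = (\<Sum>k\<in>T. u k * c k)"
    and monomial_basis: "is_right_basis A (*) UNIV {p. Poly_Mapping.keys p \<subseteq> I} (ordered_monomial u)"
begin

abbreviation exps :: "('i \<Rightarrow>\<^sub>0 nat) set" where "exps \<equiv> {p. Poly_Mapping.keys p \<subseteq> I}"
abbreviation mon :: "('i \<Rightarrow>\<^sub>0 nat) \<Rightarrow> 'b" where "mon \<equiv> ordered_monomial u"

lemmas A_closed = unital_subringD[OF subring_A]

definition coef :: "'b \<Rightarrow> ('i \<Rightarrow>\<^sub>0 nat) \<Rightarrow> 'b" where
  "coef x = (THE c. (\<forall>p. c p \<in> A) \<and> finite {p. c p \<noteq> 0} \<and> {p. c p \<noteq> 0} \<subseteq> exps \<and>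
        x = (\<Sum>p | c p \<noteq> 0. mon p * c p))"

lemma coef_ex1: "\<exists>!c. (\<forall>p. c p \<in> A) \<and> finite {p. c p \<noteq> 0} \<and> {p. c p \<noteq> 0} \<subseteq> exps \<and>
        x = (\<Sum>p | c p \<noteq> 0. mon p * c p)"
  using monomial_basis unfolding is_right_basis_def by (elim conjE) (rule bspec[OF _ UNIV_I])

lemma coef_in_A: "coef x p \<in> A"
  and coef_finite: "finite {p. coef x p \<noteq> 0}"
  and coef_exps: "coef x p \<noteq> 0 \<Longrightarrow> p \<in> exps"
  and coef_expansion: "x = (\<Sum>p | coef x p \<noteq> 0. mon p * coef x p)"
proof -
  note c = theI'[OF coef_ex1[of x], folded coef_def]
  show "coef x p \<in> A" "finite {p. coef x p \<noteq> 0}" using c by blast+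
  show "coef x p \<noteq> 0 \<Longrightarrow> p \<in> exps" using c by blast
  show "x = (\<Sum>p | coef x p \<noteq> 0. mon p * coef x p)" using c by (elim conjE)
qed

lemma coef_expansion_superset:
  assumes "finite F" "\<And>p. coef x p \<noteq> 0 \<Longrightarrow> p \<in> F"
  shows "x = (\<Sum>p\<in>F. mon p * coef x p)"
proof -
  have "(\<Sum>p | coef x p \<noteq> 0. mon p * coef x p) = (\<Sum>p\<in>F. mon p * coef x p)"
    using assms by (intro sum.mono_neutral_left) auto
  with coef_expansion[of x] show ?thesis by (rule trans)
qed

lemma coef_eqI:
  assumes "finite F" "F \<subseteq> exps" "\<And>p. c p \<in> A" "\<And>p. p \<notin> F \<Longrightarrow> c p = 0"
    and "x = (\<Sum>p\<in>F. mon p * c p)"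
  shows "coef x = c"
proof -
  have s: "{p. c p \<noteq> 0} \<subseteq> F" using assms(4) by blast
  have "(\<Sum>p | c p \<noteq> 0. mon p * c p) = (\<Sum>p\<in>F. mon p * c p)"
    using assms(1) s by (intro sum.mono_neutral_left) auto
  then have "x = (\<Sum>p | c p \<noteq> 0. mon p * c p)" using assms(5) by (rule trans[rotated, OF sym])
  then have "(\<forall>p. c p \<in> A) \<and> finite {p. c p \<noteq> 0} \<and> {p. c p \<noteq> 0} \<subseteq> exps \<and>
        x = (\<Sum>p | c p \<noteq> 0. mon p * c p)"
    using assms(1-3) s by (meson finite_subset order_trans)
  then show ?thesis unfolding coef_def using the1_equality[OF coef_ex1] by blast
qed

lemma coef_diff: "coef (x - y) p = coef x p - coef y p"
proof -
  let ?F = "{p. coef x p \<noteq> 0} \<union> {p. coef y p \<noteq> 0}"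
  have "x - y = (\<Sum>p\<in>?F. mon p * coef x p) - (\<Sum>p\<in>?F. mon p * coef y p)"
    using coef_finite[of x] coef_finite[of y] by (intro arg_cong2[of _ _ _ _ "(-)"] coef_expansion_superset) auto
  then have "coef (x - y) = (\<lambda>p. coef x p - coef y p)"
    using coef_finite coef_exps coef_in_A A_closed
    by (intro coef_eqI[of ?F]) (auto simp: right_diff_distrib sum_subtractf)
  then show ?thesis by simp
qed

lemma coef_0 [simp]: "coef 0 p = 0"
  using coef_diff[of 0 0 p] by simp

lemma coef_add: "coef (x + y) p = coef x p + coef y p"
  using coef_diff[of x "0 - y" p] coef_diff[of 0 y p] by simp

lemma coef_sum: "coef (sum f F) p = (\<Sum>i\<in>F. coef (f i) p)"
  by (induction F rule: infinite_finite_induct) (auto simp: coef_add)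

lemma coef_mult_right:
  assumes "a \<in> A" shows "coef (x * a) p = coef x p * a"
proof -
  let ?F = "{p. coef x p \<noteq> 0}"
  have "x * a = (\<Sum>p\<in>?F. mon p * coef x p) * a"
    by (rule arg_cong[OF coef_expansion])
  then have "x * a = (\<Sum>p\<in>?F. mon p * (coef x p * a))"
    by (simp add: sum_distrib_right mult.assoc)
  then have "coef (x * a) = (\<lambda>p. coef x p * a)"
    using coef_finite[of x] coef_exps assms coef_in_A A_closed
    by (intro coef_eqI[of ?F]) auto
  then show ?thesis by simp
qed

lemma coef_mon:
  assumes "p \<in> exps" shows "coef (mon p) q = (if q = p then 1 else 0)"
proof -
  have "coef (mon p) = (\<lambda>q. if q = p then 1 else 0)"
    using assms A_closed by (intro coef_eqI[of "{p}"]) auto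
  then show ?thesis by simp
qed

lemma coef_mon_mult:
  assumes "p \<in> exps" "a \<in> A" shows "coef (mon p * a) q = (if q = p then a else 0)"
  using assms by (simp add: coef_mult_right coef_mon)

lemma coef_eq_0I: "(\<And>p. coef x p = 0) \<Longrightarrow> x = 0"
  by (subst coef_expansion) simp

definition supported :: "('i \<Rightarrow>\<^sub>0 nat) set \<Rightarrow> 'b set" where
  "supported S = {x. \<forall>p. coef x p \<noteq> 0 \<longrightarrow> p \<in> S}"

lemma supported_mono: "x \<in> supported S \<Longrightarrow> S \<subseteq> S' \<Longrightarrow> x \<in> supported S'"
  by (auto simp: supported_def)

lemma supported_0: "0 \<in> supported S"
    and supported_add: "x \<in> supported S \<Longrightarrow> y \<in> supported S \<Longrightarrow> x + y \<in> supported S"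
    and supported_diff: "x \<in> supported S \<Longrightarrow> y \<in> supported S \<Longrightarrow> x - y \<in> supported S"
    and supported_mult_right: "x \<in> supported S \<Longrightarrow> a \<in> A \<Longrightarrow> x * a \<in> supported S"
proof -
  show "x \<in> supported S \<Longrightarrow> y \<in> supported S \<Longrightarrow> x + y \<in> supported S"
    unfolding supported_def mem_Collect_eq coef_add by (metis add_0)
  show "x \<in> supported S \<Longrightarrow> y \<in> supported S \<Longrightarrow> x - y \<in> supported S"
    unfolding supported_def mem_Collect_eq coef_diff by (metis diff_0_right)
  show "x \<in> supported S \<Longrightarrow> a \<in> A \<Longrightarrow> x * a \<in> supported S"
    unfolding supported_def mem_Collect_eq by (metis coef_mult_right mult_zero_left)
qed (simp add: supported_def)

lemma supported_sum: "(\<And>i. i \<in> F \<Longrightarrow> f i \<in> supported S) \<Longrightarrow> sum f F \<in> supported S"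
  by (induction F rule: infinite_finite_induct) (auto simp: supported_0 supported_add)

lemma supported_mon: "p \<in> exps \<Longrightarrow> p \<in> S \<Longrightarrow> mon p \<in> supported S"
  by (auto simp: supported_def coef_mon split: if_splits)

lemma supported_coefficient:
  assumes "a \<in> A" "0 \<in> S" shows "a \<in> supported S"
  using supported_mult_right[OF supported_mon[of 0 S] assms(1)] assms(2) by simp

lemma supported_mult_left:
  assumes "\<And>p. p \<in> S \<Longrightarrow> p \<in> exps \<Longrightarrow> y * mon p \<in> supported S'" and "x \<in> supported S"
  shows "y * x \<in> supported S'"
proof -
  have "y * x = y * (\<Sum>p | coef x p \<noteq> 0. mon p * coef x p)" by (rule arg_cong[OF coef_expansion])
  also have "\<dots> = (\<Sum>p | coef x p \<noteq> 0. (y * mon p) * coef x p)"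
    by (simp add: sum_distrib_left mult.assoc)
  also have "\<dots> \<in> supported S'"
    using assms coef_exps coef_in_A
    by (intro supported_sum supported_mult_right assms(1)) (auto simp: supported_def)
  finally show ?thesis .
qed

end

text \<open>The conditions say that \<open>u i * u j\<close>, for \<open>i \<noteq> j\<close>, has larger weight than its commutator, a combination of variables
  up to an element of \<open>A\<close>, and that \<open>u i * a\<close> has larger weight than \<open>\<delta>(a) \<in> A\<close>.\<close>

locale weighted_pbw_ring = pbw_ring A I u U
  for A :: "'b::ring_1 set" and I :: "'i::linorder set" and u :: "'i \<Rightarrow> 'b" and U :: "'b set" +
  fixes w :: "'i \<Rightarrow> nat"
  assumes w_pos: "i \<in> I \<Longrightarrow> 0 < w i"
    and w_less: "i \<in> I \<Longrightarrow> j \<in> I \<Longrightarrow> k \<in> I \<Longrightarrow> i \<noteq> j \<Longrightarrow> w k < w i + w j"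
begin

abbreviation lower :: "nat \<Rightarrow> 'b set" where "lower n \<equiv> supported {p. wt w p < n}"

abbreviation lower2 :: "nat \<Rightarrow> nat \<Rightarrow> 'b set" where
  "lower2 d n \<equiv> supported {p. deg p < d \<and> wt w p < n}"

text \<open>The induction is on the total degree, and the remainders are bounded in degree and in weight. The weight alone
  does not work: after \<open>u i * mon q\<close> is reduced for \<open>p = \<epsilon>\<^sub>j + q\<close>, the remainder may have larger weight than \<open>p\<close> if
  \<open>w i > w j\<close>, and it still has to be multiplied by \<open>u j\<close>. Its total degree is smaller than that of \<open>p\<close>.\<close>

lemma commutation_lead:
  assumes "p \<in> exps"
  shows "(\<forall>i\<in>I. u i * mon p - mon (unit_exp i + p) \<in> lower2 (deg p + 1) (wt w p + w i))
       \<and> (\<forall>a\<in>A. a * mon p - mon p * a \<in> lower2 (deg p) (wt w p))"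
  using assms
proof (induction "deg p" arbitrary: p rule: less_induct)
  case less
  let ?s = "unit_exp"
  let ?d = "deg"
  show ?case
  proof (cases "p = 0")
    case True
    then show ?thesis by (simp add: ordered_monomial_single[of u _ "Suc 0", simplified] supported_0)
  next
    case False
    obtain j q where p: "p = ?s j + q" and least: "\<And>k. k \<in> Poly_Mapping.keys p \<Longrightarrow> j \<le> k"
      using exponent_peel[OF False] by metis
    have kp: "Poly_Mapping.keys p = insert j (Poly_Mapping.keys q)" by (simp only: p keys_single_add)
    then have j: "j \<in> I" and q: "q \<in> exps" using less.prems by auto
    have least_q: "\<And>k. k \<in> Poly_Mapping.keys q \<Longrightarrow> j \<le> k" using kp least by blast
    have mp: "mon p = u j * mon q" unfolding p by (rule ordered_monomial_Cons[OF least_q])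
    have dp: "?d p = Suc (?d q)" and wp: "wt w p = w j + wt w q" by (simp_all add: p wt_add)
    have wj: "0 < w j" by (rule w_pos[OF j])
    have IHu: "u i * mon r - mon (?s i + r) \<in> lower2 (?d r + 1) (wt w r + w i)"
      if "r \<in> exps" "?d r \<le> ?d q" "i \<in> I" for r i
      using less.hyps[of r] that dp by auto
    have IHa: "a * mon r - mon r * a \<in> lower2 (?d r) (wt w r)"
      if "r \<in> exps" "?d r \<le> ?d q" "a \<in> A" for r a
      using less.hyps[of r] that dp by auto
    have s_exps: "?s i + r \<in> exps" if "r \<in> exps" "i \<in> I" for r i
      using that keys_add[of "?s i" r] by auto
    have u_lower2: "u i * x \<in> lower2 (m + 1) (n + w i)"
      if x: "x \<in> lower2 m n" and m: "m \<le> Suc (?d q)" and i: "i \<in> I" for x m n i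
    proof (rule supported_mult_left[OF _ x])
      fix r assume r: "r \<in> {p. ?d p < m \<and> wt w p < n}" "r \<in> exps"
      have "u i * mon r - mon (?s i + r) \<in> lower2 (m + 1) (n + w i)"
        using r m by (intro supported_mono[OF IHu[OF r(2) _ i]]) auto
      moreover have "mon (?s i + r) \<in> lower2 (m + 1) (n + w i)"
        using r by (intro supported_mon s_exps i) (auto simp: wt_add)
      ultimately have "(u i * mon r - mon (?s i + r)) + mon (?s i + r) \<in> lower2 (m + 1) (n + w i)"
        by (rule supported_add)
      then show "u i * mon r \<in> lower2 (m + 1) (n + w i)" by simp
    qed
    have aq: "a * mon q \<in> lower2 (?d q + 1) (wt w q + 1)" if a: "a \<in> A" for a
    proof -
      have "a * mon q - mon q * a \<in> lower2 (?d q + 1) (wt w q + 1)"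
        by (rule supported_mono[OF IHa[OF q _ a]]) auto
      moreover have "mon q * a \<in> lower2 (?d q + 1) (wt w q + 1)"
        using q by (intro supported_mult_right[OF _ a] supported_mon) auto
      ultimately show ?thesis using supported_add by fastforce
    qed
    have A_part: "a * mon p - mon p * a \<in> lower2 (?d p) (wt w p)" if a: "a \<in> A" for a
    proof -
      let ?b = "u j * a - a * u j"
      have b: "?b \<in> A" by (rule commutator_coefficient[OF u_in_U[OF j] a])
      have "a * mon p - mon p * a = u j * (a * mon q - mon q * a) - ?b * mon q"
        by (simp add: mp algebra_simps)
      moreover have "u j * (a * mon q - mon q * a) \<in> lower2 (?d p) (wt w p)"
        using u_lower2[OF IHa[OF q _ a] _ j] by (simp add: dp wp add.commute)
      moreover have "?b * mon q \<in> lower2 (?d p) (wt w p)"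
        by (rule supported_mono[OF aq[OF b]]) (use wj in \<open>auto simp: dp wp\<close>)
      ultimately show ?thesis using supported_diff by simp
    qed
    have U_part: "u i * mon p - mon (?s i + p) \<in> lower2 (?d p + 1) (wt w p + w i)" if i: "i \<in> I" for i
    proof (cases "i \<le> j")
      case True
      then have "mon (?s i + p) = u i * mon p"
        using least by (intro ordered_monomial_Cons) (meson order_trans)
      then show ?thesis by (simp add: supported_0)
    next
      case False
      then have ij: "i \<noteq> j" by auto
      let ?S = "lower2 (?d p + 1) (wt w p + w i)"
      obtain z where z: "z \<in> U" "u i * u j - u j * u i - z \<in> A"
        using commutator_U[OF u_in_U[OF i] u_in_U[OF j]] by blast
      let ?a = "u i * u j - u j * u i - z"
      obtain T c where T: "finite T" "T \<subseteq> I" "\<And>k. k \<in> T \<Longrightarrow> c k \<in> A" "z = (\<Sum>k\<in>T. u k * c k)"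
        using U_combination[OF z(1)] by blast
      have key: "\<And>k. k \<in> Poly_Mapping.keys (?s i + q) \<Longrightarrow> j \<le> k"
        using False least_q by (auto simp: keys_single_add)
      have "?s i + p = ?s j + (?s i + q)" by (simp add: p ac_simps)
      then have mip: "mon (?s i + p) = u j * mon (?s i + q)"
        using ordered_monomial_Cons[OF key, where u = u] by simp
      \<comment> \<open>Move \<open>u i\<close> past the least variable \<open>u j\<close>, at the cost of the commutator \<open>z + ?a\<close>.\<close>
      have eq: "u i * mon p - mon (?s i + p) =
          u j * (u i * mon q - mon (?s i + q)) + (\<Sum>k\<in>T. u k * (c k * mon q)) + ?a * mon q"
        unfolding mip mp
      proof -
        have "(\<Sum>k\<in>T. u k * (c k * mon q)) = z * mon q"
          by (simp add: T(4) sum_distrib_right mult.assoc)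
        then show "u i * (u j * mon q) - u j * mon (?s i + q) =
          u j * (u i * mon q - mon (?s i + q)) + (\<Sum>k\<in>T. u k * (c k * mon q)) + ?a * mon q"
          by (simp add: algebra_simps)
      qed
      have "u j * (u i * mon q - mon (?s i + q)) \<in> ?S"
        using u_lower2[OF IHu[OF q _ i] _ j] by (simp add: dp wp ac_simps)
      moreover have "(\<Sum>k\<in>T. u k * (c k * mon q)) \<in> ?S"
      proof (rule supported_sum)
        fix k assume k: "k \<in> T"
        then have kI: "k \<in> I" using T by blast
        have "u k * (c k * mon q) \<in> lower2 (?d q + 1 + 1) (wt w q + 1 + w k)"
          using k T by (intro u_lower2 aq kI) auto
        then show "u k * (c k * mon q) \<in> ?S"
          by (rule supported_mono) (use w_less[OF i j kI] ij in \<open>auto simp: dp wp\<close>)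
      qed
      moreover have "?a * mon q \<in> ?S"
        by (rule supported_mono[OF aq[OF z(2)]]) (use wj in \<open>auto simp: dp wp\<close>)
      ultimately show ?thesis unfolding eq by (intro supported_add)
    qed
    show ?thesis using A_part U_part by blast
  qed
qed

lemma variable_mult_lead:
  assumes "i \<in> I" "p \<in> exps"
  shows "u i * mon p - mon (unit_exp i + p) \<in> lower (w i + wt w p)"
proof -
  have "u i * mon p - mon (unit_exp i + p) \<in> lower2 (deg p + 1) (wt w p + w i)"
    using commutation_lead[OF assms(2)] assms(1) by blast
  then show ?thesis by (rule supported_mono) auto
qed

lemma coefficient_mult_lead:
  assumes "a \<in> A" "p \<in> exps"
  shows "a * mon p - mon p * a \<in> lower (wt w p)"
proof -
  have "a * mon p - mon p * a \<in> lower2 (deg p) (wt w p)"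
    using commutation_lead[OF assms(2)] assms(1) by blast
  then show ?thesis by (rule supported_mono) auto
qed

lemma single_add_exps: "i \<in> I \<Longrightarrow> p \<in> exps \<Longrightarrow> unit_exp i + p \<in> exps"
  by (simp add: keys_single_add)

lemma variable_mult_lower:
  assumes "x \<in> lower n" "i \<in> I" shows "u i * x \<in> lower (w i + n)"
proof (rule supported_mult_left[OF _ assms(1)])
  fix p assume p: "p \<in> {p. wt w p < n}" "p \<in> exps"
  have "u i * mon p - mon (unit_exp i + p) \<in> lower (w i + n)"
    by (rule supported_mono[OF variable_mult_lead[OF assms(2) p(2)]]) (use p in auto)
  moreover have "mon (unit_exp i + p) \<in> lower (w i + n)"
    using p assms(2) by (intro supported_mon single_add_exps) (auto simp: wt_add)
  ultimately show "u i * mon p \<in> lower (w i + n)" using supported_add by fastforce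
qed

lemma coefficient_mult_lower:
  assumes "x \<in> lower n" "a \<in> A" shows "a * x \<in> lower n"
proof (rule supported_mult_left[OF _ assms(1)])
  fix p assume p: "p \<in> {p. wt w p < n}" "p \<in> exps"
  have "a * mon p - mon p * a \<in> lower n"
    by (rule supported_mono[OF coefficient_mult_lead[OF assms(2) p(2)]]) (use p in auto)
  moreover have "mon p * a \<in> lower n"
    using p assms(2) by (intro supported_mon supported_mult_right) auto
  ultimately show "a * mon p \<in> lower n" using supported_add by fastforce
qed

lemma exps_induct [consumes 1, case_names zero add]:
  assumes "p \<in> exps" and "P 0"
    and step: "\<And>j q. j \<in> I \<Longrightarrow> q \<in> exps \<Longrightarrow> (\<And>k. k \<in> Poly_Mapping.keys q \<Longrightarrow> j \<le> k) \<Longrightarrow> P q \<Longrightarrow>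
      P (unit_exp j + q)"
  shows "P p"
  using assms(1)
proof (induction "deg p" arbitrary: p rule: less_induct)
  case less
  show ?case
  proof (cases "p = 0")
    case False
    obtain j q where p: "p = unit_exp j + q"
      and least: "\<And>k. k \<in> Poly_Mapping.keys p \<Longrightarrow> j \<le> k"
      using exponent_peel[OF False] by metis
    have kp: "Poly_Mapping.keys p = insert j (Poly_Mapping.keys q)" by (simp only: p keys_single_add)
    have "P q" using kp less.prems by (intro less.hyps) (auto simp: p wt_add)
    then show ?thesis unfolding p using kp less.prems least by (intro step) auto
  qed (use assms in simp)
qed

lemma mon_mult_lead:
  assumes "p \<in> exps" "q \<in> exps"
  shows "mon p * mon q - mon (p + q) \<in> lower (wt w p + wt w q)"
  using assms(1)
proof (induction p rule: exps_induct)
  case zero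
  then show ?case by (simp add: supported_0)
next
  case (add j p)
  let ?s = "unit_exp j"
  have pq: "p + q \<in> exps" using add.hyps(2) assms(2) keys_add[of p q] by auto
  have "mon (?s + p) * mon q - mon (?s + p + q) =
      u j * (mon p * mon q - mon (p + q)) + (u j * mon (p + q) - mon (?s + (p + q)))"
    using ordered_monomial_Cons[OF add.hyps(3), where u = u] by (simp add: algebra_simps)
  also have "\<dots> \<in> lower (wt w (?s + p) + wt w q)"
    using variable_mult_lower[OF add.IH add.hyps(1)] variable_mult_lead[OF add.hyps(1) pq]
    by (intro supported_add) (simp_all add: wt_add ac_simps)
  finally show ?case .
qed

lemma mon_mult_lower:
  assumes "p \<in> exps" "x \<in> lower n" shows "mon p * x \<in> lower (wt w p + n)"
  using assms(1)
proof (induction p rule: exps_induct)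
  case (add j p)
  then show ?case
    using ordered_monomial_Cons[OF add.hyps(3), where u = u] variable_mult_lower[OF add.IH add.hyps(1)]
    by (simp add: mult.assoc wt_add ac_simps)
qed (use assms in simp)

text \<open>The associated graded ring is the polynomial ring over \<open>A\<close>.\<close>

lemma term_mult_lead:
  assumes "p \<in> exps" "q \<in> exps" "a \<in> A"
  shows "mon p * a * mon q - mon (p + q) * a \<in> lower (wt w p + wt w q)"
proof -
  have "mon p * a * mon q - mon (p + q) * a =
      mon p * (a * mon q - mon q * a) + (mon p * mon q - mon (p + q)) * a"
    by (simp add: algebra_simps)
  also have "\<dots> \<in> lower (wt w p + wt w q)"
    using assms
    by (intro supported_add mon_mult_lower coefficient_mult_lead supported_mult_right mon_mult_lead)
  finally show ?thesis .
qed

lemma coef_lower: "x \<in> lower n \<Longrightarrow> n \<le> wt w p \<Longrightarrow> coef x p = 0"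
  by (auto simp: supported_def)

text \<open>In a vanishing sum, look at the coefficient of a monomial of largest weight among those with \<open>c p \<noteq> 0\<close>: only its
  own term contributes.\<close>

lemma triangular_independent:
  assumes F: "finite F" "F \<subseteq> exps" and c: "\<And>p. p \<in> F \<Longrightarrow> c p \<in> A"
    and t: "\<And>p. p \<in> F \<Longrightarrow> t p - mon p * c p \<in> lower (wt w p)"
    and t0: "\<And>p. p \<in> F \<Longrightarrow> c p = 0 \<Longrightarrow> t p = 0"
    and 0: "(\<Sum>p\<in>F. t p) = 0"
  shows "\<forall>p\<in>F. c p = 0"
proof (rule ccontr)
  let ?G = "{p\<in>F. c p \<noteq> 0}"
  assume "\<not> ?thesis"
  then have G: "?G \<noteq> {}" by auto
  have fin: "finite (wt w ` ?G)" using F by simp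
  have "Max (wt w ` ?G) \<in> wt w ` ?G" using G F by (intro Max_in) auto
  then obtain p where p: "p \<in> ?G" "wt w p = Max (wt w ` ?G)" by auto
  have max: "wt w q \<le> wt w p" if "q \<in> ?G" for q using that fin p(2) by simp
  have lead: "coef (t q) p = (if q = p then c p else 0)" if q: "q \<in> F" for q
  proof (cases "c q = 0")
    case True
    then show ?thesis using t0[OF q] by auto
  next
    case False
    have "coef (t q - mon q * c q) p = 0"
      using max[of q] False q by (intro coef_lower[OF t[OF q]]) auto
    then have "coef (t q) p = coef (mon q * c q) p" by (simp add: coef_diff)
    then show ?thesis using q F c by (auto simp: coef_mon_mult)
  qed
  have "0 = coef (\<Sum>q\<in>F. t q) p" using 0 by simp
  also have "\<dots> = (\<Sum>q\<in>F. if q = p then c p else 0)" using lead by (simp add: coef_sum)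
  also have "\<dots> = c p" using p F by (simp add: sum.delta)
  finally show False using p by simp
qed

lemma lower_UNIV:
  obtains n where "x \<in> lower n"
proof
  let ?N = "Suc (Max (insert 0 (wt w ` {p. coef x p \<noteq> 0})))"
  show "x \<in> lower ?N" unfolding supported_def
    using coef_finite[of x] by (auto simp: less_Suc_eq_le intro!: Max_ge)
qed

text \<open>Subtracting the elements of \<open>Y\<close> that match the monomials of an element lowers its weight, and weights
  are natural numbers.\<close>

lemma triangular_span:
  assumes add: "\<And>x y. x \<in> Y \<Longrightarrow> y \<in> Y \<Longrightarrow> x + y \<in> Y" and zero: "0 \<in> Y"
    and t: "\<And>p a. p \<in> exps \<Longrightarrow> a \<in> A \<Longrightarrow> \<exists>y\<in>Y. mon p * a - y \<in> lower (wt w p)"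
  shows "x \<in> Y"
proof -
  obtain n where "x \<in> lower n" by (rule lower_UNIV)
  then show ?thesis
  proof (induction n arbitrary: x rule: less_induct)
    case (less n)
    have "\<forall>p. \<exists>y. coef x p \<noteq> 0 \<longrightarrow> y \<in> Y \<and> mon p * coef x p - y \<in> lower (wt w p)"
      using t coef_exps coef_in_A by meson
    then obtain y where y: "\<And>p. coef x p \<noteq> 0 \<Longrightarrow> y p \<in> Y"
        "\<And>p. coef x p \<noteq> 0 \<Longrightarrow> mon p * coef x p - y p \<in> lower (wt w p)"
      by metis
    have "x = (\<Sum>p | coef x p \<noteq> 0. (mon p * coef x p - y p) + y p)"
      using coef_expansion[of x] by (simp only: diff_add_cancel)
    also have "\<dots> \<in> Y"
    proof -
      have step: "(mon p * coef x p - y p) + y p \<in> Y" if p: "coef x p \<noteq> 0" for p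
      proof -
        have "wt w p < n" using less.prems p by (auto simp: supported_def)
        then show ?thesis using less.IH[OF _ y(2)[OF p]] y(1)[OF p] add by blast
      qed
      have "(\<Sum>p\<in>F. (mon p * coef x p - y p) + y p) \<in> Y" if "F \<subseteq> {p. coef x p \<noteq> 0}" for F
        using that step
        by (induction F rule: infinite_finite_induct) (auto simp: zero intro!: add simp del: diff_add_cancel)
      then show ?thesis by blast
    qed
    finally show ?case .
  qed
qed

text \<open>Among the monomials of largest weight, the lexicographically largest one is chosen in either factor. The lexicographic
  order is compatible with addition of exponents, so the product of the two chosen monomials is obtained in one way only,
  and its coefficient is a product of nonzero elements of the domain \<open>A\<close>.\<close>

lemma leading_term_mult:
  assumes dom: "nc_domain A" and x: "x \<noteq> 0" and y: "y \<noteq> 0"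
  obtains p q where "coef x p \<noteq> 0" "\<forall>p'. coef x p' \<noteq> 0 \<longrightarrow> wt w p' \<le> wt w p"
    "coef y q \<noteq> 0" "\<forall>q'. coef y q' \<noteq> 0 \<longrightarrow> wt w q' \<le> wt w q"
    "coef (x * y) (p + q) \<noteq> 0"
proof -
  have ex: "\<exists>p. coef z p \<noteq> 0 \<and> (\<forall>p'. coef z p' \<noteq> 0 \<longrightarrow> wt w p' \<le> wt w p \<and> (wt w p' = wt w p \<longrightarrow> p' \<le> p))"
    if "z \<noteq> 0" for z
  proof -
    define G where "G = {p. coef z p \<noteq> 0}"
    have G: "finite G" "G \<noteq> {}" using that coef_finite[of z] coef_eq_0I[of z] by (auto simp: G_def)
    define m where "m = Max (wt w ` G)"
    have m: "wt w p \<le> m" if "p \<in> G" for p using that G by (simp add: m_def)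
    have "m \<in> wt w ` G" unfolding m_def using G by (intro Max_in) auto
    then obtain r where r: "m = wt w r" "r \<in> G" by (rule imageE)
    define H where "H = {p\<in>G. wt w p = m}"
    have H: "finite H" "H \<noteq> {}" using G r by (auto simp: H_def)
    have "Max H \<in> H" using H by (rule Max_in)
    then have "coef z (Max H) \<noteq> 0" "wt w (Max H) = m" by (auto simp: H_def G_def)
    moreover have "p' \<le> Max H" if "p' \<in> G" "wt w p' = m" for p'
      using that H by (simp add: H_def)
    ultimately show ?thesis using m unfolding G_def by (intro exI[of _ "Max H"]) simp
  qed
  obtain p where p: "coef x p \<noteq> 0" "\<And>p'. coef x p' \<noteq> 0 \<Longrightarrow> wt w p' \<le> wt w p"
      "\<And>p'. coef x p' \<noteq> 0 \<Longrightarrow> wt w p' = wt w p \<Longrightarrow> p' \<le> p"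
    using ex[OF x] by blast
  obtain q where q: "coef y q \<noteq> 0" "\<And>q'. coef y q' \<noteq> 0 \<Longrightarrow> wt w q' \<le> wt w q"
      "\<And>q'. coef y q' \<noteq> 0 \<Longrightarrow> wt w q' = wt w q \<Longrightarrow> q' \<le> q"
    using ex[OF y] by blast
  let ?X = "{p. coef x p \<noteq> 0}" and ?Y = "{p. coef y p \<noteq> 0}"
  have "x * y = (\<Sum>p'\<in>?X. mon p' * coef x p') * (\<Sum>q'\<in>?Y. mon q' * coef y q')"
    by (intro arg_cong2[of _ _ _ _ "(*)"] coef_expansion)
  also have "\<dots> = (\<Sum>(p', q')\<in>?X \<times> ?Y. (mon p' * coef x p' * mon q') * coef y q')"
    by (simp add: sum_product sum.cartesian_product mult.assoc)
  finally have xy: "coef (x * y) (p + q) =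
      (\<Sum>(p', q')\<in>?X \<times> ?Y. coef (mon p' * coef x p' * mon q') (p + q) * coef y q')"
    by (simp add: coef_sum case_prod_beta coef_mult_right coef_in_A)
  have t: "coef (mon p' * coef x p' * mon q') (p + q) = (if (p', q') = (p, q) then coef x p else 0)"
    if p': "coef x p' \<noteq> 0" and q': "coef y q' \<noteq> 0" for p' q'
  proof -
    have e: "p' \<in> exps" "q' \<in> exps" using p' q' coef_exps by auto
    then have e': "p' + q' \<in> exps" using keys_add[of p' q'] by auto
    have "coef (mon p' * coef x p' * mon q' - mon (p' + q') * coef x p') (p + q) = 0"
      using p(2)[OF p'] q(2)[OF q'] by (intro coef_lower[OF term_mult_lead] e coef_in_A) (simp add: wt_add)
    then have "coef (mon p' * coef x p' * mon q') (p + q) = (if p + q = p' + q' then coef x p' else 0)"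
      using coef_mon_mult[OF e' coef_in_A] by (simp add: coef_diff)
    moreover have "p' = p \<and> q' = q" if eq: "p + q = p' + q'"
    proof -
      have "wt w p + wt w q = wt w p' + wt w q'" using eq by (metis wt_add)
      then have "wt w p' = wt w p" "wt w q' = wt w q" using p(2)[OF p'] q(2)[OF q'] by auto
      then have le: "p' \<le> p" "q' \<le> q" using p(3) q(3) p' q' by auto
      have "p' = p"
      proof (rule ccontr)
        assume "p' \<noteq> p"
        then have "p' + q' < p + q" using le by (intro add_less_le_mono) auto
        then show False using eq by simp
      qed
      then show ?thesis using eq by simp
    qed
    ultimately show ?thesis by auto
  qed
  have "coef (x * y) (p + q) = (\<Sum>z\<in>?X \<times> ?Y. if z = (p, q) then coef x p * coef y q else 0)"
    unfolding xy
  proof (rule sum.cong[OF refl], clarify)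
    fix p' q' assume "coef x p' \<noteq> 0" "coef y q' \<noteq> 0"
    from t[OF this] show "coef (mon p' * coef x p' * mon q') (p + q) * coef y q' =
        (if (p', q') = (p, q) then coef x p * coef y q else 0)" by auto
  qed
  also have "\<dots> = coef x p * coef y q"
    using p q coef_finite[of x] coef_finite[of y] by (simp add: sum.delta)
  finally have c: "coef (x * y) (p + q) = coef x p * coef y q" .
  have "coef x p * coef y q \<noteq> 0" using dom p q coef_in_A unfolding nc_domain_def by blast
  then show ?thesis using that p(1,2) q(1,2) c by auto
qed

end

section \<open>Exchanging a basis vector\<close>

text \<open>With a larger weight for variable \<open>i\<close> than for the others, the leading part of \<open>x\<close> is \<open>u i * c i\<close>. The
  ordered monomials in the new variables are then triangular with respect to the old ones, with the invertible
  diagonal entries \<open>(c i)\<^sup>n\<close>, where \<open>n\<close> is the exponent of \<open>i\<close>.\<close>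

lemma pbw_ring_exchange:
  fixes u :: "'i::linorder \<Rightarrow> 'b::ring_1"
  assumes "pbw_ring A I u U" and xU: "x \<in> U"
    and T: "finite T" "T \<subseteq> I" "\<And>k. k \<in> T \<Longrightarrow> c k \<in> A" "x = (\<Sum>k\<in>T. u k * c k)"
    and i: "i \<in> T" and d: "d \<in> A" "c i * d = 1" "d * c i = 1"
  shows "pbw_ring A I (u(i := x)) U"
proof -
  interpret pbw_ring A I u U by fact
  \<comment> \<open>The weight of \<open>i\<close> must stay below twice the weight of the others, so 2 and 1 would not do.\<close>
  define w :: "'i \<Rightarrow> nat" where "w k = (if k = i then 3 else 2)" for k
  have wi: "w i = 3" and wk: "k \<noteq> i \<Longrightarrow> w k = 2" "2 \<le> w k" "w k \<le> 3" for k by (auto simp: w_def)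
  interpret weighted_pbw_ring A I u U w
    by unfold_locales (auto simp: w_def)
  define v where "v = u(i := x)"
  have vi: "v i = x" and vk: "k \<noteq> i \<Longrightarrow> v k = u k" for k by (simp_all add: v_def)
  have iI: "i \<in> I" using i T by blast
  let ?c = "\<lambda>p::'i \<Rightarrow>\<^sub>0 nat. c i ^ Poly_Mapping.lookup p i"
  let ?d = "\<lambda>p::'i \<Rightarrow>\<^sub>0 nat. d ^ Poly_Mapping.lookup p i"
  have pow: "y ^ n \<in> A" if "y \<in> A" for y n
    using that by (induction n) (auto simp: A_closed)
  have inv: "c i ^ n * d ^ n = 1 \<and> d ^ n * c i ^ n = 1" for n
  proof (induction n)
    case (Suc n)
    have "c i ^ Suc n * d ^ Suc n = c i * (c i ^ n * d ^ n) * d"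
      by (simp add: power_commutes mult.assoc flip: power_Suc2)
    moreover have "d ^ Suc n * c i ^ Suc n = d * (d ^ n * c i ^ n) * c i"
      by (simp add: power_commutes mult.assoc flip: power_Suc2)
    ultimately show ?case using Suc d by simp
  qed simp
  have lead: "ordered_monomial v p - mon p * ?c p \<in> lower (wt w p)" if "p \<in> exps" for p
    using that
  proof (induction p rule: exps_induct)
    case zero
    then show ?case by (simp add: supported_0)
  next
    case (add j p)
    let ?r = "ordered_monomial v p - mon p * ?c p"
    have m: "ordered_monomial v (unit_exp j + p) = v j * ordered_monomial v p"
      "mon (unit_exp j + p) = u j * mon p"
      by (simp_all only: ordered_monomial_Cons[OF add.hyps(3)])
    show ?case
    proof (cases "j = i")
      case False
      have "ordered_monomial v (unit_exp j + p) - mon (unit_exp j + p) * ?c (unit_exp j + p) = u j * ?r"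
        unfolding m vk[OF False] using False by (simp add: lookup_add lookup_single right_diff_distrib mult.assoc)
      then show ?thesis using variable_mult_lower[OF add.IH add.hyps(1)] by (simp add: wt_add)
    next
      case True
      have eq: "ordered_monomial v (unit_exp j + p) - mon (unit_exp j + p) * ?c (unit_exp j + p) =
          (\<Sum>k\<in>T. u k * (c k * ?r)) + (\<Sum>k\<in>T - {i}. u k * (c k * mon p * ?c p))
          + u i * ((c i * mon p - mon p * c i) * ?c p)"
      proof -
        have "x * ordered_monomial v p = x * ?r + x * (mon p * ?c p)" by (simp add: algebra_simps)
        also have "x * ?r = (\<Sum>k\<in>T. u k * (c k * ?r))"
          by (simp only: T(4) sum_distrib_right mult.assoc)
        also have "x * (mon p * ?c p) = (\<Sum>k\<in>T. u k * (c k * mon p * ?c p))"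
          by (simp only: T(4) sum_distrib_right mult.assoc)
        also have "\<dots> = u i * (c i * mon p * ?c p) + (\<Sum>k\<in>T - {i}. u k * (c k * mon p * ?c p))"
          by (rule sum.remove[OF T(1) i])
        finally show ?thesis
          unfolding True m[unfolded True vi] by (simp add: lookup_add left_diff_distrib right_diff_distrib mult.assoc)
      qed
      have cm: "c k * mon p * ?c p \<in> lower (Suc (wt w p))" if k: "k \<in> T" for k
        using add.hyps(2)
        by (intro supported_mult_right coefficient_mult_lower supported_mon T(3) k pow i) auto
      have "(\<Sum>k\<in>T. u k * (c k * ?r)) \<in> lower (3 + wt w p)"
      proof (rule supported_sum)
        fix k assume k: "k \<in> T"
        have "u k * (c k * ?r) \<in> lower (w k + wt w p)"
          using k T by (intro variable_mult_lower coefficient_mult_lower add.IH) auto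
        then show "u k * (c k * ?r) \<in> lower (3 + wt w p)"
          by (rule supported_mono) (use wk(3)[of k] in auto)
      qed
      moreover have "(\<Sum>k\<in>T - {i}. u k * (c k * mon p * ?c p)) \<in> lower (3 + wt w p)"
      proof (rule supported_sum)
        fix k assume k: "k \<in> T - {i}"
        have "u k * (c k * mon p * ?c p) \<in> lower (w k + Suc (wt w p))"
          using k T by (intro variable_mult_lower cm) auto
        then show "u k * (c k * mon p * ?c p) \<in> lower (3 + wt w p)"
          by (rule supported_mono) (use k wk(1)[of k] in auto)
      qed
      moreover have "u i * ((c i * mon p - mon p * c i) * ?c p) \<in> lower (3 + wt w p)"
        using variable_mult_lower[OF supported_mult_right[OF coefficient_mult_lead[OF T(3)[OF i] add.hyps(2)]
          pow[OF T(3)[OF i]]] iI] by (simp add: wi)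
      ultimately show ?thesis unfolding eq by (simp add: wt_add True wi supported_add)
    qed
  qed
  have lead': "ordered_monomial v p * a - mon p * (?c p * a) \<in> lower (wt w p)"
    if "p \<in> exps" "a \<in> A" for p a
    using supported_mult_right[OF lead[OF that(1)] that(2)] by (simp add: algebra_simps)
  have indep: "\<forall>p\<in>F. a p = 0"
    if F: "finite F" "F \<subseteq> exps" and a: "\<And>p. p \<in> F \<Longrightarrow> a p \<in> A"
      and 0: "(\<Sum>p\<in>F. ordered_monomial v p * a p) = 0" for F a
  proof
    have unit: "?c p * y = 0 \<Longrightarrow> y = 0" for p y
      using inv[of "Poly_Mapping.lookup p i"] by (metis mult.assoc mult_1_left mult_zero_right)
    have t0: "?c p * a p = 0 \<Longrightarrow> ordered_monomial v p * a p = 0" for p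
      using unit[of p "a p"] by simp
    have "\<forall>p\<in>F. ?c p * a p = 0"
      using F(2) a
      by (intro triangular_independent[OF F _ _ _ 0] lead' t0) (auto intro: A_closed pow T(3) i)
    then show "a p = 0" if "p \<in> F" for p using that unit by blast
  qed
  have span: "y \<in> combinations (\<lambda>p a. ordered_monomial v p * a) exps A" for y
  proof (rule triangular_span)
    fix p a assume p: "p \<in> exps" and a: "a \<in> A"
    have da: "?d p * a \<in> A" by (rule A_closed(5)[OF pow[OF d(1)] a])
    have "?c p * (?d p * a) = a"
      using inv[of "Poly_Mapping.lookup p i"] by (simp flip: mult.assoc)
    then have "ordered_monomial v p * (?d p * a) - mon p * a \<in> lower (wt w p)"
      using lead'[OF p da] by (simp only:)
    from supported_diff[OF supported_0 this]
    have "mon p * a - ordered_monomial v p * (?d p * a) \<in> lower (wt w p)" by simp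
    then show "\<exists>y\<in>combinations (\<lambda>p a. ordered_monomial v p * a) exps A. mon p * a - y \<in> lower (wt w p)"
      using combinations_single[OF p da, of "\<lambda>p a. ordered_monomial v p * a"] by blast
  qed (simp_all add: combinations_0 combinations_add[OF subring_A] distrib_left)
  have basis: "is_right_basis A (*) UNIV exps (ordered_monomial v)"
  proof (rule is_right_basisI[OF subring_A subset_UNIV])
    show "UNIV \<subseteq> combinations (\<lambda>p a. ordered_monomial v p * a) exps A" using span by blast
  next
    fix F a p
    assume "finite F" "F \<subseteq> exps" "\<And>p. p \<in> F \<Longrightarrow> a p \<in> A" "(\<Sum>p\<in>F. ordered_monomial v p * a p) = 0" "p \<in> F"
    then show "a p = 0" using indep by blast
  qed
  show ?thesis
    unfolding v_def[symmetric]
  proof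
    show "unital_subring A" by (rule subring_A)
    show "\<And>k. k \<in> I \<Longrightarrow> v k \<in> U" using u_in_U xU by (simp add: v_def)
    show "is_right_basis A (*) UNIV exps (ordered_monomial v)" by (rule basis)
    fix y assume y: "y \<in> U"
    show "y * a - a * y \<in> A" if "a \<in> A" for a using commutator_coefficient[OF y that] .
    show "\<exists>z\<in>U. y * y' - y' * y - z \<in> A" if "y' \<in> U" for y' using commutator_U[OF y that] .
    obtain S b where S: "finite S" "S \<subseteq> I" "\<And>k. k \<in> S \<Longrightarrow> b k \<in> A" "y = (\<Sum>k\<in>S. u k * b k)"
      using U_combination[OF y] by blast
    let ?b = "\<lambda>k. if k \<in> S then b k else 0" and ?c' = "\<lambda>k. if k \<in> T then c k else 0"
    let ?S = "S \<union> T"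
    have mem: "?b k \<in> A" "?c' k \<in> A" for k using S(3) T(3) A_closed by auto
    have yS: "y = (\<Sum>k\<in>?S. u k * ?b k)"
      unfolding S(4) using S(1) T(1) by (intro sum.mono_neutral_cong_left) auto
    have xT: "x = (\<Sum>k\<in>?S. u k * ?c' k)"
      unfolding T(4) using S(1) T(1) by (intro sum.mono_neutral_cong_left) auto
    have fin: "finite ?S" "i \<in> ?S" using S T i by auto
    have x': "x = u i * c i + (\<Sum>k\<in>?S - {i}. u k * ?c' k)"
      using xT sum.remove[OF fin, of "\<lambda>k. u k * ?c' k"] i by simp
    have ui: "u i = (x - (\<Sum>k\<in>?S - {i}. u k * ?c' k)) * d"
    proof -
      have "x - (\<Sum>k\<in>?S - {i}. u k * ?c' k) = u i * c i" using x' by (simp add: algebra_simps)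
      then show ?thesis using d by (simp add: mult.assoc)
    qed
    let ?e = "\<lambda>k. if k = i then d * ?b i else ?b k - ?c' k * d * ?b i"
    have "y = u i * ?b i + (\<Sum>k\<in>?S - {i}. u k * ?b k)"
      using yS sum.remove[OF fin, of "\<lambda>k. u k * ?b k"] by simp
    also have "\<dots> = x * (d * ?b i) + (\<Sum>k\<in>?S - {i}. u k * (?b k - ?c' k * d * ?b i))"
      by (subst ui) (simp add: left_diff_distrib right_diff_distrib sum_subtractf sum_distrib_right mult.assoc
          del: if_split)
    also have "\<dots> = (\<Sum>k\<in>?S. v k * ?e k)"
      by (subst sum.remove[OF fin]) (auto intro!: sum.cong simp: vi vk)
    finally have "y = (\<Sum>k\<in>?S. v k * ?e k)" .
    moreover have "?e k \<in> A" for k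
      using A_closed(5)[OF d(1) mem(1)[of i]]
        A_closed(3)[OF mem(1)[of k] A_closed(5)[OF A_closed(5)[OF mem(2)[of k] d(1)] mem(1)[of i]]]
      by (cases "k = i") (simp_all only: if_True if_False simp_thms)
    ultimately show "\<exists>F e. finite F \<and> F \<subseteq> I \<and> (\<forall>k\<in>F. e k \<in> A) \<and> y = (\<Sum>k\<in>F. v k * e k)"
      using fin(1) S(2) T(2) by (intro exI[of _ ?S] exI[of _ ?e] conjI ballI) (assumption | blast)+
  qed
qed

section \<open>The Ore extension generated by one variable\<close>

lemma keys_subset_singleton: "Poly_Mapping.keys p \<subseteq> {i} \<longleftrightarrow> p = Poly_Mapping.single i (Poly_Mapping.lookup p i)"
proof
  assume p: "Poly_Mapping.keys p \<subseteq> {i}"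
  show "p = Poly_Mapping.single i (Poly_Mapping.lookup p i)"
  proof (rule poly_mapping_eqI)
    fix k
    show "Poly_Mapping.lookup p k = Poly_Mapping.lookup (Poly_Mapping.single i (Poly_Mapping.lookup p i)) k"
      using p by (cases "k = i") (auto simp: lookup_single in_keys_iff)
  qed
next
  assume p: "p = Poly_Mapping.single i (Poly_Mapping.lookup p i)"
  show "Poly_Mapping.keys p \<subseteq> {i}" by (subst p) simp
qed

context pbw_ring
begin

text \<open>The right span of the powers of \<open>u i\<close>: the Ore extension \<open>A[u i; \<delta>]\<close>, seen through its monomials.\<close>

definition ore_part :: "'i \<Rightarrow> 'b set" where
  "ore_part i = supported {p. Poly_Mapping.keys p \<subseteq> {i}}"

lemma ore_part_diff: "x \<in> ore_part i \<Longrightarrow> y \<in> ore_part i \<Longrightarrow> x - y \<in> ore_part i"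
    and ore_part_coefficient: "a \<in> A \<Longrightarrow> a \<in> ore_part i"
    and ore_part_mult_right: "x \<in> ore_part i \<Longrightarrow> a \<in> A \<Longrightarrow> x * a \<in> ore_part i"
    and ore_part_sum: "(\<And>j. j \<in> F \<Longrightarrow> f j \<in> ore_part i) \<Longrightarrow> sum f F \<in> ore_part i"
proof -
  show "x \<in> ore_part i \<Longrightarrow> y \<in> ore_part i \<Longrightarrow> x - y \<in> ore_part i"
    unfolding ore_part_def by (rule supported_diff)
  show "a \<in> A \<Longrightarrow> a \<in> ore_part i"
    unfolding ore_part_def by (rule supported_coefficient) simp_all
  show "x \<in> ore_part i \<Longrightarrow> a \<in> A \<Longrightarrow> x * a \<in> ore_part i"
    unfolding ore_part_def by (rule supported_mult_right)
  show "(\<And>j. j \<in> F \<Longrightarrow> f j \<in> ore_part i) \<Longrightarrow> sum f F \<in> ore_part i"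
    unfolding ore_part_def by (rule supported_sum)
qed

context
  fixes i :: 'i
  assumes i: "i \<in> I"
begin

lemma power_in_ore_part: "mon (Poly_Mapping.single i n) \<in> ore_part i"
  unfolding ore_part_def using i by (intro supported_mon) simp_all

lemma variable_mult_power: "u i * mon (Poly_Mapping.single i n) = mon (Poly_Mapping.single i (Suc n))"
  by (simp add: ordered_monomial_single)

lemma variable_mult_ore_part:
  assumes "x \<in> ore_part i" shows "u i * x \<in> ore_part i"
  unfolding ore_part_def
proof (rule supported_mult_left[OF _ assms[unfolded ore_part_def]])
  fix p :: "'i \<Rightarrow>\<^sub>0 nat" assume "p \<in> {p. Poly_Mapping.keys p \<subseteq> {i}}"
  then have p: "p = Poly_Mapping.single i (Poly_Mapping.lookup p i)" by (simp only: mem_Collect_eq keys_subset_singleton)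
  have "u i * mon p = mon (Poly_Mapping.single i (Suc (Poly_Mapping.lookup p i)))"
    by (subst p) (rule variable_mult_power)
  then show "u i * mon p \<in> supported {p. Poly_Mapping.keys p \<subseteq> {i}}"
    using power_in_ore_part by (simp only: ore_part_def)
qed

lemma coefficient_mult_ore_part:
  assumes "a \<in> A" "x \<in> ore_part i" shows "a * x \<in> ore_part i"
proof -
  have pow: "a * mon (Poly_Mapping.single i n) \<in> ore_part i" if "a \<in> A" for a n
    using that
  proof (induction n arbitrary: a)
    case 0
    then show ?case by (simp add: ore_part_coefficient)
  next
    case (Suc n)
    let ?b = "u i * a - a * u i"
    have b: "?b \<in> A" by (rule commutator_coefficient[OF u_in_U[OF i] Suc.prems])
    have "a * mon (Poly_Mapping.single i (Suc n)) =
        u i * (a * mon (Poly_Mapping.single i n)) - ?b * mon (Poly_Mapping.single i n)"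
      unfolding variable_mult_power[symmetric] by (simp add: left_diff_distrib mult.assoc)
    also have "\<dots> \<in> ore_part i"
      by (rule ore_part_diff[OF variable_mult_ore_part[OF Suc.IH[OF Suc.prems]] Suc.IH[OF b]])
    finally show ?case .
  qed
  show ?thesis
    unfolding ore_part_def
  proof (rule supported_mult_left[OF _ assms(2)[unfolded ore_part_def]])
    fix p :: "'i \<Rightarrow>\<^sub>0 nat" assume "p \<in> {p. Poly_Mapping.keys p \<subseteq> {i}}"
    then have p: "p = Poly_Mapping.single i (Poly_Mapping.lookup p i)" by (simp only: mem_Collect_eq keys_subset_singleton)
    show "a * mon p \<in> supported {p. Poly_Mapping.keys p \<subseteq> {i}}"
      using pow[OF assms(1), of "Poly_Mapping.lookup p i"] unfolding ore_part_def by (simp only: p[symmetric])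
  qed
qed

lemma ore_part_expansion:
  assumes "x \<in> ore_part i"
  shows "x = (\<Sum>p | coef x p \<noteq> 0. u i ^ Poly_Mapping.lookup p i * coef x p)"
proof -
  have "(\<Sum>p | coef x p \<noteq> 0. mon p * coef x p) = (\<Sum>p | coef x p \<noteq> 0. u i ^ Poly_Mapping.lookup p i * coef x p)"
  proof (rule sum.cong[OF refl])
    fix p assume "p \<in> {p. coef x p \<noteq> 0}"
    then have "Poly_Mapping.keys p \<subseteq> {i}" using assms unfolding ore_part_def supported_def by blast
    then have p: "p = Poly_Mapping.single i (Poly_Mapping.lookup p i)" by (simp only: keys_subset_singleton)
    have "mon p = u i ^ Poly_Mapping.lookup p i" by (subst p) (rule ordered_monomial_single)
    then show "mon p * coef x p = u i ^ Poly_Mapping.lookup p i * coef x p" by simp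
  qed
  with coef_expansion show ?thesis by (rule trans)
qed

lemma ore_part_mult:
  assumes x: "x \<in> ore_part i" and y: "y \<in> ore_part i" shows "x * y \<in> ore_part i"
proof -
  have pow: "u i ^ n * z \<in> ore_part i" if "z \<in> ore_part i" for n z
    using that by (induction n) (simp_all add: mult.assoc variable_mult_ore_part)
  have "x * y = (\<Sum>p | coef x p \<noteq> 0. u i ^ Poly_Mapping.lookup p i * coef x p) * y"
    by (rule arg_cong[OF ore_part_expansion[OF x]])
  also have "\<dots> = (\<Sum>p | coef x p \<noteq> 0. u i ^ Poly_Mapping.lookup p i * (coef x p * y))"
    by (simp only: sum_distrib_right mult.assoc)
  also have "\<dots> \<in> ore_part i"
    by (intro ore_part_sum pow coefficient_mult_ore_part coef_in_A y)
  finally show ?thesis .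
qed

lemma unital_subring_ore_part: "unital_subring (ore_part i)"
  unfolding unital_subring_def
  by (intro conjI ballI ore_part_coefficient[OF A_closed(1)] ore_part_diff ore_part_mult)

lemma ore_part_least:
  assumes S: "unital_subring S" and "A \<subseteq> S" "u i \<in> S"
  shows "ore_part i \<subseteq> S"
proof
  fix x assume x: "x \<in> ore_part i"
  have pow: "u i ^ n \<in> S" for n
    using unital_subringD[OF S] assms(3) by (induction n) simp_all
  have "coef x p \<in> S" for p using coef_in_A assms(2) by blast
  then have "(\<Sum>p | coef x p \<noteq> 0. u i ^ Poly_Mapping.lookup p i * coef x p) \<in> S"
    by (intro unital_subring_sum[OF S] unital_subringD(5)[OF S] pow)
  then show "x \<in> S" by (simp only: ore_part_expansion[OF x, symmetric])
qed

lemma coef_ore_part: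
  assumes "x \<in> ore_part i" "coef x p \<noteq> 0" shows "p = Poly_Mapping.single i (Poly_Mapping.lookup p i)"
proof -
  have "Poly_Mapping.keys p \<subseteq> {i}" using assms unfolding ore_part_def supported_def by blast
  then show ?thesis by (simp only: keys_subset_singleton)
qed

abbreviation exps_off :: "('i \<Rightarrow>\<^sub>0 nat) set" where "exps_off \<equiv> {p \<in> exps. Poly_Mapping.lookup p i = 0}"

interpretation deg: weighted_pbw_ring A I u U "\<lambda>_. Suc 0"
  by unfold_locales auto

text \<open>The products \<open>(u i)\<^sup>n * a * mon q\<close>, where \<open>q\<close> does not involve \<open>i\<close>, have leading terms \<open>mon p * a\<close>, where \<open>p\<close>
  runs once through all exponents. Having \<open>a\<close> in the middle lets the factors \<open>(u i)\<^sup>n * a\<close> sum up to left coefficients in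
  the Ore extension.\<close>

lemma ore_part_left_free: "left_free_extension (ore_part i) exps_off mon 0"
proof
  show "unital_subring (ore_part i)" by (rule unital_subring_ore_part)
  show "0 \<in> exps_off" "mon 0 = 1" by simp_all
next
  fix F r
  assume F: "finite F" "F \<subseteq> exps_off" and r: "\<forall>q\<in>F. r q \<in> ore_part i"
    and 0: "(\<Sum>q\<in>F. r q * mon q) = 0"
  let ?s = "\<lambda>n. Poly_Mapping.single i (n::nat)"
  define N where "N = (\<Union>q\<in>F. (\<lambda>p. Poly_Mapping.lookup p i) ` {p. coef (r q) p \<noteq> 0})"
  have fN: "finite N" unfolding N_def using F(1) coef_finite by simp
  have rq: "r q = (\<Sum>n\<in>N. u i ^ n * coef (r q) (?s n))" if q: "q \<in> F" for q
  proof -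
    have rin: "r q \<in> ore_part i" using r q by blast
    have inj: "inj_on (\<lambda>p. Poly_Mapping.lookup p i) {p. coef (r q) p \<noteq> 0}"
    proof (rule inj_onI)
      fix p p' assume "p \<in> {p. coef (r q) p \<noteq> 0}" "p' \<in> {p. coef (r q) p \<noteq> 0}"
      then have p: "p = ?s (Poly_Mapping.lookup p i)" and p': "p' = ?s (Poly_Mapping.lookup p' i)"
        using coef_ore_part[OF rin] by blast+
      assume "Poly_Mapping.lookup p i = Poly_Mapping.lookup p' i"
      then have "?s (Poly_Mapping.lookup p i) = ?s (Poly_Mapping.lookup p' i)" by (rule arg_cong)
      then show "p = p'" by (simp only: p[symmetric] p'[symmetric])
    qed
    have "(\<Sum>p | coef (r q) p \<noteq> 0. u i ^ Poly_Mapping.lookup p i * coef (r q) p) =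
        (\<Sum>p | coef (r q) p \<noteq> 0. u i ^ Poly_Mapping.lookup p i * coef (r q) (?s (Poly_Mapping.lookup p i)))"
    proof (rule sum.cong[OF refl])
      fix p assume "p \<in> {p. coef (r q) p \<noteq> 0}"
      then have p: "p = ?s (Poly_Mapping.lookup p i)" using coef_ore_part[OF rin] by blast
      show "u i ^ Poly_Mapping.lookup p i * coef (r q) p =
          u i ^ Poly_Mapping.lookup p i * coef (r q) (?s (Poly_Mapping.lookup p i))"
        by (simp only: p[symmetric])
    qed
    also have "\<dots> = (\<Sum>n\<in>(\<lambda>p. Poly_Mapping.lookup p i) ` {p. coef (r q) p \<noteq> 0}. u i ^ n * coef (r q) (?s n))"
      by (simp only: sum.reindex[OF inj] o_def)
    also have "\<dots> = (\<Sum>n\<in>N. u i ^ n * coef (r q) (?s n))"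
    proof (rule sum.mono_neutral_left[OF fN])
      show "(\<lambda>p. Poly_Mapping.lookup p i) ` {p. coef (r q) p \<noteq> 0} \<subseteq> N" unfolding N_def using q by blast
      show "\<forall>n\<in>N - (\<lambda>p. Poly_Mapping.lookup p i) ` {p. coef (r q) p \<noteq> 0}. u i ^ n * coef (r q) (?s n) = 0"
      proof
        fix n assume n: "n \<in> N - (\<lambda>p. Poly_Mapping.lookup p i) ` {p. coef (r q) p \<noteq> 0}"
        have "coef (r q) (?s n) = 0"
        proof (rule ccontr)
          assume "coef (r q) (?s n) \<noteq> 0"
          then have "Poly_Mapping.lookup (?s n) i \<in> (\<lambda>p. Poly_Mapping.lookup p i) ` {p. coef (r q) p \<noteq> 0}" by blast
          then show False using n by simp
        qed
        then show "u i ^ n * coef (r q) (?s n) = 0" by simp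
      qed
    qed
    finally show ?thesis using ore_part_expansion[OF rin] by (rule trans[rotated])
  qed
  \<comment> \<open>The exponent of the leading monomial of \<open>(u i)\<^sup>n * a * mon q\<close> for \<open>z = (n, q)\<close>.\<close>
  define h where "h z = ?s (fst z) + snd z" for z
  have h_inj: "inj_on h (N \<times> F)"
  proof (rule inj_onI)
    fix z z' assume z: "z \<in> N \<times> F" "z' \<in> N \<times> F" and eq: "h z = h z'"
    have "Poly_Mapping.lookup (snd z) i = 0" "Poly_Mapping.lookup (snd z') i = 0" using z F(2) by auto
    moreover have "Poly_Mapping.lookup (h z) i = Poly_Mapping.lookup (h z') i" using eq by simp
    ultimately have f: "fst z = fst z'" by (simp add: h_def lookup_add)
    then have "snd z = snd z'" using eq by (simp add: h_def)
    then show "z = z'" using f by (simp add: prod_eq_iff)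
  qed
  define k where "k = the_inv_into (N \<times> F) h"
  have k: "k (h z) = z" if "z \<in> N \<times> F" for z
    unfolding k_def by (rule the_inv_into_f_f[OF h_inj that])
  let ?G = "h ` (N \<times> F)"
  let ?c = "\<lambda>p. coef (r (snd (k p))) (?s (fst (k p)))"
  let ?t = "\<lambda>p. mon (?s (fst (k p))) * ?c p * mon (snd (k p))"
  have "\<forall>p\<in>?G. ?c p = 0"
  proof (rule deg.triangular_independent[where t = ?t])
    show "finite ?G" using fN F(1) by simp
    have sI: "?s n \<in> exps" for n using i by simp
    show "?G \<subseteq> exps"
    proof
      fix p assume "p \<in> ?G"
      then obtain z where z: "p = h z" "z \<in> N \<times> F" by blast
      then have "snd z \<in> F" by auto
      then have "Poly_Mapping.keys (snd z) \<subseteq> I" using F(2) by blast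
      then show "p \<in> exps" unfolding z(1) h_def using keys_add[of "?s (fst z)" "snd z"] sI[of "fst z"] by blast
    qed
    show "?c p \<in> A" for p by (rule coef_in_A)
    show "?t p - mon p * ?c p \<in> deg.lower (deg p)" if p: "p \<in> ?G" for p
    proof -
      obtain z where z: "p = h z" "z \<in> N \<times> F" using p by blast
      have "snd z \<in> F" using z(2) by auto
      then have e: "snd z \<in> exps" using F(2) by blast
      have "mon (?s (fst z)) * coef (r (snd z)) (?s (fst z)) * mon (snd z) - mon (h z) * coef (r (snd z)) (?s (fst z))
          \<in> deg.lower (deg (h z))"
        using deg.term_mult_lead[OF sI e coef_in_A] unfolding h_def wt_add .
      then show ?thesis by (simp only: z(1) k[OF z(2)])
    qed
    show "?t p = 0" if "?c p = 0" for p by (simp only: that mult_zero_right mult_zero_left)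
    have "(\<Sum>p\<in>?G. ?t p) = (\<Sum>z\<in>N \<times> F. mon (?s (fst z)) * coef (r (snd z)) (?s (fst z)) * mon (snd z))"
      by (subst sum.reindex[OF h_inj]) (rule sum.cong[OF refl], simp only: o_def k)
    also have "\<dots> = (\<Sum>n\<in>N. \<Sum>q\<in>F. u i ^ n * coef (r q) (?s n) * mon q)"
      by (simp add: sum.cartesian_product case_prod_beta ordered_monomial_single)
    also have "\<dots> = (\<Sum>q\<in>F. \<Sum>n\<in>N. u i ^ n * coef (r q) (?s n) * mon q)" by (rule sum.swap)
    also have "\<dots> = (\<Sum>q\<in>F. r q * mon q)"
    proof (rule sum.cong[OF refl])
      fix q assume q: "q \<in> F"
      have "r q * mon q = (\<Sum>n\<in>N. u i ^ n * coef (r q) (?s n)) * mon q" by (rule arg_cong[OF rq[OF q]])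
      then show "(\<Sum>n\<in>N. u i ^ n * coef (r q) (?s n) * mon q) = r q * mon q" by (simp only: sum_distrib_right)
    qed
    finally show "(\<Sum>p\<in>?G. ?t p) = 0" by (simp only: 0)
  qed
  then have c0: "coef (r q) (?s n) = 0" if "q \<in> F" "n \<in> N" for q n
    using that k[of "(n, q)"] by force
  show "\<forall>q\<in>F. r q = 0"
  proof
    fix q assume q: "q \<in> F"
    have "(\<Sum>n\<in>N. u i ^ n * coef (r q) (?s n)) = 0" using c0[OF q] by simp
    then show "r q = 0" by (rule trans[OF rq[OF q]])
  qed
next
  fix x
  let ?Y = "combinations (\<lambda>p r. r * mon p) exps_off (ore_part i)"
  show "x \<in> ?Y"
  proof (rule deg.triangular_span)
    show "y + z \<in> ?Y" if "y \<in> ?Y" "z \<in> ?Y" for y z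
      by (rule combinations_add[OF unital_subring_ore_part _ that]) (rule distrib_right)
    show "0 \<in> ?Y" by (rule combinations_0)
  next
    fix p a assume p: "p \<in> exps" and a: "a \<in> A"
    let ?s = "Poly_Mapping.single i (Poly_Mapping.lookup p i)"
    let ?q = "p - ?s"
    have pq: "?s + ?q = p"
      by (rule poly_mapping_eqI) (simp add: lookup_add lookup_minus lookup_single when_def)
    have q: "?q \<in> exps_off" using p by (auto simp: in_keys_iff lookup_minus)
    have "mon ?s * a * mon ?q - mon (?s + ?q) * a \<in> deg.lower (deg ?s + deg ?q)"
      using q i by (intro deg.term_mult_lead a) auto
    then have "mon ?s * a * mon ?q - mon p * a \<in> deg.lower (deg p)"
      by (simp only: wt_add[symmetric] pq)
    from supported_diff[OF supported_0 this]
    have "mon p * a - mon ?s * a * mon ?q \<in> deg.lower (deg p)" by simp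
    moreover have "mon ?s * a * mon ?q \<in> ?Y"
      using combinations_single[OF q ore_part_mult_right[OF power_in_ore_part a]] .
    ultimately show "\<exists>y\<in>?Y. mon p * a - y \<in> deg.lower (deg p)" by blast
  qed
qed

lemma pbw_domain:
  fixes x y :: 'b
  assumes "nc_domain A" "x \<noteq> 0" "y \<noteq> 0" shows "x * y \<noteq> 0"
proof (rule deg.leading_term_mult[OF assms])
  fix p q assume "coef (x * y) (p + q) \<noteq> 0"
  then show "x * y \<noteq> 0" by auto
qed

lemma ore_part_domain:
  assumes dom: "nc_domain A" shows "nc_domain (ore_part i)"
  unfolding nc_domain_def
proof (intro ballI impI, rule ccontr)
  fix x y :: 'b assume "x * y = 0" "\<not> (x = 0 \<or> y = 0)"
  then show False using pbw_domain[OF dom, of x y] by simp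
qed

text \<open>Give \<open>u i\<close> weight \<open>1\<close> and all other variables a weight \<open>N\<close> above every exponent of \<open>u i\<close> in \<open>x\<close> and \<open>y\<close>.
  The leading exponents of \<open>x\<close> and \<open>y\<close> add up to one of \<open>x * y\<close>, so they involve only \<open>i\<close> and have weight
  below \<open>N\<close>. No monomial of \<open>x\<close> or \<open>y\<close> can then involve another variable.\<close>

lemma ore_part_factor_closed:
  assumes dom: "nc_domain A" and xy: "x * y \<in> ore_part i" "x * y \<noteq> 0"
  shows "x \<in> ore_part i \<and> y \<in> ore_part i"
proof -
  let ?E = "(\<lambda>p. Poly_Mapping.lookup p i) ` ({p. coef x p \<noteq> 0} \<union> {p. coef y p \<noteq> 0})"
  define N where "N = Suc (Max (insert 0 ?E))"
  have fin: "finite (insert 0 ?E)" using coef_finite by simp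
  have bound: "Poly_Mapping.lookup p i < N" if "coef x p \<noteq> 0 \<or> coef y p \<noteq> 0" for p
    unfolding N_def less_Suc_eq_le using that by (intro Max_ge[OF fin]) auto
  define w where "w k = (if k = i then 1 else N)" for k
  have N: "0 < N" by (simp add: N_def)
  interpret w: weighted_pbw_ring A I u U w
    by unfold_locales (use N in \<open>auto simp: w_def\<close>)
  have "x \<noteq> 0" "y \<noteq> 0" using xy(2) by auto
  then obtain p q where p: "coef x p \<noteq> 0" "\<forall>p'. coef x p' \<noteq> 0 \<longrightarrow> wt w p' \<le> wt w p"
    and q: "coef y q \<noteq> 0" "\<forall>q'. coef y q' \<noteq> 0 \<longrightarrow> wt w q' \<le> wt w q"
    and pq: "coef (x * y) (p + q) \<noteq> 0"
    by (rule w.leading_term_mult[OF dom])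
  have "Poly_Mapping.keys (p + q) \<subseteq> {i}" using xy(1) pq unfolding ore_part_def supported_def by blast
  moreover have "Poly_Mapping.keys p \<subseteq> Poly_Mapping.keys (p + q)" "Poly_Mapping.keys q \<subseteq> Poly_Mapping.keys (p + q)"
    by (auto simp: in_keys_iff lookup_add)
  ultimately have "p = Poly_Mapping.single i (Poly_Mapping.lookup p i)" "q = Poly_Mapping.single i (Poly_Mapping.lookup q i)"
    by (simp_all only: keys_subset_singleton[symmetric])
  then have "wt w p = w i * Poly_Mapping.lookup p i" "wt w q = w i * Poly_Mapping.lookup q i"
    using wt_single[of w i] by metis+
  then have wN: "wt w p < N" "wt w q < N" using bound p(1) q(1) by (simp_all add: w_def)
  have small: "Poly_Mapping.keys p' \<subseteq> {i}" if p': "wt w p' < N" for p'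
  proof
    fix k assume k: "k \<in> Poly_Mapping.keys p'"
    show "k \<in> {i}"
    proof (rule ccontr)
      assume "k \<notin> {i}"
      then have "N \<le> w k * Poly_Mapping.lookup p' k" using k by (simp add: w_def in_keys_iff)
      also have "\<dots> \<le> wt w p'" unfolding wt_def using k by (intro member_le_sum) auto
      finally show False using p' by simp
    qed
  qed
  have "x \<in> ore_part i" unfolding ore_part_def supported_def
    using small le_less_trans[OF p(2)[rule_format] wN(1)] by simp
  moreover have "y \<in> ore_part i" unfolding ore_part_def supported_def
    using small le_less_trans[OF q(2)[rule_format] wN(2)] by simp
  ultimately show ?thesis ..
qed

text \<open>To solve \<open>f * s + g * t = 0\<close>, take for \<open>s\<close> and \<open>t\<close> polynomials of degree at most \<open>D\<close> with unknown coefficients,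
  where \<open>f\<close> and \<open>g\<close> have degree below \<open>D\<close>. These are \<open>2 (D + 1)\<close> unknowns, and the \<open>2 D\<close> coefficients of the left side have to
  vanish. Over the Ore domain \<open>A\<close>, a system with fewer equations than unknowns has a nontrivial solution.\<close>

lemma ore_part_right_ore:
  assumes dom: "nc_domain A" and ore: "right_ore A"
  shows "right_ore (ore_part i)"
  unfolding right_ore_def
proof (intro ballI impI)
  fix f g assume f: "f \<in> ore_part i" "f \<noteq> 0" and g: "g \<in> ore_part i" "g \<noteq> 0"
  let ?s = "\<lambda>n. Poly_Mapping.single i (n::nat)"
  obtain Df where Df: "f \<in> deg.lower Df" by (rule deg.lower_UNIV)
  obtain Dg where Dg: "g \<in> deg.lower Dg" by (rule deg.lower_UNIV)
  define D where "D = max Df Dg"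
  have D: "f \<in> deg.lower D" "g \<in> deg.lower D"
    by (rule supported_mono[OF Df], auto simp: D_def) (rule supported_mono[OF Dg], auto simp: D_def)
  have lower_mult: "x * mon (?s l) \<in> deg.lower (D + l)" if x: "x \<in> deg.lower D" for x l
  proof -
    have "x * mon (?s l) = (\<Sum>p | coef x p \<noteq> 0. mon p * coef x p) * mon (?s l)"
      by (rule arg_cong[OF coef_expansion])
    also have "\<dots> = (\<Sum>p | coef x p \<noteq> 0. mon p * (coef x p * mon (?s l)))"
      by (simp only: sum_distrib_right mult.assoc)
    also have "\<dots> \<in> deg.lower (D + l)"
    proof (rule supported_sum)
      fix p assume "p \<in> {p. coef x p \<noteq> 0}"
      then have p: "p \<in> exps" "deg p < D" using coef_exps[of x p] x unfolding supported_def by blast+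
      have "mon (?s l) \<in> deg.lower (Suc l)" using i by (intro supported_mon) simp_all
      then have "mon p * (coef x p * mon (?s l)) \<in> deg.lower (deg p + Suc l)"
        by (intro deg.mon_mult_lower p deg.coefficient_mult_lower coef_in_A)
      then show "mon p * (coef x p * mon (?s l)) \<in> deg.lower (D + l)"
        by (rule supported_mono) (use p(2) in auto)
    qed
    finally show ?thesis .
  qed
  let ?J = "(UNIV :: bool set) \<times> {..D}"
  \<comment> \<open>The columns of the system: the contributions of the single unknowns to \<open>f * s + g * t\<close>.\<close>
  define e where "e j = (if fst j then f else g) * mon (?s (snd j))" for j :: "bool \<times> nat"
  have e: "e j \<in> ore_part i" "e j \<in> deg.lower (D + snd j)" for j
    unfolding e_def using f(1) g(1) D power_in_ore_part by (auto intro!: ore_part_mult lower_mult)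
  have "\<exists>c. (\<forall>j. c j \<in> A) \<and> (\<exists>j\<in>?J. c j \<noteq> 0) \<and> (\<forall>q\<in>{..<2 * D}. (\<Sum>j\<in>?J. coef (e j) (?s q) * c j) = 0)"
  proof (rule right_ore_dependent[OF subring_A dom ore])
    show "card {..<2 * D} < card ?J" by (simp add: card_cartesian_product)
  qed (simp_all add: coef_in_A)
  then obtain c where c: "\<forall>j. c j \<in> A" "\<exists>j\<in>?J. c j \<noteq> 0"
    and rel: "\<forall>q\<in>{..<2 * D}. (\<Sum>j\<in>?J. coef (e j) (?s q) * c j) = 0" by (elim exE conjE)
  define S where "S b = (\<Sum>l\<le>D. mon (?s l) * c (b, l))" for b
  have S: "S b \<in> ore_part i" for b
    unfolding S_def using c(1) by (intro ore_part_sum ore_part_mult_right power_in_ore_part) blast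
  have coef_S: "coef (S b) (?s l) = c (b, l)" if l: "l \<le> D" for b l
  proof -
    have "coef (S b) (?s l) = (\<Sum>k\<le>D. coef (mon (?s k) * c (b, k)) (?s l))"
      unfolding S_def by (rule coef_sum)
    also have "\<dots> = (\<Sum>k\<le>D. if k = l then c (b, l) else 0)"
      using i c(1) by (intro sum.cong[OF refl]) (auto simp: coef_mon_mult dest: inj_onD[OF inj_single])
    also have "\<dots> = c (b, l)" using l by simp
    finally show ?thesis .
  qed
  let ?z = "\<Sum>j\<in>?J. e j * c j"
  have z: "?z = f * S True + g * S False"
  proof -
    have "?z = (\<Sum>b\<in>UNIV. \<Sum>l\<le>D. e (b, l) * c (b, l))"
      by (simp add: sum.cartesian_product case_prod_beta)
    also have "\<dots> = f * S True + g * S False"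
      by (simp add: UNIV_bool e_def S_def sum_distrib_left mult.assoc add.commute)
    finally show ?thesis .
  qed
  have "?z = 0"
  proof (rule coef_eq_0I)
    fix p
    have "?z \<in> ore_part i" by (intro ore_part_sum ore_part_mult_right e(1) spec[OF c(1)])
    note zp = coef_ore_part[OF this, of p]
    show "coef ?z p = 0"
    proof (rule ccontr)
      assume nz: "coef ?z p \<noteq> 0"
      have cz: "coef ?z p = (\<Sum>j\<in>?J. coef (e j) p * c j)"
        by (simp only: coef_sum coef_mult_right[OF spec[OF c(1)]])
      define q where "q = Poly_Mapping.lookup p i"
      have p: "p = ?s q" unfolding q_def by (rule zp[OF nz])
      show False
      proof (cases "q < 2 * D")
        case True
        then show False using rel nz cz unfolding p by simp
      next
        case False
        have "coef (e j) p = 0" if "j \<in> ?J" for j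
          using that False by (intro deg.coef_lower[OF e(2)]) (auto simp: p)
        then have "(\<Sum>j\<in>?J. coef (e j) p * c j) = 0" by (intro sum.neutral) simp
        then show False using nz cz by simp
      qed
    qed
  qed
  then have fg: "f * S True = g * (- S False)" using z by (simp add: eq_neg_iff_add_eq_0)
  have "S True \<noteq> 0"
  proof
    assume T: "S True = 0"
    then have "g * S False = 0" using fg by simp
    then have "S False = 0" using pbw_domain[OF dom g(2)] by blast
    then have "S b = 0" for b using T by (cases b) simp_all
    then have "c (b, l) = 0" if "l \<le> D" for b l using coef_S[OF that, of b] by simp
    then show False using c(2) by auto
  qed
  then have "f * S True \<noteq> 0" by (rule pbw_domain[OF dom f(2)])
  moreover have "- S False \<in> ore_part i" by (rule unital_subringD(6)[OF unital_subring_ore_part S])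
  ultimately show "\<exists>s\<in>ore_part i. \<exists>t\<in>ore_part i. f * s = g * t \<and> f * s \<noteq> 0"
    using fg S by blast
qed

lemma ore_part_extension:
  assumes dom: "nc_domain A" and ore: "right_ore A"
  shows "factor_closed_extension (ore_part i) exps_off mon 0"
  by (rule factor_closed_extension.intro[OF ore_part_left_free
        factor_closed_extension_axioms.intro[OF ore_part_domain[OF dom] ore_part_right_ore[OF dom ore]]])
    (rule ore_part_factor_closed[OF dom])

end

end

section \<open>Crossed products\<close>

context crossed_product
begin

lemma scalar_in_A: "scaleB c 1 \<in> A"
  using subalgebra_A unfolding subalgebra_def by blast

lemma scale_eq_mult: "scaleB c x = x * scaleB c 1"
  using B.scale_mult_right[of x c 1] by simp

lemma bar_combination:
  shows "\<exists>T a. finite T \<and> T \<subseteq> I \<and> x = (\<Sum>k\<in>T. scaleG (a k) (e k)) \<and>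
    bar x = (\<Sum>k\<in>T. bar (e k) * scaleB (a k) 1)"
proof -
  interpret bar: Vector_Spaces.linear scaleG scaleB bar by (rule bar_linear)
  have "x \<in> G.span (e ` I)" using basis_span by simp
  then obtain t r where t: "finite t" "t \<subseteq> e ` I" "x = (\<Sum>v\<in>t. scaleG (r v) v)"
    unfolding G.span_explicit by blast
  obtain T where T: "T \<subseteq> I" "finite T" "t = e ` T" using finite_subset_image[OF t(1,2)] by blast
  have "inj_on e T" using basis_inj T(1) by (rule inj_on_subset)
  then have x: "x = (\<Sum>k\<in>T. scaleG (r (e k)) (e k))" using t(3) T(3) by (simp add: sum.reindex)
  have "bar x = (\<Sum>k\<in>T. scaleB (r (e k)) (bar (e k)))"
    unfolding x by (simp only: bar.sum bar.scale)
  then have "bar x = (\<Sum>k\<in>T. bar (e k) * scaleB (r (e k)) 1)" by (simp only: scale_eq_mult[symmetric])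
  then show ?thesis using T x by (intro exI[of _ T] exI[of _ "\<lambda>k. r (e k)"] conjI)
qed

lemma unital_subring_A: "unital_subring A"
  using subalgebra_A unfolding subalgebra_def unital_subring_def by blast

lemma pbw_ring_bar: "pbw_ring A I (\<lambda>i. bar (e i)) (range bar)"
proof
  show "unital_subring A" by (rule unital_subring_A)
  show "is_right_basis A (*) UNIV {p. Poly_Mapping.keys p \<subseteq> I} (ordered_monomial (\<lambda>i. bar (e i)))"
    by (rule monomial_basis)
  show "x * a - a * x \<in> A" if "x \<in> range bar" "a \<in> A" for x a
    using that commutator_derivation unfolding derivation_def by auto
  show "\<exists>z\<in>range bar. x * y - y * x - z \<in> A" if "x \<in> range bar" "y \<in> range bar" for x y
    using that commutator_bracket by blast
  show "\<exists>T c. finite T \<and> T \<subseteq> I \<and> (\<forall>k\<in>T. c k \<in> A) \<and> x = (\<Sum>k\<in>T. bar (e k) * c k)" if x: "x \<in> range bar" for x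
  proof -
    obtain y where y: "x = bar y" using x by blast
    obtain T a where "finite T" "T \<subseteq> I" "bar y = (\<Sum>k\<in>T. bar (e k) * scaleB (a k) 1)"
      using bar_combination[of y] by (elim exE conjE)
    then show ?thesis unfolding y using scalar_in_A
      by (intro exI[of _ T] exI[of _ "\<lambda>k. scaleB (a k) 1"] conjI ballI)
  qed
qed simp

text \<open>Some basis vector has a nonzero, hence invertible, scalar coefficient in \<open>g\<close>; exchange that one for \<open>g\<close>.\<close>

lemma bar_as_variable:
  assumes "g \<noteq> 0"
  obtains i where "i \<in> I" "pbw_ring A I ((\<lambda>i. bar (e i))(i := bar g)) (range bar)"
proof -
  obtain T a where T: "finite T" "T \<subseteq> I" and g: "g = (\<Sum>k\<in>T. scaleG (a k) (e k))"
    and bg: "bar g = (\<Sum>k\<in>T. bar (e k) * scaleB (a k) 1)"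
    using bar_combination[of g] by (elim exE conjE)
  have "\<exists>i\<in>T. a i \<noteq> 0"
  proof (rule ccontr)
    assume "\<not> ?thesis"
    then have "(\<Sum>k\<in>T. scaleG (a k) (e k)) = 0" by (intro sum.neutral) simp
    then show False using assms g by simp
  qed
  then obtain i where i: "i \<in> T" "a i \<noteq> 0" by blast
  have "scaleB (a i) 1 * scaleB (inverse (a i)) 1 = 1" "scaleB (inverse (a i)) 1 * scaleB (a i) 1 = 1"
    using i(2) by (simp_all add: scale_eq_mult[symmetric])
  then have "pbw_ring A I ((\<lambda>i. bar (e i))(i := bar g)) (range bar)"
    using pbw_ring_exchange[OF pbw_ring_bar _ T scalar_in_A bg i(1) scalar_in_A] by blast
  then show ?thesis using that i(1) T(2) by blast
qed

lemma subalgebra_hull_eq_ore_part: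
  assumes "i \<in> I" "pbw_ring A I v U" "v i = bar g"
  shows "subalgebra scaleB hull insert (bar g) A = pbw_ring.ore_part A I v i"
proof (rule hull_unique)
  interpret pbw_ring A I v U by fact
  have R: "unital_subring (ore_part i)" by (rule unital_subring_ore_part[OF assms(1)])
  have v: "v i \<in> ore_part i"
    using power_in_ore_part[OF assms(1), of 1] by (simp add: ordered_monomial_single del: One_nat_def)
  then show "insert (bar g) A \<subseteq> ore_part i" using ore_part_coefficient assms(3) by auto
  have "scaleB c x \<in> ore_part i" if "x \<in> ore_part i" for c x
    using ore_part_mult_right[OF that scalar_in_A] by (simp only: scale_eq_mult[symmetric])
  then show "subalgebra scaleB (ore_part i)"
    using R unfolding subalgebra_def unital_subring_def by blast
  fix S assume S: "insert (bar g) A \<subseteq> S" "subalgebra scaleB S"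
  have "unital_subring S" using S(2) unfolding subalgebra_def unital_subring_def by blast
  then show "ore_part i \<subseteq> S" using S(1) assms(3) by (intro ore_part_least[OF assms(1)]) auto
qed

end

theorem theorem6p2:
  fixes scaleB :: "'k::field \<Rightarrow> 'b::ring_1 \<Rightarrow> 'b"
    and scaleG :: "'k \<Rightarrow> 'g::ab_group_add \<Rightarrow> 'g"
    and bracket :: "'g \<Rightarrow> 'g \<Rightarrow> 'g"
    and A A1 K :: "'b set"
    and I :: "'i::linorder set" and e :: "'i \<Rightarrow> 'g"
    and bar :: "'g \<Rightarrow> 'b" and g :: 'g
  assumes "crossed_product scaleB scaleG bracket A I e bar"
    and "nc_domain A" and "noetherian A"
    and "g \<noteq> 0"
    and "A1 = subalgebra scaleB hull insert (bar g) A"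
    and "IBN A" and "IBN A1" and "IBN (UNIV :: 'b set)"
    and "right_ideal A1 K"
    and "stably_free A1 (*) K" and "\<not> free_module A1 (*) K"
  shows "right_ideal UNIV (extend_ideal K UNIV)
    \<and> is_tensor_product A1 (*) K (*) UNIV (extend_ideal K UNIV) (*)
    \<and> stably_free UNIV (*) (extend_ideal K UNIV)
    \<and> \<not> free_module UNIV (*) (extend_ideal K UNIV)"
proof -
  interpret crossed_product scaleB scaleG bracket A I e bar by fact
  obtain i where i: "i \<in> I" and pbw: "pbw_ring A I ((\<lambda>i. bar (e i))(i := bar g)) (range bar)"
    by (rule bar_as_variable[OF assms(4)])
  let ?v = "(\<lambda>i. bar (e i))(i := bar g)"
  have A1: "A1 = pbw_ring.ore_part A I ?v i"
    unfolding assms(5) by (rule subalgebra_hull_eq_ore_part[OF i pbw]) simp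
  have "right_ore A" by (rule noetherian_domain_right_ore[OF unital_subring_A assms(2,3)])
  then interpret factor_closed_extension A1 "{p \<in> {p. Poly_Mapping.keys p \<subseteq> I}. Poly_Mapping.lookup p i = 0}"
    "ordered_monomial ?v" 0
    unfolding A1 by (rule pbw_ring.ore_part_extension[OF pbw i assms(2)])
  show ?thesis
    using right_ideal_extend[OF assms(9)] tensor_product_extend[OF assms(9)]
      stably_free_extend[OF assms(9,10)] free_extend_imp_free[OF assms(9,10,8)] assms(11)
    by blast
qed

end
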